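(* Let $\Pi$ be a deterministic, memoryless $\{\textsc{Bland},\textsc{Dantzig},\textsc{LargestIncrease}\}$-ranking-based pivot rule. Then there exists a family of linear programs, with $N$ denoting the number of non-zero entries of the constraint matrix, such that the simplex method with pivot rule $\Pi$ takes $\Omega(2^{\sqrt N})$ iterations.
   Context: Linear programs are of the form $\max\, c^\top x$ s.t. $Ax=b$, $x\ge0$, with $A\in\mathbb{Q}^{m\times n}$ of full row rank, assumed feasible and bounded, with an initial feasible basis given. A basis $B\subseteq[n]$ is a set of $m$ indices of linearly independent columns; it is feasible if the associated basic solution is $\ge0$. Reduced costs: $\mathrm{rc}(i)=c_i-c_B^\top A_{\cdot B}^{-1}A_{\cdot i}$; improving indices $\Gamma^+(B)=\{i\notin B:\mathrm{rc}(i)>0\}$. An iteration moves from $B$ to a feasible basis $B\cup\{i\}\setminus\{j\}$ with $i\in\Gamma^+(B)$; the method stops when $\Gamma^+(B)=\emptyset$. For a non-degenerate program, $B[i]$ denotes the unique feasible basis obtained by entering $i$, with basic feasible solution $x[i]$. Neighbor rankings: for a feasible basis $B$ they give total preorders on $\Gamma^+(B)$ ($i\preceq j$ means $j$ is at least as preferred): \textsc{Bland}: $i\preceq j$ iff $j\le i$ (smaller index preferred); \textsc{Dantzig}: $i\preceq j$ iff $\mathrm{rc}(i)\le\mathrm{rc}(j)$; \textsc{LargestIncrease}: $i\preceq j$ iff $c^\top x[i]\le c^\top x[j]$. A deterministic memoryless pivot rule $\Pi$ assigns to each program and feasible non-optimal basis $B$ an entering index in $\Gamma^+(B)$ (no ties;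 the leaving index is then determined in non-degenerate programs). It is $\{\textsc{Bland},\textsc{Dantzig},\textsc{LargestIncrease}\}$-ranking-based if its choice depends only on these three preorders in the following sense: for any two programs (of any sizes) with feasible non-optimal bases $B,B'$ and any bijection $\varphi:\Gamma^+(B)\to\Gamma^+(B')$ such that $i\preceq_B j\iff\varphi(i)\preceq_{B'}\varphi(j)$ for all $i,j$ and each of the three rankings, if $\Pi$ selects $i$ at $B$ then it selects $\varphi(i)$ at $B'$. *)

theory Defs
  imports Complex_Main
begin

text \<open>A linear program  max c^T x  s.t.  A x = b, x \<ge> 0  with A an m x n rational matrix.
  Rows are indexed by 0..<m, columns by 0..<n (the order of indices is the one used by Bland).
  Entries outside these ranges are irrelevant junk.\<close>

record lp =
  nrows :: nat
  ncols :: nat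
  mat   :: "nat \<Rightarrow> nat \<Rightarrow> rat"
  rhs   :: "nat \<Rightarrow> rat"
  obj   :: "nat \<Rightarrow> rat"

definition feasible_point :: "lp \<Rightarrow> (nat \<Rightarrow> rat) \<Rightarrow> bool" where
  "feasible_point P x \<longleftrightarrow>
     (\<forall>j. ncols P \<le> j \<longrightarrow> x j = 0) \<and> (\<forall>j. 0 \<le> x j) \<and>
     (\<forall>r<nrows P. (\<Sum>j<ncols P. mat P r j * x j) = rhs P r)"

definition objval :: "lp \<Rightarrow> (nat \<Rightarrow> rat) \<Rightarrow> rat" where
  "objval P x = (\<Sum>j<ncols P. obj P j * x j)"

definition bounded_lp :: "lp \<Rightarrow> bool" where
  "bounded_lp P \<longleftrightarrow> (\<exists>M. \<forall>x. feasible_point P x \<longrightarrow> objval P x \<le> M)"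

definition is_basis :: "lp \<Rightarrow> nat set \<Rightarrow> bool" where
  "is_basis P B \<longleftrightarrow> B \<subseteq> {..<ncols P} \<and> card B = nrows P \<and>
     (\<forall>l :: nat \<Rightarrow> rat. (\<forall>r<nrows P. (\<Sum>j\<in>B. l j * mat P r j) = 0) \<longrightarrow> (\<forall>j\<in>B. l j = 0))"

text \<open>The basic solution associated with a basis (unique for a basis).\<close>
definition basic_sol :: "lp \<Rightarrow> nat set \<Rightarrow> nat \<Rightarrow> rat" where
  "basic_sol P B = (THE x. (\<forall>j. j \<notin> B \<longrightarrow> x j = 0) \<and>
     (\<forall>r<nrows P. (\<Sum>j<ncols P. mat P r j * x j) = rhs P r))"

definition feasible_basis :: "lp \<Rightarrow> nat set \<Rightarrow> bool" where
  "feasible_basis P B \<longleftrightarrow> is_basis P B \<and> (\<forall>j. 0 \<le> basic_sol P B j)"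

text \<open>The row vector  c_B^T A_B^{-1}  (the unique y with  y^T A_B = c_B).\<close>
definition dual_sol :: "lp \<Rightarrow> nat set \<Rightarrow> nat \<Rightarrow> rat" where
  "dual_sol P B = (THE y. (\<forall>r. nrows P \<le> r \<longrightarrow> y r = 0) \<and>
     (\<forall>j\<in>B. (\<Sum>r<nrows P. y r * mat P r j) = obj P j))"

definition red_cost :: "lp \<Rightarrow> nat set \<Rightarrow> nat \<Rightarrow> rat" where
  "red_cost P B i = obj P i - (\<Sum>r<nrows P. dual_sol P B r * mat P r i)"

definition improving :: "lp \<Rightarrow> nat set \<Rightarrow> nat set" where
  "improving P B = {i. i < ncols P \<and> i \<notin> B \<and> 0 < red_cost P B i}"

definition nondegenerate :: "lp \<Rightarrow> bool" where
  "nondegenerate P \<longleftrightarrow> (\<forall>B. feasible_basis P B \<longrightarrow> (\<forall>j\<in>B. 0 < basic_sol P B j))"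

text \<open>B[i]: the (unique, in a non-degenerate program) feasible basis obtained by entering i,
  and x[i] its basic feasible solution.\<close>
definition enter_basis :: "lp \<Rightarrow> nat set \<Rightarrow> nat \<Rightarrow> nat set" where
  "enter_basis P B i = (THE B'. \<exists>j\<in>B. B' = (insert i B) - {j} \<and> feasible_basis P B')"

definition enter_sol :: "lp \<Rightarrow> nat set \<Rightarrow> nat \<Rightarrow> nat \<Rightarrow> rat" where
  "enter_sol P B i = basic_sol P (enter_basis P B i)"

text \<open>The three neighbor rankings:  R P B i j  means  i \<preceq> j  (j at least as preferred).\<close>
definition bland_le :: "lp \<Rightarrow> nat set \<Rightarrow> nat \<Rightarrow> nat \<Rightarrow> bool" where
  "bland_le P B i j \<longleftrightarrow> j \<le> i"

definition dantzig_le :: "lp \<Rightarrow> nat set \<Rightarrow> nat \<Rightarrow> nat \<Rightarrow> bool" where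
  "dantzig_le P B i j \<longleftrightarrow> red_cost P B i \<le> red_cost P B j"

definition largest_increase_le :: "lp \<Rightarrow> nat set \<Rightarrow> nat \<Rightarrow> nat \<Rightarrow> bool" where
  "largest_increase_le P B i j \<longleftrightarrow> objval P (enter_sol P B i) \<le> objval P (enter_sol P B j)"

text \<open>The class of programs considered: bounded, non-degenerate (feasibility and full row rank
  follow from the existence of the feasible basis that is always given alongside).\<close>
definition admissible_lp :: "lp \<Rightarrow> bool" where
  "admissible_lp P \<longleftrightarrow> bounded_lp P \<and> nondegenerate P"

definition pivot_rule :: "(lp \<Rightarrow> nat set \<Rightarrow> nat) \<Rightarrow> bool" where
  "pivot_rule \<Pi> \<longleftrightarrow> (\<forall>P B. admissible_lp P \<longrightarrow> feasible_basis P B \<longrightarrow> improving P B \<noteq> {} \<longrightarrow>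
      \<Pi> P B \<in> improving P B)"

definition preserves_ranking ::
  "(lp \<Rightarrow> nat set \<Rightarrow> nat \<Rightarrow> nat \<Rightarrow> bool) \<Rightarrow> lp \<Rightarrow> nat set \<Rightarrow> lp \<Rightarrow> nat set \<Rightarrow> (nat \<Rightarrow> nat) \<Rightarrow> bool" where
  "preserves_ranking R P B P' B' \<phi> \<longleftrightarrow>
     (\<forall>i\<in>improving P B. \<forall>j\<in>improving P B. R P B i j \<longleftrightarrow> R P' B' (\<phi> i) (\<phi> j))"

definition ranking_based_BDL :: "(lp \<Rightarrow> nat set \<Rightarrow> nat) \<Rightarrow> bool" where
  "ranking_based_BDL \<Pi> \<longleftrightarrow>
     (\<forall>P B P' B' \<phi>.
        admissible_lp P \<longrightarrow> feasible_basis P B \<longrightarrow> improving P B \<noteq> {} \<longrightarrow>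
        admissible_lp P' \<longrightarrow> feasible_basis P' B' \<longrightarrow> improving P' B' \<noteq> {} \<longrightarrow>
        bij_betw \<phi> (improving P B) (improving P' B') \<longrightarrow>
        preserves_ranking bland_le P B P' B' \<phi> \<longrightarrow>
        preserves_ranking dantzig_le P B P' B' \<phi> \<longrightarrow>
        preserves_ranking largest_increase_le P B P' B' \<phi> \<longrightarrow>
        \<Pi> P' B' = \<phi> (\<Pi> P B))"

definition simplex_runs_at_least :: "(lp \<Rightarrow> nat set \<Rightarrow> nat) \<Rightarrow> lp \<Rightarrow> nat set \<Rightarrow> nat \<Rightarrow> bool" where
  "simplex_runs_at_least \<Pi> P B0 T \<longleftrightarrow>
     (\<exists>Bs :: nat \<Rightarrow> nat set. Bs 0 = B0 \<and> feasible_basis P B0 \<and>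
        (\<forall>t<T. improving P (Bs t) \<noteq> {} \<and>
           (\<exists>j\<in>Bs t. Bs (Suc t) = insert (\<Pi> P (Bs t)) (Bs t) - {j}) \<and>
           feasible_basis P (Bs (Suc t))))"

definition nnz :: "lp \<Rightarrow> nat" where
  "nnz P = card {(r, j). r < nrows P \<and> j < ncols P \<and> mat P r j \<noteq> 0}"

end

theory Submission
  imports Defs "HOL-Library.Product_Lexorder"
begin

text \<open>The programs are flow formulations of two-action Markov decision processes. Every feasible point is
  positive in each of the column pairs (one pair per state), so the feasible bases are exactly policies,
  entering an improving column switches one state, and non-degeneracy is automatic. Giving the state at
  position \<open>i\<close> a source and a column scale of size \<open>R ^ i\<close>, with \<open>R\<close> huge, makes the reduced costs and the
  objective increases of the improving columns grow strictly with the index. On such programs a ranking-based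
  rule is a mere function \<open>r\<close>: among \<open>K\<close> improving columns it takes the one of rank \<open>r K\<close> from below.

  Suppose first that \<open>3 * n \<le> r K\<close> for some \<open>K \<le> 350 * n\<^sup>2\<close>, for infinitely many \<open>n\<close>. Then an odometer
  with \<open>n\<close> wheels of a large fixed base is built that always has exactly three improving columns per wheel,
  the intended one having the largest index; columns that are always improving are added below and above to
  bring the intended column to rank \<open>r K\<close> among \<open>K\<close>. A large base is needed because these additional
  columns already cost about \<open>n\<^sup>2\<close> non-zero entries.

  Otherwise, for all large \<open>n\<close>, the rule takes one of the \<open>3 * n\<close> lowest improving columns as long as there
  are at most \<open>350 * n\<^sup>2\<close> of them. Then each bit of a Gray code counter of Klee-Minty type is replaced by a
  majority vote among \<open>6 * n + 1\<close> voters. However the rule chooses among the lowest columns, a bit can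
  flip only when the majorities of all less significant bits are settled.\<close>

section \<open>Bases and the simplex step\<close>

text \<open>The ranking by objective increase shapes the construction. The increase of a switch at
  \<open>s\<close> is its advantage times the flow through \<open>s\<close> afterwards, and this
  flow collects the sources of all states leading to \<open>s\<close>; it stays comparable to
  \<open>R ^ idx s\<close> only if these states have smaller indices. In a counter the fast
  components lead into the slow ones, so slow moves get large indices. A rule taking low ranks thus
  serves the fast components first, as desired. For high ranks this order is wrong. The odometer
  therefore prepares each hand by a latch, through which hardly anything flows and whose index is
  free; only the hand, moved when all faster wheels have finished, carries their flow.

  The constants balance the two cases. For low ranks, \<open>50 * n\<close> bits have at most
  \<open>50 * n * (6 * n + 1)\<close> improving columns, hence the bound
  \<open>350 * n\<^sup>2\<close>, and cost at most \<open>(50 * n)\<^sup>2\<close> entries. For high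
  ranks, up to \<open>350 * n\<^sup>2\<close> additional states cost two entries each, and base
  \<open>2 ^ 32\<close> makes \<open>n\<close> wheels count to \<open>2 ^ (32 * n)\<close>, where
  \<open>(32 * n)\<^sup>2 = 1024 * n\<^sup>2\<close>.\<close>

lemma square_system_solvable:
  fixes a :: "'r \<Rightarrow> 'c \<Rightarrow> 'f::field"
  assumes "finite R" "finite C" "card R = card C"
    and ker: "\<And>l. \<lbrakk>\<And>r. r \<in> R \<Longrightarrow> (\<Sum>c\<in>C. l c * a r c) = 0\<rbrakk> \<Longrightarrow> \<forall>c\<in>C. l c = 0"
  shows "\<exists>x. \<forall>r\<in>R. (\<Sum>c\<in>C. x c * a r c) = b r"
  using assms
proof (induction "card C" arbitrary: R C a b)
  case 0
  then show ?case by auto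
next
  case (Suc n)
  obtain c where c: "c \<in> C" using Suc.hyps(2) by (metis card.empty ex_in_conv nat.distinct(1))
  have "\<exists>r\<in>R. a r c \<noteq> 0"
  proof (rule ccontr)
    assume no: "\<not> ?thesis"
    have "\<forall>c'\<in>C. (if c' = c then 1 else 0 :: 'f) = 0"
    proof (rule Suc.prems(4))
      fix r assume "r \<in> R"
      have "(\<Sum>c'\<in>C. (if c' = c then 1 else 0) * a r c') = (\<Sum>c'\<in>C. if c' = c then a r c else 0)"
        by (intro sum.cong) auto
      also have "\<dots> = 0" using no \<open>r \<in> R\<close> c Suc.prems(2) by simp
      finally show "(\<Sum>c'\<in>C. (if c' = c then 1 else 0) * a r c') = 0" .
    qed
    with c show False by auto
  qed
  then obtain r where r: "r \<in> R" "a r c \<noteq> 0" by blast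
  \<comment> \<open>\<open>a'\<close> is the Schur complement after eliminating row \<open>r\<close>
    and column \<open>c\<close>; \<open>ext l t\<close> extends a vector on \<open>C - {c}\<close>
    so that row \<open>r\<close> gets the value \<open>t\<close>. With \<open>t = 0\<close> it
    transfers the kernel condition, with \<open>t = b r\<close> the solution.\<close>
  define a' where "a' s d = a s d - a s c * a r d / a r c" for s d
  define ext where "ext l t d = (if d = c then (t - (\<Sum>d\<in>C-{c}. l d * a r d)) / a r c else l d)"
    for l :: "'c \<Rightarrow> 'f" and t d
  have split: "(\<Sum>d\<in>C. f d) = f c + (\<Sum>d\<in>C-{c}. f d)" for f :: "'c \<Rightarrow> 'f"
    using c Suc.prems(2) by (simp add: sum.remove)
  have extr: "(\<Sum>d\<in>C. ext l t d * a r d) = t" for l t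
  proof -
    have "(\<Sum>d\<in>C-{c}. ext l t d * a r d) = (\<Sum>d\<in>C-{c}. l d * a r d)"
      by (intro sum.cong) (auto simp: ext_def)
    then show ?thesis by (simp add: split) (simp add: ext_def r(2))
  qed
  have exts: "(\<Sum>d\<in>C. ext l t d * a s d) = (\<Sum>d\<in>C-{c}. l d * a' s d) + a s c * t / a r c" for l t s
  proof -
    define X Y where "X = (\<Sum>d\<in>C-{c}. l d * a r d)" and "Y = (\<Sum>d\<in>C-{c}. l d * a s d)"
    have "(\<Sum>d\<in>C-{c}. l d * a' s d) = Y - (\<Sum>d\<in>C-{c}. a s c / a r c * (l d * a r d))"
      by (simp add: a'_def Y_def right_diff_distrib sum_subtractf mult_ac)
    also have "\<dots> = Y - a s c / a r c * X" by (simp add: X_def sum_distrib_left)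
    finally have *: "(\<Sum>d\<in>C-{c}. l d * a' s d) = Y - a s c / a r c * X" .
    have "(\<Sum>d\<in>C-{c}. ext l t d * a s d) = Y" unfolding Y_def by (intro sum.cong) (auto simp: ext_def)
    then have "(\<Sum>d\<in>C. ext l t d * a s d) = (t - X) / a r c * a s c + Y"
      by (simp add: split X_def) (simp add: ext_def)
    then show ?thesis unfolding * by (simp add: divide_inverse algebra_simps)
  qed
  have "\<exists>x. \<forall>s\<in>R-{r}. (\<Sum>d\<in>C-{c}. x d * a' s d) = b s - a s c * b r / a r c"
  proof (rule Suc.hyps(1))
    show "n = card (C - {c})" using Suc.hyps(2) c by simp
    show "finite (R - {r})" "finite (C - {c})" "card (R - {r}) = card (C - {c})"
      using Suc.prems c r by auto
    fix l assume l: "\<And>s. s \<in> R - {r} \<Longrightarrow> (\<Sum>d\<in>C-{c}. l d * a' s d) = 0"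
    have "\<forall>d\<in>C. ext l 0 d = 0"
    proof (rule Suc.prems(4))
      fix s assume "s \<in> R"
      then show "(\<Sum>d\<in>C. ext l 0 d * a s d) = 0"
        by (cases "s = r") (use l in \<open>auto simp: extr exts\<close>)
    qed
    then show "\<forall>d\<in>C - {c}. l d = 0" by (auto simp: ext_def split: if_splits)
  qed
  then obtain x where x: "\<And>s. s \<in> R - {r} \<Longrightarrow> (\<Sum>d\<in>C-{c}. x d * a' s d) = b s - a s c * b r / a r c"
    by blast
  have "(\<Sum>d\<in>C. ext x (b r) d * a s d) = b s" if "s \<in> R" for s
    by (cases "s = r") (use that x in \<open>auto simp: extr exts\<close>)
  then show ?case by blast
qed

text \<open>If \<open>x\<close> solves the system for the unit vector at \<open>r\<close>, then
  \<open>y r\<close> is \<open>y\<close> applied to the matrix times \<open>x\<close>, which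
  vanishes column by column. Both existence and uniqueness of \<open>dual_sol\<close> rest on this,
  since its equations are transposed.\<close>

lemma square_system_left:
  fixes a :: "'r \<Rightarrow> 'c \<Rightarrow> 'f::field"
  assumes fin: "finite R" "finite C" "card R = card C"
    and ker: "\<And>l. \<lbrakk>\<And>r. r \<in> R \<Longrightarrow> (\<Sum>c\<in>C. l c * a r c) = 0\<rbrakk> \<Longrightarrow> \<forall>c\<in>C. l c = 0"
    and y: "\<And>c. c \<in> C \<Longrightarrow> (\<Sum>r\<in>R. y r * a r c) = 0"
  shows "\<forall>r\<in>R. y r = 0"
proof
  fix r assume r: "r \<in> R"
  have "\<exists>x. \<forall>s\<in>R. (\<Sum>c\<in>C. x c * a s c) = (if s = r then 1 else 0)"
    by (rule square_system_solvable) (use fin ker in auto)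
  then obtain x where x: "\<forall>s\<in>R. (\<Sum>c\<in>C. x c * a s c) = (if s = r then 1 else 0)"
    by blast
  have "y r = (\<Sum>s\<in>R. y s * (if s = r then 1 else 0))"
  proof -
    have "(\<Sum>s\<in>R. y s * (if s = r then 1 else 0)) = (\<Sum>s\<in>R. if s = r then y r else 0)"
      by (intro sum.cong) auto
    then show ?thesis using r fin by simp
  qed
  also have "\<dots> = (\<Sum>s\<in>R. y s * (\<Sum>c\<in>C. x c * a s c))" using x by (intro sum.cong) auto
  also have "\<dots> = (\<Sum>c\<in>C. x c * (\<Sum>s\<in>R. y s * a s c))"
  proof -
    have "(\<Sum>s\<in>R. y s * (\<Sum>c\<in>C. x c * a s c)) = (\<Sum>s\<in>R. \<Sum>c\<in>C. y s * (x c * a s c))"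
      by (simp add: sum_distrib_left)
    also have "\<dots> = (\<Sum>c\<in>C. \<Sum>s\<in>R. y s * (x c * a s c))" by (rule sum.swap)
    also have "\<dots> = (\<Sum>c\<in>C. x c * (\<Sum>s\<in>R. y s * a s c))"
      by (simp add: sum_distrib_left mult.left_commute)
    finally show ?thesis .
  qed
  also have "\<dots> = 0" using y by simp
  finally show "y r = 0" .
qed

section \<open>Basic and dual solutions, and the ratio test\<close>

lemma basis_finite: "is_basis P B \<Longrightarrow> finite B"
  by (auto simp: is_basis_def intro: finite_subset)

lemma basis_kernel:
  assumes "is_basis P B" "\<And>r. r < nrows P \<Longrightarrow> (\<Sum>j\<in>B. l j * mat P r j) = 0"
  shows "\<forall>j\<in>B. l j = 0"
  using assms unfolding is_basis_def by blast

lemma sum_over_basis: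
  assumes "is_basis P B" "\<forall>j. j \<notin> B \<longrightarrow> x j = 0"
  shows "(\<Sum>j<ncols P. w j * x j) = (\<Sum>j\<in>B. x j * (w j :: rat))"
proof -
  have "(\<Sum>j<ncols P. w j * x j) = (\<Sum>j\<in>B. w j * x j)"
    using assms by (intro sum.mono_neutral_right) (auto simp: is_basis_def)
  then show ?thesis by (simp add: mult.commute)
qed

lemma basic_sol_unique:
  assumes B: "is_basis P B"
    and x: "\<forall>j. j \<notin> B \<longrightarrow> x j = 0" "\<forall>r<nrows P. (\<Sum>j<ncols P. mat P r j * x j) = rhs P r"
  shows "basic_sol P B = x"
  unfolding basic_sol_def
proof (rule the_equality)
  show "(\<forall>j. j \<notin> B \<longrightarrow> x j = 0) \<and> (\<forall>r<nrows P. (\<Sum>j<ncols P. mat P r j * x j) = rhs P r)"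
    using x by blast
  fix z assume z: "(\<forall>j. j \<notin> B \<longrightarrow> z j = 0) \<and> (\<forall>r<nrows P. (\<Sum>j<ncols P. mat P r j * z j) = rhs P r)"
  have "\<forall>j\<in>B. z j - x j = 0"
  proof (rule basis_kernel[OF B])
    fix r assume "r < nrows P"
    then show "(\<Sum>j\<in>B. (z j - x j) * mat P r j) = 0"
      using x z sum_over_basis[OF B, of x "mat P r"] sum_over_basis[OF B, of z "mat P r"]
      by (simp add: left_diff_distrib sum_subtractf)
  qed
  then show "z = x" using x z by (metis ext eq_iff_diff_eq_0)
qed

lemma basic_sol_props:
  assumes B: "is_basis P B"
  shows "j \<notin> B \<Longrightarrow> basic_sol P B j = 0"
    and "r < nrows P \<Longrightarrow> (\<Sum>j<ncols P. mat P r j * basic_sol P B j) = rhs P r"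
proof -
  have "\<exists>x. \<forall>r\<in>{..<nrows P}. (\<Sum>j\<in>B. x j * mat P r j) = rhs P r"
    by (rule square_system_solvable)
      (use B basis_finite[OF B] basis_kernel[OF B] in \<open>auto simp: is_basis_def\<close>)
  then obtain x where x: "\<And>r. r < nrows P \<Longrightarrow> (\<Sum>j\<in>B. x j * mat P r j) = rhs P r" by auto
  define x' where "x' j = (if j \<in> B then x j else 0)" for j
  have 1: "\<forall>j. j \<notin> B \<longrightarrow> x' j = 0" by (simp add: x'_def)
  have 2: "\<forall>r<nrows P. (\<Sum>j<ncols P. mat P r j * x' j) = rhs P r"
    using x by (simp add: sum_over_basis[OF B 1]) (simp add: x'_def)
  have "basic_sol P B = x'" by (rule basic_sol_unique[OF B 1 2])
  with 1 2 show "j \<notin> B \<Longrightarrow> basic_sol P B j = 0"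
    "r < nrows P \<Longrightarrow> (\<Sum>j<ncols P. mat P r j * basic_sol P B j) = rhs P r" by auto
qed

lemma feasible_basis_point:
  assumes "feasible_basis P B"
  shows "feasible_point P (basic_sol P B)"
proof -
  have B: "is_basis P B" using assms by (simp add: feasible_basis_def)
  then have "j \<notin> B" if "ncols P \<le> j" for j using that by (auto simp: is_basis_def)
  then show ?thesis
    using assms basic_sol_props[OF B] by (auto simp: feasible_point_def feasible_basis_def)
qed

lemma dual_sol_unique:
  assumes B: "is_basis P B"
    and y: "\<forall>r. nrows P \<le> r \<longrightarrow> y r = 0" "\<forall>j\<in>B. (\<Sum>r<nrows P. y r * mat P r j) = obj P j"
  shows "dual_sol P B = y"
  unfolding dual_sol_def
proof (rule the_equality)
  show "(\<forall>r. nrows P \<le> r \<longrightarrow> y r = 0) \<and> (\<forall>j\<in>B. (\<Sum>r<nrows P. y r * mat P r j) = obj P j)"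
    using y by blast
  fix z assume z: "(\<forall>r. nrows P \<le> r \<longrightarrow> z r = 0) \<and> (\<forall>j\<in>B. (\<Sum>r<nrows P. z r * mat P r j) = obj P j)"
  have "\<forall>r\<in>{..<nrows P}. z r - y r = 0"
  proof (rule square_system_left[where a = "mat P" and C = B])
    show "finite B" "card {..<nrows P} = card B" using B basis_finite[OF B] by (auto simp: is_basis_def)
    show "\<forall>c\<in>B. l c = 0" if "\<And>r. r \<in> {..<nrows P} \<Longrightarrow> (\<Sum>c\<in>B. l c * mat P r c) = 0" for l
      using basis_kernel[OF B] that by blast
    show "(\<Sum>r<nrows P. (z r - y r) * mat P r c) = 0" if "c \<in> B" for c
      using y z that by (simp add: left_diff_distrib sum_subtractf)
  qed simp
  then show "z = y" using y z by (metis ext eq_iff_diff_eq_0 lessThan_iff not_less)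
qed

lemma basis_column_coords:
  assumes B: "is_basis P B"
  obtains z where "\<And>r. r < nrows P \<Longrightarrow> (\<Sum>j\<in>B. z j * mat P r j) = mat P r i"
proof -
  have "\<exists>z. \<forall>r\<in>{..<nrows P}. (\<Sum>j\<in>B. z j * mat P r j) = mat P r i"
    by (rule square_system_solvable)
      (use B basis_finite[OF B] basis_kernel[OF B] in \<open>auto simp: is_basis_def\<close>)
  with that show ?thesis by auto
qed

lemma dual_sol_props:
  assumes B: "is_basis P B" and j: "j \<in> B"
  shows "(\<Sum>r<nrows P. dual_sol P B r * mat P r j) = obj P j"
proof -
  have "\<exists>y. \<forall>j\<in>B. (\<Sum>r<nrows P. y r * mat P r j) = obj P j"
  proof (rule square_system_solvable)
    show "finite B" "card B = card {..<nrows P}" using B basis_finite[OF B] by (auto simp: is_basis_def)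
    show "\<forall>r\<in>{..<nrows P}. y r = 0" if "\<And>j. j \<in> B \<Longrightarrow> (\<Sum>r<nrows P. y r * mat P r j) = 0" for y
      by (rule square_system_left[where a = "mat P" and C = B])
        (use B basis_finite[OF B] basis_kernel[OF B] that in \<open>auto simp: is_basis_def\<close>)
  qed auto
  then obtain y where y: "\<And>j. j \<in> B \<Longrightarrow> (\<Sum>r<nrows P. y r * mat P r j) = obj P j" by blast
  define y' where "y' r = (if r < nrows P then y r else 0)" for r
  have y': "\<forall>j\<in>B. (\<Sum>r<nrows P. y' r * mat P r j) = obj P j" using y by (simp add: y'_def)
  have "dual_sol P B = y'"
    by (rule dual_sol_unique[OF B _ y']) (simp add: y'_def)
  with y' j show ?thesis by simp
qed

text \<open>Ratio test: \<open>z\<close> expresses the entering column in the basis, and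
  \<open>pt t\<close> is the point reached when the entering variable is raised to \<open>t\<close>;
  the objective grows at rate \<open>red_cost\<close>. Boundedness gives some
  \<open>z j > 0\<close>, and a basic variable that reaches zero first leaves.\<close>

lemma simplex_step:
  assumes fB: "feasible_basis P B" and bd: "bounded_lp P" and i: "i \<in> improving P B"
  obtains j where "j \<in> B" "feasible_basis P (insert i B - {j})"
proof -
  have B: "is_basis P B" using fB by (simp add: feasible_basis_def)
  note fin = basis_finite[OF B]
  have iB: "i \<notin> B" "i < ncols P" and rc: "0 < red_cost P B i" using i by (auto simp: improving_def)
  have Bn: "j < ncols P" if "j \<in> B" for j using B that by (auto simp: is_basis_def)
  obtain z where z: "\<And>r. r < nrows P \<Longrightarrow> (\<Sum>j\<in>B. z j * mat P r j) = mat P r i"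
    using basis_column_coords[OF B] by blast
  define x where "x = basic_sol P B"
  have x: "\<And>j. j \<notin> B \<Longrightarrow> x j = 0" "\<And>j. 0 \<le> x j"
    "\<And>r. r < nrows P \<Longrightarrow> (\<Sum>j<ncols P. mat P r j * x j) = rhs P r"
    using basic_sol_props[OF B] fB by (auto simp: x_def feasible_basis_def)
  define pt where "pt t j = (if j = i then t else if j \<in> B then x j - t * z j else 0)" for t j
  have lin: "(\<Sum>j<ncols P. w j * pt t j) = (\<Sum>j<ncols P. w j * x j) + t * (w i - (\<Sum>j\<in>B. z j * w j))"
    for w t
  proof -
    have "(\<Sum>j<ncols P. w j * pt t j) = (\<Sum>j\<in>insert i B. w j * pt t j)"
      by (rule sum.mono_neutral_right) (use iB Bn in \<open>auto simp: pt_def\<close>)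
    also have "\<dots> = w i * t + (\<Sum>j\<in>B. w j * pt t j)"
      using fin iB by (simp add: pt_def)
    also have "(\<Sum>j\<in>B. w j * pt t j) = (\<Sum>j\<in>B. x j * w j - t * (z j * w j))"
      using iB by (intro sum.cong) (auto simp: pt_def algebra_simps)
    also have "\<dots> = (\<Sum>j\<in>B. x j * w j) - t * (\<Sum>j\<in>B. z j * w j)"
      by (simp add: sum_subtractf sum_distrib_left)
    also have "(\<Sum>j\<in>B. x j * w j) = (\<Sum>j<ncols P. w j * x j)"
      using sum_over_basis[OF B, of x w] x(1) by simp
    finally show ?thesis by (simp add: algebra_simps)
  qed
  have rows: "(\<Sum>j<ncols P. mat P r j * pt t j) = rhs P r" if "r < nrows P" for r t
    using that by (simp add: lin x(3) z)
  have rc_eq: "red_cost P B i = obj P i - (\<Sum>j\<in>B. z j * obj P j)"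
  proof -
    have "(\<Sum>j\<in>B. z j * obj P j) = (\<Sum>j\<in>B. \<Sum>r<nrows P. z j * (dual_sol P B r * mat P r j))"
      using dual_sol_props[OF B] by (simp add: sum_distrib_left[symmetric])
    also have "\<dots> = (\<Sum>r<nrows P. \<Sum>j\<in>B. z j * (dual_sol P B r * mat P r j))" by (rule sum.swap)
    also have "\<dots> = (\<Sum>r<nrows P. dual_sol P B r * (\<Sum>j\<in>B. z j * mat P r j))"
      by (simp add: sum_distrib_left mult.left_commute)
    also have "\<dots> = (\<Sum>r<nrows P. dual_sol P B r * mat P r i)" using z by simp
    finally show ?thesis by (simp add: red_cost_def)
  qed
  have ob: "objval P (pt t) = objval P x + t * red_cost P B i" for t
    by (simp add: objval_def lin rc_eq)
  have "\<exists>j\<in>B. 0 < z j"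
  proof (rule ccontr)
    assume "\<not> ?thesis"
    then have neg: "z j \<le> 0" if "j \<in> B" for j using that by force
    obtain M where M: "\<And>x. feasible_point P x \<Longrightarrow> objval P x \<le> M" using bd by (auto simp: bounded_lp_def)
    \<comment> \<open>Without a positive \<open>z j\<close> every \<open>t \<ge> 0\<close> gives a
      feasible point; this one pushes the objective above the bound \<open>M\<close>.\<close>
    define t where "t = (\<bar>M - objval P x\<bar> + 1) / red_cost P B i"
    have t: "t > 0" using rc by (simp add: t_def)
    have "0 \<le> pt t j" for j
      using neg[of j] t x(2)[of j] by (auto simp: pt_def mult_nonneg_nonpos intro: order_trans[of _ 0])
    then have "feasible_point P (pt t)"
      using rows iB Bn by (fastforce simp: feasible_point_def pt_def)
    from M[OF this] have "objval P x + t * red_cost P B i \<le> M" by (simp add: ob)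
    moreover have "t * red_cost P B i = \<bar>M - objval P x\<bar> + 1" using rc by (simp add: t_def)
    ultimately show False by linarith
  qed
  then have ne: "{j\<in>B. 0 < z j} \<noteq> {}" by blast
  obtain k where k: "k \<in> B" "0 < z k" and kmin: "\<And>j. j \<in> B \<Longrightarrow> 0 < z j \<Longrightarrow> x k / z k \<le> x j / z j"
  proof -
    obtain k where "is_arg_min (\<lambda>j. x j / z j) (\<lambda>j. j \<in> {j\<in>B. 0 < z j}) k"
      using ex_is_arg_min_if_finite[OF _ ne, of "\<lambda>j. x j / z j"] fin by auto
    then show ?thesis using that[of k] by (auto simp: is_arg_min_linorder)
  qed
  define t where "t = x k / z k"
  have t: "0 \<le> t" using k x(2)[of k] by (simp add: t_def)
  have tz: "t * z j \<le> x j" if "j \<in> B" for j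
  proof (cases "0 < z j")
    case True
    then show ?thesis using kmin[OF that True] by (simp add: t_def[symmetric] pos_le_divide_eq)
  next
    case False
    then show ?thesis using t x(2)[of j] by (meson mult_nonneg_nonpos not_less order_trans)
  qed
  define B' where "B' = insert i B - {k}"
  have ik: "i \<noteq> k" using iB k by auto
  have B': "is_basis P B'"
    unfolding is_basis_def
  proof (intro conjI allI impI)
    show "B' \<subseteq> {..<ncols P}" using iB Bn by (auto simp: B'_def)
    show "card B' = nrows P"
      using B fin iB k ik by (simp add: B'_def is_basis_def)
    fix l :: "nat \<Rightarrow> rat" assume l: "\<forall>r<nrows P. (\<Sum>j\<in>B'. l j * mat P r j) = 0"
    have B'eq: "B' = insert i (B - {k})" using ik by (auto simp: B'_def)
    \<comment> \<open>Expanding column \<open>i\<close> turns a relation on \<open>B'\<close> into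
      one on \<open>B\<close>. Its coefficient at \<open>k\<close> is \<open>l i * z k\<close> with
      \<open>z k > 0\<close>, so \<open>l i\<close> vanishes before the others.\<close>
    define m where "m j = l i * z j + (if j = k then 0 else l j)" for j
    have "\<forall>j\<in>B. m j = 0"
    proof (rule basis_kernel[OF B])
      fix r assume r: "r < nrows P"
      have "(\<Sum>j\<in>B. m j * mat P r j) = (\<Sum>j\<in>B. l i * (z j * mat P r j) + (if j = k then 0 else l j * mat P r j))"
        by (intro sum.cong) (auto simp: m_def algebra_simps)
      also have "\<dots> = l i * (\<Sum>j\<in>B. z j * mat P r j) + (\<Sum>j\<in>B. if j = k then 0 else l j * mat P r j)"
        by (simp add: sum.distrib sum_distrib_left)
      also have "(\<Sum>j\<in>B. if j = k then 0 else l j * mat P r j) = (\<Sum>j\<in>B-{k}. l j * mat P r j)"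
        using fin k by (simp add: sum.remove[of B k])
      also have "l i * (\<Sum>j\<in>B. z j * mat P r j) = l i * mat P r i" by (simp add: z r)
      also have "l i * mat P r i + (\<Sum>j\<in>B-{k}. l j * mat P r j) = (\<Sum>j\<in>B'. l j * mat P r j)"
        using fin iB by (simp add: B'eq)
      finally show "(\<Sum>j\<in>B. m j * mat P r j) = 0" using l r by simp
    qed
    then have m: "\<And>j. j \<in> B \<Longrightarrow> m j = 0" by blast
    have "l i = 0" using m[OF k(1)] k(2) by (simp add: m_def)
    then have "l j = 0" if "j \<in> B" "j \<noteq> k" for j
      using m[OF that(1)] that(2) by (simp add: m_def)
    with \<open>l i = 0\<close> show "\<forall>j\<in>B'. l j = 0" by (auto simp: B'eq)
  qed
  have "basic_sol P B' = pt t"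
  proof (rule basic_sol_unique[OF B'])
    show "\<forall>j. j \<notin> B' \<longrightarrow> pt t j = 0" using k ik by (auto simp: B'_def pt_def t_def)
    show "\<forall>r<nrows P. (\<Sum>j<ncols P. mat P r j * pt t j) = rhs P r" using rows by blast
  qed
  moreover have "0 \<le> pt t j" for j using t tz by (auto simp: pt_def)
  ultimately have "feasible_basis P B'" using B' by (simp add: feasible_basis_def)
  with k that show ?thesis by (auto simp: B'_def)
qed

section \<open>Programs of two-action decision processes\<close>

lemma sum_list_map_0: "(\<And>x. x \<in> set l \<Longrightarrow> f x = 0) \<Longrightarrow> sum_list (map f l) = (0 :: 'a :: monoid_add)"
  by (induction l) auto

text \<open>\<open>key\<close> fixes the index order of the columns, \<open>tr s a\<close> lists
  successors with weights, and \<open>R\<close> is the ratio of consecutive sources and column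
  scales. Counting the reward in \<open>substoch\<close> makes the constant vector 1 dominate every
  Bellman update. A total weight of 1 is allowed, so policies may contain cycles and need not be
  bases.\<close>

locale binary_mdp =
  fixes S :: "'s set" and key :: "'s \<Rightarrow> 'k::linorder"
    and tr :: "'s \<Rightarrow> bool \<Rightarrow> ('s \<times> rat) list" and rew :: "'s \<Rightarrow> bool \<Rightarrow> rat" and R :: rat
  assumes finS: "finite S" and inj_key: "inj_on key S" and R_ge: "2 \<le> R"
    and tr_ok: "\<And>s a t w. s \<in> S \<Longrightarrow> (t, w) \<in> set (tr s a) \<Longrightarrow> t \<in> S \<and> t \<noteq> s \<and> 0 < w"
    and rew_nonneg: "\<And>s a. s \<in> S \<Longrightarrow> 0 \<le> rew s a"
    and substoch: "\<And>s a. s \<in> S \<Longrightarrow> sum_list (map snd (tr s a)) + rew s a \<le> 1"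
begin

definition idx :: "'s \<Rightarrow> nat" where "idx s = card {t\<in>S. key t < key s}"
definition en :: "nat \<Rightarrow> 's" where "en = inv_into S idx"
definition prob :: "'s \<Rightarrow> bool \<Rightarrow> 's \<Rightarrow> rat" where
  "prob s a t = (\<Sum>(u, w)\<leftarrow>tr s a. if u = t then w else 0)"
definition val :: "('s \<Rightarrow> rat) \<Rightarrow> 's \<Rightarrow> bool \<Rightarrow> rat" where
  "val v s a = rew s a + (\<Sum>(u, w)\<leftarrow>tr s a. w * v u)"
text \<open>Row \<open>r\<close> is the flow balance at the state in position \<open>r\<close>.
  Source and column scale serve different rankings: scaling a column changes its reduced cost but no
  objective increase, while the sources change the flow and thus the increases but no reduced
  cost.\<close>

definition prog :: lp where
  "prog = \<lparr> nrows = card S, ncols = 2 * card S,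
     mat = (\<lambda>r j. R ^ (j div 2) * (of_bool (r = j div 2) - prob (en (j div 2)) (odd j) (en r))),
     rhs = (\<lambda>r. R ^ r), obj = (\<lambda>j. R ^ (j div 2) * rew (en (j div 2)) (odd j)) \<rparr>"
definition col :: "'s \<Rightarrow> bool \<Rightarrow> nat" where "col s a = 2 * idx s + of_bool a"
definition basis :: "('s \<Rightarrow> bool) \<Rightarrow> nat set" where "basis f = (\<lambda>s. col s (f s)) ` S"
definition flux :: "(nat \<Rightarrow> rat) \<Rightarrow> 's \<Rightarrow> bool \<Rightarrow> rat" where "flux x s a = R ^ idx s * x (col s a)"
definition bellman :: "('s \<Rightarrow> bool) \<Rightarrow> ('s \<Rightarrow> rat) \<Rightarrow> bool" where
  "bellman f v \<longleftrightarrow> (\<forall>s\<in>S. v s = val v s (f s))"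
definition adv :: "('s \<Rightarrow> bool) \<Rightarrow> ('s \<Rightarrow> rat) \<Rightarrow> 's \<Rightarrow> rat" where
  "adv f v s = val v s (\<not> f s) - v s"
definition imp :: "('s \<Rightarrow> bool) \<Rightarrow> ('s \<Rightarrow> rat) \<Rightarrow> 's set" where
  "imp f v = {s\<in>S. 0 < adv f v s}"
abbreviation flip :: "('s \<Rightarrow> bool) \<Rightarrow> 's \<Rightarrow> 's \<Rightarrow> bool" where "flip f s \<equiv> f(s := \<not> f s)"

section \<open>Positions of states and of their columns\<close>

lemma prog_simps [simp]: "nrows prog = card S" "ncols prog = 2 * card S" "rhs prog r = R ^ r"
  by (simp_all add: prog_def)

lemma idx_less_iff:
  assumes "s \<in> S" "t \<in> S"
  shows "idx s < idx t \<longleftrightarrow> key s < key t"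
proof -
  have *: "idx s < idx t" if "key s < key t" "s \<in> S" for s t
    unfolding idx_def by (rule psubset_card_mono) (use finS that in auto)
  have "s = t" if "\<not> key s < key t" "\<not> key t < key s"
    using that assms inj_key by (meson inj_onD neqE)
  then show ?thesis using * assms by (metis less_asym)
qed

lemma bij_idx: "bij_betw idx S {..<card S}"
proof (rule bij_betw_imageI)
  show inj: "inj_on idx S"
    by (rule inj_onI) (metis idx_less_iff inj_key inj_onD less_irrefl neqE)
  have "idx ` S \<subseteq> {..<card S}"
  proof (rule image_subsetI)
    fix s assume "s \<in> S"
    then show "idx s \<in> {..<card S}" unfolding idx_def lessThan_iff
      by (intro psubset_card_mono) (use finS in auto)
  qed
  then show "idx ` S = {..<card S}"
    by (simp add: card_image card_subset_eq inj)
qed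

lemma idx_less: "s \<in> S \<Longrightarrow> idx s < card S"
  using bij_idx by (auto simp: bij_betw_def)

lemma idx_inj: "s \<in> S \<Longrightarrow> t \<in> S \<Longrightarrow> idx s = idx t \<longleftrightarrow> s = t"
  using bij_idx by (auto simp: bij_betw_def inj_on_def)

lemma en_idx [simp]: "s \<in> S \<Longrightarrow> en (idx s) = s"
  using bij_idx by (simp add: en_def bij_betw_def)

lemma en_in: "i < card S \<Longrightarrow> en i \<in> S" and idx_en: "i < card S \<Longrightarrow> idx (en i) = i"
  using bij_idx by (auto simp: en_def bij_betw_def inv_into_into f_inv_into_f)

lemma R_pos: "0 < R ^ i"
  using R_ge by (intro zero_less_power) simp

lemma R_nonneg [simp]: "0 \<le> R ^ i" using R_pos[of i] by (simp add: less_imp_le)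
lemma R_nz [simp]: "R \<noteq> 0" "\<not> R < 0" using R_ge by simp_all

lemma sum_idx: "(\<Sum>r<card S. g r) = (\<Sum>s\<in>S. g (idx s))"
  using sum.reindex_bij_betw[OF bij_idx, of g] by simp

lemma sum_col: "(\<Sum>j<2 * card S. g j) = (\<Sum>s\<in>S. g (col s False) + g (col s True))"
proof -
  have "(\<Sum>j<2 * n. g j) = (\<Sum>i<n. g (2 * i) + g (2 * i + 1))" for n
    by (induction n) (simp_all add: add.assoc)
  then show ?thesis by (simp add: sum_idx col_def)
qed

lemma col_inj: "s \<in> S \<Longrightarrow> t \<in> S \<Longrightarrow> col s a = col t b \<longleftrightarrow> s = t \<and> a = b"
  by (cases a; cases b; simp add: col_def idx_inj; presburger)

lemma col_div [simp]: "col s a div 2 = idx s" and col_odd [simp]: "odd (col s a) = a"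
  by (simp_all add: col_def)

lemma col_less: "s \<in> S \<Longrightarrow> col s a < 2 * card S"
  using idx_less[of s] by (cases a) (auto simp: col_def)

lemma col_cases:
  assumes "j < 2 * card S"
  obtains s a where "s \<in> S" "j = col s a"
proof (rule that)
  show "en (j div 2) \<in> S" using assms by (intro en_in) simp
  have "idx (en (j div 2)) = j div 2" using assms by (intro idx_en) simp
  then show "j = col (en (j div 2)) (odd j)" by (simp add: col_def)
qed

lemma mat_col: "s \<in> S \<Longrightarrow> t \<in> S \<Longrightarrow> mat prog (idx t) (col s a) = R ^ idx s * (of_bool (t = s) - prob s a t)"
  by (simp add: prog_def idx_inj)

lemma obj_col: "s \<in> S \<Longrightarrow> obj prog (col s a) = R ^ idx s * rew s a"
  by (simp add: prog_def)

lemma prob_nonneg: "s \<in> S \<Longrightarrow> 0 \<le> prob s a t"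
  unfolding prob_def by (rule sum_list_nonneg) (use tr_ok in \<open>force split: if_splits\<close>)

lemma prob_self: "s \<in> S \<Longrightarrow> prob s a s = 0"
  unfolding prob_def by (rule sum_list_map_0) (use tr_ok in auto)

lemma prob_nzD: "prob s a t \<noteq> 0 \<Longrightarrow> t \<in> fst ` set (tr s a)"
  unfolding prob_def by (erule contrapos_np, rule sum_list_map_0) (force split: if_splits)

lemma prob_sum:
  assumes "s \<in> S"
  shows "(\<Sum>t\<in>S. prob s a t * v t) = (\<Sum>(u, w)\<leftarrow>tr s a. w * v u)"
proof -
  have "(\<Sum>t\<in>S. (\<Sum>(u, w)\<leftarrow>l. if u = t then w else 0) * v t) = (\<Sum>(u, w)\<leftarrow>l. w * v u)"
    if "\<forall>(u, w)\<in>set l. u \<in> S" for l :: "('s \<times> rat) list"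
    using that
  proof (induction l)
    case (Cons p l)
    obtain u w where p: "p = (u, w)" by force
    have "(\<Sum>t\<in>S. (if u = t then w else 0) * v t) = (\<Sum>t\<in>S. if u = t then w * v t else 0)"
      by (intro sum.cong) auto
    also have "\<dots> = w * v u" using Cons.prems finS by (simp add: p)
    finally show ?case using Cons by (simp add: p distrib_right sum.distrib)
  qed simp
  then show ?thesis unfolding prob_def using tr_ok[OF assms] by fastforce
qed

lemma val_eq: "s \<in> S \<Longrightarrow> val v s a = rew s a + (\<Sum>t\<in>S. prob s a t * v t)"
  by (simp add: val_def prob_sum)

lemma val_const: "s \<in> S \<Longrightarrow> val (\<lambda>_. 1) s a \<le> 1"
proof -
  have "(\<lambda>(u, w). w * 1) = (snd :: 's \<times> rat \<Rightarrow> rat)" by auto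
  then show "s \<in> S \<Longrightarrow> val (\<lambda>_. 1) s a \<le> 1" using substoch[of s a] by (simp add: val_def add.commute)
qed

section \<open>Flow balance and weak duality\<close>

lemma dual_col:
  assumes s: "s \<in> S"
  shows "(\<Sum>r<card S. y r * mat prog r (col s a)) = R ^ idx s * (y (idx s) - (\<Sum>t\<in>S. prob s a t * y (idx t)))"
proof -
  have "(\<Sum>r<card S. y r * mat prog r (col s a)) = (\<Sum>t\<in>S. y (idx t) * (R ^ idx s * (of_bool (t = s) - prob s a t)))"
    unfolding sum_idx by (intro sum.cong) (simp_all add: mat_col s)
  also have "\<dots> = R ^ idx s * (\<Sum>t\<in>S. of_bool (t = s) * y (idx t) - prob s a t * y (idx t))"
    by (simp add: sum_distrib_left algebra_simps)
  also have "(\<Sum>t\<in>S. of_bool (t = s) * y (idx t) - prob s a t * y (idx t))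
      = (\<Sum>t\<in>S. of_bool (t = s) * y (idx t)) - (\<Sum>t\<in>S. prob s a t * y (idx t))"
    by (simp add: sum_subtractf)
  also have "(\<Sum>t\<in>S. of_bool (t = s) * y (idx t)) = y (idx s)"
  proof -
    have "(\<Sum>t\<in>S. of_bool (t = s) * y (idx t)) = (\<Sum>t\<in>S. if t = s then y (idx t) else 0)"
      by (intro sum.cong) auto
    then show ?thesis using s finS by simp
  qed
  finally show ?thesis .
qed

lemma row_flux:
  assumes t: "t \<in> S"
  shows "(\<Sum>j<2 * card S. mat prog (idx t) j * x j)
    = flux x t False + flux x t True - (\<Sum>s\<in>S. prob s False t * flux x s False + prob s True t * flux x s True)"
proof -
  have "(\<Sum>j<2 * card S. mat prog (idx t) j * x j)
      = (\<Sum>s\<in>S. of_bool (t = s) * (flux x s False + flux x s True)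
           - (prob s False t * flux x s False + prob s True t * flux x s True))"
    unfolding sum_col by (intro sum.cong) (simp_all add: mat_col t flux_def algebra_simps)
  also have "\<dots> = (\<Sum>s\<in>S. of_bool (t = s) * (flux x s False + flux x s True))
      - (\<Sum>s\<in>S. prob s False t * flux x s False + prob s True t * flux x s True)"
    by (simp add: sum_subtractf)
  also have "(\<Sum>s\<in>S. of_bool (t = s) * (flux x s False + flux x s True))
      = (\<Sum>s\<in>S. if t = s then flux x s False + flux x s True else 0)"
    by (intro sum.cong) auto
  finally show ?thesis using t finS by simp
qed

lemma feasible_flux:
  assumes "feasible_point prog x" "t \<in> S"
  shows "flux x t False + flux x t True
    = R ^ idx t + (\<Sum>s\<in>S. prob s False t * flux x s False + prob s True t * flux x s True)"
proof -
  have "(\<Sum>j<2 * card S. mat prog (idx t) j * x j) = R ^ idx t"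
    using assms idx_less[of t] by (auto simp: feasible_point_def)
  then show ?thesis by (simp add: row_flux assms(2))
qed

lemma flux_nonneg: "feasible_point prog x \<Longrightarrow> 0 \<le> flux x s a"
  by (auto simp: feasible_point_def flux_def)

lemma flux_lower:
  assumes "feasible_point prog x" "t \<in> S"
  shows "R ^ idx t \<le> flux x t False + flux x t True"
  unfolding feasible_flux[OF assms]
  using flux_nonneg[OF assms(1)] prob_nonneg by (simp add: sum_nonneg)

text \<open>Weighting the balance at each state by \<open>v\<close> and summing gives this for every
  vector \<open>v\<close>, whether or not it solves a Bellman equation. The constant vector 1 yields
  boundedness, the values of a policy yield the effect of one switch.\<close>

lemma objval_flux:
  assumes x: "feasible_point prog x"
  shows "objval prog x = (\<Sum>s\<in>S. (val v s False - v s) * flux x s False + (val v s True - v s) * flux x s True)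
    + (\<Sum>s\<in>S. v s * R ^ idx s)"
proof -
  have rowv: "(\<Sum>t\<in>S. v t * (flux x t False + flux x t True)) = (\<Sum>t\<in>S. v t * R ^ idx t)
      + (\<Sum>s\<in>S. (\<Sum>t\<in>S. prob s False t * v t) * flux x s False + (\<Sum>t\<in>S. prob s True t * v t) * flux x s True)"
  proof -
    have "(\<Sum>t\<in>S. v t * (flux x t False + flux x t True))
      = (\<Sum>t\<in>S. v t * R ^ idx t + (\<Sum>s\<in>S. v t * (prob s False t * flux x s False + prob s True t * flux x s True)))"
      by (intro sum.cong) (simp_all add: feasible_flux[OF x] distrib_left sum_distrib_left)
    also have "\<dots> = (\<Sum>t\<in>S. v t * R ^ idx t)
      + (\<Sum>t\<in>S. \<Sum>s\<in>S. v t * (prob s False t * flux x s False + prob s True t * flux x s True))"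
      by (simp add: sum.distrib)
    also have "(\<Sum>t\<in>S. \<Sum>s\<in>S. v t * (prob s False t * flux x s False + prob s True t * flux x s True))
      = (\<Sum>s\<in>S. \<Sum>t\<in>S. v t * (prob s False t * flux x s False + prob s True t * flux x s True))"
      by (rule sum.swap)
    also have "\<dots> = (\<Sum>s\<in>S. (\<Sum>t\<in>S. prob s False t * v t) * flux x s False + (\<Sum>t\<in>S. prob s True t * v t) * flux x s True)"
      by (intro sum.cong) (simp_all add: sum_distrib_right sum.distrib distrib_left mult.assoc mult.left_commute)
    finally show ?thesis .
  qed
  have "objval prog x = (\<Sum>s\<in>S. rew s False * flux x s False + rew s True * flux x s True)"
    unfolding objval_def prog_simps sum_col by (intro sum.cong) (simp_all add: obj_col flux_def algebra_simps)
  also have "\<dots> = (\<Sum>s\<in>S. (val v s False - v s) * flux x s False + (val v s True - v s) * flux x s True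
      + (v s * (flux x s False + flux x s True)
        - ((\<Sum>t\<in>S. prob s False t * v t) * flux x s False + (\<Sum>t\<in>S. prob s True t * v t) * flux x s True)))"
    by (intro sum.cong) (simp_all add: val_eq algebra_simps)
  also have "\<dots> = (\<Sum>s\<in>S. (val v s False - v s) * flux x s False + (val v s True - v s) * flux x s True)
      + ((\<Sum>s\<in>S. v s * (flux x s False + flux x s True))
        - (\<Sum>s\<in>S. (\<Sum>t\<in>S. prob s False t * v t) * flux x s False + (\<Sum>t\<in>S. prob s True t * v t) * flux x s True))"
    by (simp only: sum.distrib sum_subtractf)
  finally show ?thesis by (simp add: rowv)
qed

text \<open>The constant vector 1 is dual feasible.\<close>

lemma bounded: "bounded_lp prog"
  unfolding bounded_lp_def
proof (intro exI allI impI)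
  fix x assume x: "feasible_point prog x"
  have "(\<Sum>s\<in>S. (val (\<lambda>_. 1) s False - 1) * flux x s False + (val (\<lambda>_. 1) s True - 1) * flux x s True) \<le> 0"
    by (intro sum_nonpos add_nonpos_nonpos mult_nonpos_nonneg) (use val_const flux_nonneg[OF x] in auto)
  then show "objval prog x \<le> (\<Sum>s\<in>S. R ^ idx s)"
    using objval_flux[OF x, of "\<lambda>_. 1"] by simp
qed

section \<open>Feasible bases are policies\<close>

lemma card_basis: "card (basis f) = card S"
  unfolding basis_def by (rule card_image) (auto simp: inj_on_def col_inj)

lemma col_in_basis: "s \<in> S \<Longrightarrow> col s a \<in> basis f \<longleftrightarrow> a = f s"
  by (auto simp: basis_def col_inj)

lemma basis_subset: "basis f \<subseteq> {..<2 * card S}"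
  by (auto simp: basis_def col_less)

text \<open>By \<open>flux_lower\<close> each pair contains a positive variable, and positive
  variables are basic. As only \<open>card S\<close> columns are basic, each pair has exactly one of
  them, and that one is positive.\<close>

lemma feasible_basis_transversal:
  assumes "feasible_basis prog B"
  obtains f where "B = basis f" "\<And>j. j \<in> B \<Longrightarrow> 0 < basic_sol prog B j"
proof -
  define x where "x = basic_sol prog B"
  have x: "feasible_point prog x" unfolding x_def by (rule feasible_basis_point[OF assms])
  have B: "is_basis prog B" using assms by (simp add: feasible_basis_def)
  define f where "f s \<longleftrightarrow> 0 < x (col s True)" for s
  have pos: "0 < x (col s (f s))" if s: "s \<in> S" for s
  proof (cases "f s")
    case False
    then have "x (col s True) = 0" using x by (auto simp: f_def feasible_point_def intro: antisym)
    then have "0 < R ^ idx s * x (col s False)"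
      using flux_lower[OF x s] R_pos[of "idx s"] by (simp add: flux_def)
    then show ?thesis using False R_pos[of "idx s"] by (simp add: zero_less_mult_iff)
  qed (simp add: f_def)
  have "basis f \<subseteq> B"
  proof
    fix j assume "j \<in> basis f"
    then obtain s where "s \<in> S" "j = col s (f s)" by (auto simp: basis_def)
    with pos[of s] show "j \<in> B" using basic_sol_props(1)[OF B, of j] by (auto simp: x_def)
  qed
  then have eq: "B = basis f"
    using B basis_finite[OF B] by (metis card_basis card_subset_eq is_basis_def prog_simps(1))
  show ?thesis
  proof (rule that[OF eq])
    fix j assume "j \<in> B"
    then show "0 < basic_sol prog B j" using pos eq by (auto simp: basis_def x_def)
  qed
qed

lemma admissible: "admissible_lp prog"
  unfolding admissible_lp_def nondegenerate_def using bounded feasible_basis_transversal by metis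

text \<open>The values of the states, listed by position, satisfy the dual equations: the factor
  \<open>R ^ idx s\<close> stands on both sides of the equation of a column.\<close>

lemma red_cost_col:
  assumes B: "is_basis prog (basis f)" and v: "bellman f v" and s: "s \<in> S"
  shows "red_cost prog (basis f) (col s a) = R ^ idx s * (val v s a - v s)"
proof -
  define y where "y r = (if r < card S then v (en r) else 0)" for r
  have y: "y (idx t) = v t" if "t \<in> S" for t using that idx_less by (simp add: y_def)
  have dc: "(\<Sum>r<card S. y r * mat prog r (col t b)) = R ^ idx t * (v t - (\<Sum>u\<in>S. prob t b u * v u))"
    if "t \<in> S" for t b
    using dual_col[OF that, of y b] y that by simp
  have "dual_sol prog (basis f) = y"
  proof (rule dual_sol_unique[OF B])
    show "\<forall>r. nrows prog \<le> r \<longrightarrow> y r = 0" by (simp add: y_def)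
    show "\<forall>j\<in>basis f. (\<Sum>r<nrows prog. y r * mat prog r j) = obj prog j"
    proof
      fix j assume "j \<in> basis f"
      then obtain t where t: "t \<in> S" "j = col t (f t)" by (auto simp: basis_def)
      have "v t = rew t (f t) + (\<Sum>u\<in>S. prob t (f t) u * v u)"
        using v t by (simp add: bellman_def val_eq)
      then show "(\<Sum>r<nrows prog. y r * mat prog r j) = obj prog j"
        using dc[OF t(1)] t by (simp add: obj_col)
    qed
  qed
  then show ?thesis using dc[OF s] s
    by (simp add: red_cost_def obj_col val_eq algebra_simps)
qed

lemma improving_basis:
  assumes B: "is_basis prog (basis f)" and v: "bellman f v"
  shows "improving prog (basis f) = (\<lambda>s. col s (\<not> f s)) ` imp f v"
proof (intro set_eqI iffI)
  fix j assume "j \<in> improving prog (basis f)"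
  then have j: "j < 2 * card S" "j \<notin> basis f" "0 < red_cost prog (basis f) j" by (auto simp: improving_def)
  obtain s a where s: "s \<in> S" "j = col s a" using j(1) by (rule col_cases)
  have "a = (\<not> f s)" using j(2) s col_in_basis by auto
  moreover have "0 < val v s a - v s" using j(3) s red_cost_col[OF B v] R_pos[of "idx s"]
    by (simp add: zero_less_mult_iff)
  ultimately show "j \<in> (\<lambda>s. col s (\<not> f s)) ` imp f v" using s by (auto simp: imp_def adv_def)
next
  fix j assume "j \<in> (\<lambda>s. col s (\<not> f s)) ` imp f v"
  then obtain s where s: "s \<in> S" "0 < adv f v s" "j = col s (\<not> f s)" by (auto simp: imp_def)
  then show "j \<in> improving prog (basis f)"
    using red_cost_col[OF B v] R_pos[of "idx s"] col_less col_in_basis[of s "\<not> f s" f]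
    by (auto simp: improving_def adv_def)
qed

lemma basis_flip:
  assumes "s \<in> S"
  shows "basis (flip f s) = insert (col s (\<not> f s)) (basis f) - {col s (f s)}"
proof (intro set_eqI)
  fix j
  show "j \<in> basis (flip f s) \<longleftrightarrow> j \<in> insert (col s (\<not> f s)) (basis f) - {col s (f s)}"
  proof (cases "j < 2 * card S")
    case True
    then obtain t a where "t \<in> S" "j = col t a" by (rule col_cases)
    then show ?thesis using assms by (auto simp: col_in_basis col_inj)
  next
    case False
    then show ?thesis using assms basis_subset[of f] basis_subset[of "flip f s"] col_less[OF assms] by auto
  qed
qed

text \<open>Dropping any other column would leave both columns of \<open>s\<close> in the basis,
  while a feasible basis contains just one of each pair.\<close>

lemma exchange_unique:
  assumes s: "s \<in> S" and j: "j \<in> basis f"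
    and fb: "feasible_basis prog (insert (col s (\<not> f s)) (basis f) - {j})"
  shows "insert (col s (\<not> f s)) (basis f) - {j} = basis (flip f s)"
proof -
  obtain g where g: "insert (col s (\<not> f s)) (basis f) - {j} = basis g"
    using feasible_basis_transversal[OF fb] by metis
  have "j = col s (f s)"
  proof (rule ccontr)
    assume "j \<noteq> col s (f s)"
    then have "col s (f s) \<in> basis g" using s by (auto simp: g[symmetric] col_in_basis)
    moreover have "j \<noteq> col s (\<not> f s)" using s j by (auto simp: col_in_basis)
    then have "col s (\<not> f s) \<in> basis g" by (simp add: g[symmetric])
    ultimately show False using s by (simp add: col_in_basis)
  qed
  then show ?thesis using basis_flip[OF s] by simp
qed

lemma step_feasible:
  assumes fB: "feasible_basis prog (basis f)" and v: "bellman f v" and s: "s \<in> imp f v"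
  shows "feasible_basis prog (basis (flip f s))"
proof -
  have S: "s \<in> S" using s by (simp add: imp_def)
  have "col s (\<not> f s) \<in> improving prog (basis f)"
    using improving_basis[of f v] fB v s by (auto simp: feasible_basis_def)
  then obtain j where j: "j \<in> basis f" "feasible_basis prog (insert (col s (\<not> f s)) (basis f) - {j})"
    using simplex_step[OF fB bounded] by metis
  then show ?thesis using exchange_unique[OF S j] by simp
qed

lemma enter_basis_eq:
  assumes "feasible_basis prog (basis f)" "bellman f v" "s \<in> imp f v"
  shows "enter_basis prog (basis f) (col s (\<not> f s)) = basis (flip f s)"
  unfolding enter_basis_def
proof (rule the_equality)
  have S: "s \<in> S" using assms by (simp add: imp_def)
  show "\<exists>j\<in>basis f. basis (flip f s) = insert (col s (\<not> f s)) (basis f) - {j} \<and> feasible_basis prog (basis (flip f s))"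
    using step_feasible[OF assms] basis_flip[OF S] S by (auto simp: col_in_basis intro!: bexI[of _ "col s (f s)"])
  show "B' = basis (flip f s)"
    if "\<exists>j\<in>basis f. B' = insert (col s (\<not> f s)) (basis f) - {j} \<and> feasible_basis prog B'" for B'
    using that exchange_unique[OF S] by metis
qed

section \<open>Objective increase and flow through a switched state\<close>

lemma flux_outside:
  assumes "feasible_basis prog (basis f)" "s \<in> S"
  shows "flux (basic_sol prog (basis f)) s (\<not> f s) = 0"
  using assms basic_sol_props(1)[of prog "basis f" "col s (\<not> f s)"]
  by (simp add: flux_def feasible_basis_def col_in_basis)

text \<open>In \<open>objval_flux\<close> with the values of the old policy, every state other than
  \<open>s\<close> carries flow only on its old column, whose coefficient is zero. The remaining sum
  does not depend on \<open>s\<close>.\<close>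

lemma enter_objval:
  assumes fB: "feasible_basis prog (basis f)" and v: "bellman f v" and s: "s \<in> imp f v"
  shows "objval prog (enter_sol prog (basis f) (col s (\<not> f s)))
    = adv f v s * flux (basic_sol prog (basis (flip f s))) s (\<not> f s) + (\<Sum>t\<in>S. v t * R ^ idx t)"
proof -
  have S: "s \<in> S" using s by (simp add: imp_def)
  define x where "x = basic_sol prog (basis (flip f s))"
  note fB' = step_feasible[OF assms]
  have x: "feasible_point prog x" unfolding x_def by (rule feasible_basis_point[OF fB'])
  have 1: "(val v t False - v t) * flux x t False + (val v t True - v t) * flux x t True
      = (if t = s then adv f v s * flux x s (\<not> f s) else 0)" if t: "t \<in> S" for t
  proof -
    have "flux x t (\<not> flip f s t) = 0" unfolding x_def by (rule flux_outside[OF fB' t])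
    moreover have "val v t (f t) = v t" using v t by (simp add: bellman_def)
    ultimately show ?thesis by (cases "f t"; cases "t = s") (auto simp: adv_def)
  qed
  have "enter_sol prog (basis f) (col s (\<not> f s)) = x"
    by (simp add: enter_sol_def enter_basis_eq[OF assms] x_def)
  then show ?thesis
    using S finS by (simp add: x_def[symmetric] objval_flux[OF x, of v] sum.cong[OF refl 1])
qed

lemma flux_pred_closed:
  assumes fB: "feasible_basis prog (basis f)" and s: "s \<in> S"
    and C: "C \<subseteq> S" "s \<in> C" "\<And>t u. t \<in> S \<Longrightarrow> u \<in> C \<Longrightarrow> prob t (f t) u \<noteq> 0 \<Longrightarrow> t \<in> C"
      "\<And>u. u \<in> C \<Longrightarrow> prob s (f s) u = 0"
  shows "flux (basic_sol prog (basis f)) s (f s) \<le> (\<Sum>u\<in>C. R ^ idx u)"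
proof -
  define x where "x = basic_sol prog (basis f)"
  have x: "feasible_point prog x" unfolding x_def by (rule feasible_basis_point[OF fB])
  define \<phi> where "\<phi> t = flux x t (f t)" for t
  have nn: "0 \<le> \<phi> t" for t by (simp add: \<phi>_def flux_nonneg[OF x])
  have other: "flux x t (\<not> f t) = 0" if "t \<in> S" for t unfolding x_def by (rule flux_outside[OF fB that])
  have eq: "\<phi> u = R ^ idx u + (\<Sum>t\<in>S. prob t (f t) u * \<phi> t)" if u: "u \<in> S" for u
  proof -
    have "\<phi> u = flux x u False + flux x u True"
      using other[OF u] by (cases "f u") (simp_all add: \<phi>_def)
    also have "\<dots> = R ^ idx u + (\<Sum>t\<in>S. prob t False u * flux x t False + prob t True u * flux x t True)"
      by (rule feasible_flux[OF x u])
    also have "(\<Sum>t\<in>S. prob t False u * flux x t False + prob t True u * flux x t True) = (\<Sum>t\<in>S. prob t (f t) u * \<phi> t)"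
    proof (rule sum.cong)
      fix t assume "t \<in> S"
      then show "prob t False u * flux x t False + prob t True u * flux x t True = prob t (f t) u * \<phi> t"
        using other[of t] by (cases "f t") (simp_all add: \<phi>_def)
    qed simp
    finally show ?thesis .
  qed
  have finC: "finite C" using C(1) finS finite_subset by blast
  have le1: "(\<Sum>u\<in>C. prob t (f t) u) \<le> 1" if "t \<in> S" for t
  proof -
    have "(\<Sum>u\<in>C. prob t (f t) u) \<le> (\<Sum>u\<in>S. prob t (f t) u)"
      by (rule sum_mono2) (use C(1) finS prob_nonneg that in auto)
    also have "\<dots> \<le> 1" using val_const[OF that, of "f t"] rew_nonneg[OF that, of "f t"] that by (simp add: val_eq)
    finally show ?thesis .
  qed
  have "(\<Sum>u\<in>C. \<phi> u) = (\<Sum>u\<in>C. R ^ idx u) + (\<Sum>u\<in>C. \<Sum>t\<in>S. prob t (f t) u * \<phi> t)"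
    unfolding sum.distrib[symmetric] by (intro sum.cong refl eq) (use C(1) in auto)
  also have "(\<Sum>u\<in>C. \<Sum>t\<in>S. prob t (f t) u * \<phi> t) = (\<Sum>t\<in>S. (\<Sum>u\<in>C. prob t (f t) u) * \<phi> t)"
    by (simp add: sum_distrib_right) (rule sum.swap)
  also have "\<dots> = (\<Sum>t\<in>C. (\<Sum>u\<in>C. prob t (f t) u) * \<phi> t)"
  proof (rule sum.mono_neutral_right[OF finS C(1)], intro ballI)
    fix t assume "t \<in> S - C"
    then have "\<forall>u\<in>C. prob t (f t) u = 0" using C(3) by blast
    then show "(\<Sum>u\<in>C. prob t (f t) u) * \<phi> t = 0" by simp
  qed
  \<comment> \<open>The term of \<open>s\<close> vanishes because \<open>s\<close> sends nothing
    into \<open>C\<close>; this leaves its flow uncancelled at the end.\<close>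
  also have "\<dots> = (\<Sum>t\<in>C-{s}. (\<Sum>u\<in>C. prob t (f t) u) * \<phi> t)"
    using finC C(2,4) by (simp add: sum.remove[of C s])
  also have "\<dots> \<le> (\<Sum>t\<in>C-{s}. \<phi> t)"
    by (rule sum_mono) (use le1 nn C(1) in \<open>auto intro!: mult_left_le_one_le sum_nonneg prob_nonneg\<close>)
  also have "\<dots> = (\<Sum>t\<in>C. \<phi> t) - \<phi> s" using finC C(2) by (simp add: sum_diff1)
  finally show ?thesis by (simp add: \<phi>_def x_def)
qed

text \<open>No flow enters \<open>C\<close> from outside, and the flow through \<open>s\<close> leaves \<open>C\<close> at once;
  hence the flow through \<open>s\<close> is at most the total source of \<open>C\<close>.\<close>

definition pred_closed :: "('s \<Rightarrow> bool) \<Rightarrow> 's \<Rightarrow> 's set \<Rightarrow> bool" where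
  "pred_closed f s C \<longleftrightarrow> C \<subseteq> S \<and> s \<in> C \<and> (\<forall>u\<in>C. key u \<le> key s) \<and>
     (\<forall>t\<in>S. \<forall>u\<in>C. u \<in> fst ` set (tr t (f t)) \<longrightarrow> t \<in> C) \<and> C \<inter> fst ` set (tr s (f s)) = {}"

text \<open>All that an instance has to prove about a policy. The bound \<open>lo\<close> is common
  to all policies of the program, so that \<open>R\<close> can be chosen large against it.\<close>

definition nice :: "rat \<Rightarrow> ('s \<Rightarrow> bool) \<Rightarrow> ('s \<Rightarrow> rat) \<Rightarrow> bool" where
  "nice lo f v \<longleftrightarrow> bellman f v \<and> imp f v \<noteq> {} \<and>
     (\<forall>s\<in>imp f v. lo \<le> adv f v s \<and> adv f v s \<le> 1 \<and> (\<exists>C. pred_closed (flip f s) s C))"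

lemma geometric_le: "(\<Sum>i\<le>n. R ^ i) \<le> 2 * R ^ n"
proof (induction n)
  case (Suc n)
  have "2 * R ^ n \<le> R * R ^ n" using R_ge by (intro mult_right_mono) auto
  then show ?case using Suc by simp
qed simp

lemma flux_bounds:
  assumes fB: "feasible_basis prog (basis f)" and v: "bellman f v" and s: "s \<in> imp f v"
    and C: "pred_closed (flip f s) s C"
  defines "\<phi> \<equiv> flux (basic_sol prog (basis (flip f s))) s (\<not> f s)"
  shows "R ^ idx s \<le> \<phi>" "\<phi> \<le> 2 * R ^ idx s"
proof -
  note fB' = step_feasible[OF fB v s]
  have S: "s \<in> S" using s by (simp add: imp_def)
  have "flux (basic_sol prog (basis (flip f s))) s (\<not> flip f s s) = 0" by (rule flux_outside[OF fB' S])
  then show "R ^ idx s \<le> \<phi>"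
    using flux_lower[OF feasible_basis_point[OF fB'] S] by (cases "f s") (simp_all add: \<phi>_def)
  have "flux (basic_sol prog (basis (flip f s))) s (flip f s s) \<le> (\<Sum>u\<in>C. R ^ idx u)"
  proof (rule flux_pred_closed[OF fB' S])
    note C' = C[unfolded pred_closed_def]
    show "C \<subseteq> S" "s \<in> C" using C' by blast+
    show "t \<in> C" if "t \<in> S" "u \<in> C" "prob t (flip f s t) u \<noteq> 0" for t u
      using C' that(1,2) prob_nzD[OF that(3)] by blast
    show "prob s (flip f s s) u = 0" if "u \<in> C" for u
      using C' that prob_nzD[of s "flip f s s" u] by blast
  qed
  also have "\<dots> = (\<Sum>i\<in>idx ` C. R ^ i)"
    using C bij_idx by (intro sum.reindex_cong[OF _ refl, symmetric])
      (auto simp: pred_closed_def bij_betw_def intro: inj_on_subset)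
  also have "\<dots> \<le> (\<Sum>i\<le>idx s. R ^ i)"
  proof (rule sum_mono2)
    show "idx ` C \<subseteq> {..idx s}"
    proof (rule image_subsetI)
      fix u assume "u \<in> C"
      then have "u \<in> S" "\<not> key s < key u" using C unfolding pred_closed_def not_less by blast+
      then show "idx u \<in> {..idx s}" using idx_less_iff[OF S, of u] by simp
    qed
  qed simp_all
  also have "\<dots> \<le> 2 * R ^ idx s" by (rule geometric_le)
  finally show "\<phi> \<le> 2 * R ^ idx s" by (simp add: \<phi>_def)
qed

lemma col_less_iff: "s \<in> S \<Longrightarrow> t \<in> S \<Longrightarrow> s \<noteq> t \<Longrightarrow> col s a < col t b \<longleftrightarrow> key s < key t"
  using idx_inj[of s t] by (cases a; cases b) (auto simp: col_def idx_less_iff[symmetric])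

end

definition aligned :: "lp \<Rightarrow> nat set \<Rightarrow> bool" where
  "aligned P B \<longleftrightarrow> (\<forall>i\<in>improving P B. \<forall>j\<in>improving P B. i < j \<longrightarrow>
     red_cost P B i < red_cost P B j \<and> objval P (enter_sol P B i) < objval P (enter_sol P B j))"

context binary_mdp
begin

text \<open>Reduced costs at \<open>s\<close> lie between \<open>lo * R ^ idx s\<close> and
  \<open>R ^ idx s\<close>, increases between \<open>lo * R ^ idx s\<close> and
  \<open>2 * R ^ idx s\<close>, where the 2 comes from the geometric sum of sources. With
  \<open>2 < R * lo\<close> the intervals of different positions are disjoint.\<close>

lemma nice_aligned:
  assumes fB: "feasible_basis prog (basis f)" and nice: "nice lo f v" and lo: "0 < lo" "2 < R * lo"
  shows "aligned prog (basis f)"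
  unfolding aligned_def
proof (intro ballI impI)
  have v: "bellman f v" using nice by (simp add: nice_def)
  have B: "is_basis prog (basis f)" using fB by (simp add: feasible_basis_def)
  fix i j assume "i \<in> improving prog (basis f)" "j \<in> improving prog (basis f)" and ij: "i < j"
  then obtain s t where s: "s \<in> imp f v" "i = col s (\<not> f s)" and t: "t \<in> imp f v" "j = col t (\<not> f t)"
    by (auto simp: improving_basis[OF B v])
  have S: "s \<in> S" "t \<in> S" using s t by (auto simp: imp_def)
  have "s \<noteq> t" using ij s t by auto
  then have "idx s < idx t" using ij s t S col_less_iff by (simp add: idx_less_iff)
  then have "R ^ Suc (idx s) \<le> R ^ idx t" using R_ge by (intro power_increasing) auto
  then have "R ^ Suc (idx s) * lo \<le> R ^ idx t * lo" using lo by (intro mult_right_mono) auto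
  moreover have "2 * R ^ idx s < R ^ Suc (idx s) * lo"
    using mult_strict_right_mono[OF lo(2) R_pos[of "idx s"]] by (simp add: mult_ac)
  ultimately have key: "2 * R ^ idx s < R ^ idx t * lo" by simp
  have as: "adv f v s \<le> 1" "0 \<le> adv f v s" and at: "lo \<le> adv f v t"
    using nice s t by (auto simp: nice_def imp_def)
  obtain C D where C: "pred_closed (flip f s) s C" and D: "pred_closed (flip f t) t D"
    using nice s t unfolding nice_def by blast
  have "red_cost prog (basis f) i < red_cost prog (basis f) j"
  proof -
    have "red_cost prog (basis f) i = R ^ idx s * adv f v s"
      by (simp add: s(2) red_cost_col[OF B v S(1)] adv_def)
    also have "\<dots> \<le> R ^ idx s * 1" using as by (intro mult_left_mono) auto
    also have "\<dots> < R ^ idx t * lo" using key R_pos[of "idx s"] by linarith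
    also have "\<dots> \<le> R ^ idx t * adv f v t" using at by (intro mult_left_mono) auto
    finally show ?thesis by (simp add: t(2) red_cost_col[OF B v S(2)] adv_def)
  qed
  moreover have "objval prog (enter_sol prog (basis f) i) < objval prog (enter_sol prog (basis f) j)"
  proof -
    note fs = flux_bounds[OF fB v s(1) C] and ft = flux_bounds[OF fB v t(1) D]
    have "adv f v s * flux (basic_sol prog (basis (flip f s))) s (\<not> f s) \<le> 1 * (2 * R ^ idx s)"
      using as fs by (intro mult_mono) (auto intro: order_trans[OF R_nonneg])
    also have "\<dots> < R ^ idx t * lo" using key by simp
    also have "\<dots> \<le> flux (basic_sol prog (basis (flip f t))) t (\<not> f t) * adv f v t"
      using at ft lo by (intro mult_mono) (auto intro: order_trans[OF R_nonneg])
    finally show ?thesis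
      by (simp add: s(2) t(2) enter_objval[OF fB v s(1)] enter_objval[OF fB v t(1)] mult.commute)
  qed
  ultimately show "red_cost prog (basis f) i < red_cost prog (basis f) j
      \<and> objval prog (enter_sol prog (basis f) i) < objval prog (enter_sol prog (basis f) j)" by blast
qed

end

section \<open>Rules as functions of the number of improving columns\<close>

definition rank :: "lp \<Rightarrow> nat set \<Rightarrow> nat \<Rightarrow> nat" where
  "rank P B i = card {j \<in> improving P B. j \<le> i}"

lemma finite_improving: "finite (improving P B)"
  by (rule finite_subset[of _ "{..<ncols P}"]) (auto simp: improving_def)

lemma ex_strict_mono_enum:
  fixes I :: "nat set"
  assumes "finite I"
  shows "\<exists>h. bij_betw h {..<card I} I \<and> strict_mono_on {..<card I} h"
proof (intro exI conjI)
  let ?l = "sorted_list_of_set I"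
  show "bij_betw (nth ?l) {..<card I} I" using assms by (intro bij_betw_nth) auto
  show "strict_mono_on {..<card I} (nth ?l)"
    using sorted_wrt_nth_less[OF strict_sorted_list_of_set[of I]]
    by (intro strict_mono_onI) simp
qed

text \<open>The increasing bijection between the improving sets preserves the order of indices and,
  by \<open>aligned\<close>, the two other rankings, which then have no ties. Being increasing, it
  also preserves ranks.\<close>

lemma aligned_rank_eq:
  assumes \<Pi>: "pivot_rule \<Pi>" "ranking_based_BDL \<Pi>"
    and P: "admissible_lp P" "feasible_basis P B" "improving P B \<noteq> {}" "aligned P B"
    and P': "admissible_lp P'" "feasible_basis P' B'" "improving P' B' \<noteq> {}" "aligned P' B'"
    and card: "card (improving P B) = card (improving P' B')"
  shows "rank P' B' (\<Pi> P' B') = rank P B (\<Pi> P B)"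
proof -
  define I I' where "I = improving P B" and "I' = improving P' B'"
  have fin: "finite I" "finite I'" by (auto simp: I_def I'_def finite_improving)
  obtain h where h: "bij_betw h {..<card I} I" "strict_mono_on {..<card I} h"
    using ex_strict_mono_enum[OF fin(1)] by blast
  obtain h' where h': "bij_betw h' {..<card I} I'" "strict_mono_on {..<card I} h'"
    using ex_strict_mono_enum[OF fin(2)] card by (auto simp: I_def I'_def)
  define g where "g = inv_into {..<card I} h"
  define \<phi> where "\<phi> = h' \<circ> g"
  have g: "bij_betw g I {..<card I}" unfolding g_def by (rule bij_betw_inv_into[OF h(1)])
  have \<phi>: "bij_betw \<phi> I I'" unfolding \<phi>_def by (rule bij_betw_trans[OF g h'(1)])
  have less: "\<phi> i < \<phi> j" if "i \<in> I" "j \<in> I" "i < j" for i j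
  proof -
    have gi: "g i \<in> {..<card I}" "g j \<in> {..<card I}" "h (g i) = i" "h (g j) = j"
      using that g h(1) by (auto simp: bij_betw_def g_def f_inv_into_f inv_into_into)
    then have "g i < g j"
      using that(3) h(2) by (metis linorder_neqE_nat order_less_irrefl order_less_asym strict_mono_onD)
    then show ?thesis using gi h'(2) by (simp add: \<phi>_def strict_mono_onD)
  qed
  have le: "\<phi> i \<le> \<phi> j \<longleftrightarrow> i \<le> j" if "i \<in> I" "j \<in> I" for i j
    using less[of i j] less[of j i] that by (cases i j rule: linorder_cases) auto
  have \<phi>I: "\<phi> i \<in> I'" if "i \<in> I" for i using \<phi> that by (auto simp: bij_betw_def)
  have pres: "(rk i \<le> rk j) \<longleftrightarrow> (rk' (\<phi> i) \<le> rk' (\<phi> j))"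
    if "\<And>i j. i \<in> I \<Longrightarrow> j \<in> I \<Longrightarrow> i < j \<Longrightarrow> rk i < rk j"
      "\<And>i j. i \<in> I' \<Longrightarrow> j \<in> I' \<Longrightarrow> i < j \<Longrightarrow> rk' i < rk' j" "i \<in> I" "j \<in> I"
    for rk rk' :: "nat \<Rightarrow> rat" and i j
    using that(1)[OF that(3,4)] that(1)[OF that(4,3)] that(2)[OF \<phi>I[OF that(3)] \<phi>I[OF that(4)]]
      that(2)[OF \<phi>I[OF that(4)] \<phi>I[OF that(3)]] less[OF that(3,4)] less[OF that(4,3)]
    by (cases i j rule: linorder_cases) auto
  have bland: "preserves_ranking bland_le P B P' B' \<phi>"
    using le by (auto simp: preserves_ranking_def bland_le_def I_def)
  have dantzig: "preserves_ranking dantzig_le P B P' B' \<phi>"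
    unfolding preserves_ranking_def dantzig_le_def
    using pres[of "red_cost P B" "red_cost P' B'"] P(4) P'(4)
    unfolding aligned_def I_def I'_def by blast
  have increase: "preserves_ranking largest_increase_le P B P' B' \<phi>"
    unfolding preserves_ranking_def largest_increase_le_def
    using pres[of "\<lambda>i. objval P (enter_sol P B i)" "\<lambda>i. objval P' (enter_sol P' B' i)"] P(4) P'(4)
    unfolding aligned_def I_def I'_def by blast
  have "\<Pi> P' B' = \<phi> (\<Pi> P B)"
    by (rule \<Pi>(2)[unfolded ranking_based_BDL_def, rule_format, OF P(1-3) P'(1-3)
          \<phi>[unfolded I_def I'_def] bland dantzig increase])
  moreover have "\<Pi> P B \<in> I" using \<Pi>(1) P by (simp add: pivot_rule_def I_def)
  ultimately have "{j\<in>I'. j \<le> \<Pi> P' B'} = \<phi> ` {j\<in>I. j \<le> \<Pi> P B}"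
    using le \<phi> by (auto simp: bij_betw_def)
  moreover have "inj_on \<phi> {j\<in>I. j \<le> \<Pi> P B}" using \<phi> by (auto simp: bij_betw_def inj_on_def)
  ultimately show ?thesis by (simp add: rank_def I_def I'_def card_image)
qed

definition selects_rank :: "(lp \<Rightarrow> nat set \<Rightarrow> nat) \<Rightarrow> (nat \<Rightarrow> nat) \<Rightarrow> bool" where
  "selects_rank \<Pi> r \<longleftrightarrow> (\<forall>P B. admissible_lp P \<longrightarrow> feasible_basis P B \<longrightarrow> improving P B \<noteq> {} \<longrightarrow> aligned P B
     \<longrightarrow> \<Pi> P B \<in> improving P B \<and> rank P B (\<Pi> P B) = r (card (improving P B)))"

lemma ex_selects_rank:
  assumes "pivot_rule \<Pi>" "ranking_based_BDL \<Pi>"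
  shows "\<exists>r. selects_rank \<Pi> r"
proof -
  define ok where "ok P B K \<longleftrightarrow> admissible_lp P \<and> feasible_basis P B \<and> improving P B \<noteq> {} \<and> aligned P B
    \<and> card (improving P B) = K" for P B K
  \<comment> \<open>For a \<open>K\<close> that no aligned basis realizes, \<open>r K\<close> is
    arbitrary and may exceed \<open>K\<close>; hence the conditions \<open>r K \<le> K\<close>
    further on.\<close>
  define r where "r K = (SOME \<rho>. \<exists>P B. ok P B K \<and> rank P B (\<Pi> P B) = \<rho>)" for K
  have "rank P B (\<Pi> P B) = r K" if ok: "ok P B K" for P B K
  proof -
    have "\<exists>P' B'. ok P' B' K \<and> rank P' B' (\<Pi> P' B') = r K"
      unfolding r_def by (rule someI[of _ "rank P B (\<Pi> P B)"]) (use ok in blast)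
    then obtain P' B' where P': "ok P' B' K" "rank P' B' (\<Pi> P' B') = r K" by blast
    then show ?thesis
      using aligned_rank_eq[OF assms, of P' B' P B] ok by (auto simp: ok_def)
  qed
  then have "selects_rank \<Pi> r"
    using assms(1) by (auto simp: selects_rank_def ok_def pivot_rule_def)
  then show ?thesis by blast
qed

context binary_mdp
begin

lemma rank_col:
  assumes B: "is_basis prog (basis f)" and v: "bellman f v" and s: "s \<in> imp f v"
  shows "rank prog (basis f) (col s (\<not> f s)) = card {t \<in> imp f v. key t \<le> key s}"
    and "card (improving prog (basis f)) = card (imp f v)"
proof -
  have S: "t \<in> S" if "t \<in> imp f v" for t using that by (simp add: imp_def)
  have inj: "inj_on (\<lambda>s. col s (\<not> f s)) (imp f v)"
    using S by (auto simp: inj_on_def col_inj)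
  then show "card (improving prog (basis f)) = card (imp f v)"
    by (simp add: improving_basis[OF B v] card_image)
  have le: "col t (\<not> f t) \<le> col s (\<not> f s) \<longleftrightarrow> key t \<le> key s" if "t \<in> imp f v" for t
    using col_less_iff[OF S[OF s] S[OF that], of "\<not> f s" "\<not> f t"] by (cases "s = t") (auto simp: not_less[symmetric])
  have "{j \<in> improving prog (basis f). j \<le> col s (\<not> f s)} = (\<lambda>s. col s (\<not> f s)) ` {t \<in> imp f v. key t \<le> key s}"
    using le by (auto simp: improving_basis[OF B v])
  then show "rank prog (basis f) (col s (\<not> f s)) = card {t \<in> imp f v. key t \<le> key s}"
    using inj by (simp add: rank_def card_image inj_on_subset[of _ "imp f v"])
qed

text \<open>\<open>J N f\<close> reads: from the policy \<open>f\<close> at least \<open>N\<close> further iterations follow.\<close>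
lemma runs_at_least:
  assumes \<Pi>: "selects_rank \<Pi> r" and lo: "0 < lo" "2 < R * lo"
    and f0: "feasible_basis prog (basis f0)" "J N0 f0"
    and step: "\<And>N f. J N f \<Longrightarrow> 0 < N \<Longrightarrow> \<exists>v. nice lo f v \<and> (\<forall>s\<in>imp f v.
      card {t \<in> imp f v. key t \<le> key s} = r (card (imp f v)) \<longrightarrow> (\<exists>N'. N \<le> Suc N' \<and> J N' (flip f s)))"
  shows "simplex_runs_at_least \<Pi> prog (basis f0) N0"
proof -
  \<comment> \<open>\<open>div 2\<close> recovers the position of the switched state from the index
    of the entering column.\<close>
  define nxt where "nxt f = flip f (en (\<Pi> prog (basis f) div 2))" for f
  define fs where "fs t = (nxt ^^ t) f0" for t
  have one: "improving prog (basis f) \<noteq> {} \<and> feasible_basis prog (basis (nxt f))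
      \<and> (\<exists>j\<in>basis f. basis (nxt f) = insert (\<Pi> prog (basis f)) (basis f) - {j})
      \<and> (\<exists>N'. N \<le> Suc N' \<and> J N' (nxt f))"
    if fB: "feasible_basis prog (basis f)" and N: "J N f" "0 < N" for f N
  proof -
    obtain v where v: "nice lo f v" and st: "\<And>s. s \<in> imp f v \<Longrightarrow>
      card {t \<in> imp f v. key t \<le> key s} = r (card (imp f v)) \<Longrightarrow> \<exists>N'. N \<le> Suc N' \<and> J N' (flip f s)"
      using step[OF N] by blast
    have bv: "bellman f v" and ne: "imp f v \<noteq> {}" using v by (auto simp: nice_def)
    have B: "is_basis prog (basis f)" using fB by (simp add: feasible_basis_def)
    have ine: "improving prog (basis f) \<noteq> {}" using ne by (simp add: improving_basis[OF B bv])
    have sel: "\<Pi> prog (basis f) \<in> improving prog (basis f)"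
      "rank prog (basis f) (\<Pi> prog (basis f)) = r (card (improving prog (basis f)))"
      using \<Pi> admissible fB ine nice_aligned[OF fB v lo] by (auto simp: selects_rank_def)
    then obtain s where s: "s \<in> imp f v" "\<Pi> prog (basis f) = col s (\<not> f s)"
      by (auto simp: improving_basis[OF B bv])
    have S: "s \<in> S" using s by (simp add: imp_def)
    have nx: "nxt f = flip f s" by (simp add: nxt_def s(2) S)
    have "card {t \<in> imp f v. key t \<le> key s} = r (card (imp f v))"
      using sel(2) rank_col[OF B bv s(1)] by (simp add: s(2))
    from st[OF s(1) this] have "\<exists>N'. N \<le> Suc N' \<and> J N' (nxt f)" by (simp add: nx)
    moreover have "\<exists>j\<in>basis f. basis (nxt f) = insert (\<Pi> prog (basis f)) (basis f) - {j}"
      using basis_flip[OF S] S by (auto simp: nx s(2) col_in_basis intro!: bexI[of _ "col s (f s)"])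
    ultimately show ?thesis using ine step_feasible[OF fB bv s(1)] by (simp add: nx)
  qed
  have inv: "feasible_basis prog (basis (fs t)) \<and> (\<exists>N. N0 \<le> N + t \<and> J N (fs t))" if "t \<le> N0" for t
    using that
  proof (induction t)
    case 0
    then show ?case using f0 by (auto simp: fs_def)
  next
    case (Suc t)
    then obtain N where N: "feasible_basis prog (basis (fs t))" "N0 \<le> N + t" "J N (fs t)" by auto
    then have "0 < N" using Suc.prems by simp
    with one[OF N(1,3)] N(2) obtain N' where "N \<le> Suc N'" "J N' (nxt (fs t))" "feasible_basis prog (basis (nxt (fs t)))"
      by blast
    with N(2) show ?case by (auto simp: fs_def intro!: exI[of _ N'])
  qed
  show ?thesis
    unfolding simplex_runs_at_least_def
  proof (intro exI[of _ "\<lambda>t. basis (fs t)"] conjI allI impI)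
    show "basis (fs 0) = basis f0" by (simp add: fs_def)
    show "feasible_basis prog (basis f0)" by (rule f0)
    fix t assume t: "t < N0"
    then obtain N where N: "feasible_basis prog (basis (fs t))" "N0 \<le> N + t" "J N (fs t)"
      using inv[of t] by auto
    then have "0 < N" using t by simp
    note * = one[OF N(1,3) this]
    show "improving prog (basis (fs t)) \<noteq> {}"
      "\<exists>j\<in>basis (fs t). basis (fs (Suc t)) = insert (\<Pi> prog (basis (fs t))) (basis (fs t)) - {j}"
      "feasible_basis prog (basis (fs (Suc t)))"
      using * by (simp_all add: fs_def)
  qed
qed

text \<open>Ordered by \<open>\<rho>\<close> the system is triangular, since a state receives flow
  only from states of larger rank. Among the states with non-zero flow in a kernel vector, and
  likewise among those with negative flow, one of largest rank contradicts its own balance. This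
  serves the initial basis; later ones are feasible by \<open>step_feasible\<close>.\<close>

lemma acyclic_basis:
  fixes \<rho> :: "'s \<Rightarrow> nat"
  assumes \<rho>: "\<And>s t. s \<in> S \<Longrightarrow> t \<in> fst ` set (tr s (f s)) \<Longrightarrow> \<rho> t < \<rho> s"
  shows "feasible_basis prog (basis f)"
proof -
  have \<rho>': "\<rho> t < \<rho> s" if "s \<in> S" "prob s (f s) t \<noteq> 0" for s t
    by (rule \<rho>[OF that(1) prob_nzD[OF that(2)]])
  have maximal: "\<exists>t. t \<in> S \<and> Q t \<and> (\<forall>s\<in>S. \<rho> t < \<rho> s \<longrightarrow> \<not> Q s)" if "u \<in> S" "Q u" for Q u
  proof -
    have "\<exists>t. (t \<in> S \<and> Q t) \<and> (\<forall>s. s \<in> S \<and> Q s \<longrightarrow> \<rho> s \<le> \<rho> t)"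
      by (rule ex_has_greatest_nat[of _ u _ "Suc (Max (\<rho> ` S))"]) (use that finS in \<open>auto simp: less_Suc_eq_le\<close>)
    then obtain t where "t \<in> S" "Q t" "\<And>s. s \<in> S \<Longrightarrow> Q s \<Longrightarrow> \<rho> s \<le> \<rho> t" by blast
    then show ?thesis by (intro exI[of _ t]) (auto simp: not_less[symmetric])
  qed
  have row: "(\<Sum>j\<in>basis f. l j * mat prog (idx t) j) = flux l t (f t) - (\<Sum>s\<in>S. prob s (f s) t * flux l s (f s))"
    if t: "t \<in> S" for l t
  proof -
    have "(\<Sum>j\<in>basis f. l j * mat prog (idx t) j) = (\<Sum>s\<in>S. l (col s (f s)) * mat prog (idx t) (col s (f s)))"
      unfolding basis_def by (subst sum.reindex) (auto simp: inj_on_def col_inj)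
    also have "\<dots> = (\<Sum>s\<in>S. (if s = t then flux l s (f s) else 0) - prob s (f s) t * flux l s (f s))"
      by (intro sum.cong) (auto simp: mat_col t flux_def algebra_simps)
    finally show ?thesis using t finS by (simp add: sum_subtractf)
  qed
  have B: "is_basis prog (basis f)"
    unfolding is_basis_def prog_simps
  proof (intro conjI allI impI ballI)
    show "basis f \<subseteq> {..<2 * card S}" by (rule basis_subset)
    show "card (basis f) = card S" by (rule card_basis)
    fix l :: "nat \<Rightarrow> rat" and j
    assume l: "\<forall>r<card S. (\<Sum>j\<in>basis f. l j * mat prog r j) = 0" and j: "j \<in> basis f"
    show "l j = 0"
    proof (rule ccontr)
      assume nz: "l j \<noteq> 0"
      obtain u where u: "u \<in> S" "j = col u (f u)" using j by (auto simp: basis_def)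
      have "flux l u (f u) \<noteq> 0" using nz u by (simp add: flux_def)
      then obtain t where t: "t \<in> S" "flux l t (f t) \<noteq> 0" "\<And>s. s \<in> S \<Longrightarrow> \<rho> t < \<rho> s \<Longrightarrow> flux l s (f s) = 0"
        using maximal[of u "\<lambda>t. flux l t (f t) \<noteq> 0"] u by blast
      have "(\<Sum>s\<in>S. prob s (f s) t * flux l s (f s)) = 0"
        by (rule sum.neutral) (use t(3) \<rho>' in \<open>metis mult_eq_0_iff\<close>)
      then show False using row[OF t(1), of l] l idx_less[OF t(1)] t(2) by simp
    qed
  qed
  define x where "x = basic_sol prog (basis f)"
  have xo: "x j = 0" if "j \<notin> basis f" for j using basic_sol_props(1)[OF B that] by (simp add: x_def)
  have eq: "flux x t (f t) = R ^ idx t + (\<Sum>s\<in>S. prob s (f s) t * flux x s (f s))" if "t \<in> S" for t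
    using row[OF that, of x] basic_sol_props(2)[OF B, of "idx t"] sum_over_basis[OF B, of x "mat prog (idx t)"]
      xo idx_less[OF that] by (simp add: x_def)
  have "0 \<le> x j" for j
  proof (rule ccontr)
    assume neg: "\<not> 0 \<le> x j"
    then have "j \<in> basis f" using xo by force
    then obtain u where u: "u \<in> S" "j = col u (f u)" by (auto simp: basis_def)
    have "flux x u (f u) < 0" using neg u R_pos[of "idx u"] by (simp add: flux_def mult_pos_neg)
    then obtain t where t: "t \<in> S" "flux x t (f t) < 0" "\<And>s. s \<in> S \<Longrightarrow> \<rho> t < \<rho> s \<Longrightarrow> 0 \<le> flux x s (f s)"
      using maximal[of u "\<lambda>t. flux x t (f t) < 0"] u by (metis not_less)
    have "0 \<le> (\<Sum>s\<in>S. prob s (f s) t * flux x s (f s))"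
    proof (rule sum_nonneg)
      fix s assume s: "s \<in> S"
      show "0 \<le> prob s (f s) t * flux x s (f s)"
      proof (cases "prob s (f s) t = 0")
        case False
        then show ?thesis using t(3)[OF s] \<rho>'[OF s False] prob_nonneg[OF s] by simp
      qed simp
    qed
    then have "0 \<le> flux x t (f t)" by (simp add: eq[OF t(1)])
    then show False using t(2) by simp
  qed
  then show ?thesis using B by (simp add: feasible_basis_def x_def)
qed

text \<open>The diagonal entries are non-zero as there are no self-loops. This bound makes the
  family contain programs of arbitrarily large \<open>nnz\<close>.\<close>

lemma nnz_ge: "card S \<le> nnz prog"
proof -
  let ?X = "{(r, j). r < nrows prog \<and> j < ncols prog \<and> mat prog r j \<noteq> 0}"
  have fin: "finite ?X" by (rule finite_subset[of _ "{..<nrows prog} \<times> {..<ncols prog}"]) auto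
  have "card S = card ((\<lambda>s. (idx s, col s False)) ` S)"
    by (subst card_image) (auto simp: inj_on_def idx_inj)
  also have "\<dots> \<le> card ?X"
    by (rule card_mono[OF fin]) (auto simp: idx_less col_less mat_col prob_self)
  finally show ?thesis by (simp add: nnz_def)
qed

lemma nnz_le: "nnz prog \<le> (\<Sum>s\<in>S. 2 + length (tr s False) + length (tr s True))"
proof -
  let ?X = "{(r, j). r < nrows prog \<and> j < ncols prog \<and> mat prog r j \<noteq> 0}"
  define Y where "Y s a = (\<lambda>t. (idx t, col s a)) ` insert s (fst ` set (tr s a))" for s a
  have finY: "finite (Y s a)" for s a by (simp add: Y_def)
  have cY: "card (Y s a) \<le> 1 + length (tr s a)" for s a
  proof -
    have "card (Y s a) \<le> card (insert s (fst ` set (tr s a)))" unfolding Y_def by (rule card_image_le) simp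
    also have "\<dots> \<le> Suc (card (fst ` set (tr s a)))" by (rule card_insert_le_m1) simp_all
    also have "card (fst ` set (tr s a)) \<le> length (tr s a)"
      using card_image_le[of "set (tr s a)" fst] card_length[of "tr s a"] by simp
    finally show ?thesis by simp
  qed
  have "?X \<subseteq> (\<Union>s\<in>S. Y s False \<union> Y s True)"
  proof clarify
    fix r j assume "r < nrows prog" and j: "j < ncols prog" and nz: "mat prog r j \<noteq> 0"
    then have r: "en r \<in> S" "idx (en r) = r" by (simp_all add: en_in idx_en)
    obtain s a where s: "s \<in> S" "j = col s a" using j by (auto elim: col_cases)
    have "en r \<in> insert s (fst ` set (tr s a))"
    proof (rule ccontr)
      assume no: "\<not> ?thesis"
      then have "prob s a (en r) = 0" using prob_nzD[of s a "en r"] by blast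
      then have "mat prog r j = 0" using mat_col[OF s(1) r(1), of a] no by (simp add: r s)
      with nz show False by simp
    qed
    then have "(r, j) \<in> Y s a" using r s by (force simp: Y_def)
    then show "(r, j) \<in> (\<Union>s\<in>S. Y s False \<union> Y s True)" using s by (cases a) auto
  qed
  then have "card ?X \<le> card (\<Union>s\<in>S. Y s False \<union> Y s True)"
    by (intro card_mono) (auto simp: finS finY)
  also have "\<dots> \<le> (\<Sum>s\<in>S. card (Y s False \<union> Y s True))" by (rule card_UN_le[OF finS])
  also have "\<dots> \<le> (\<Sum>s\<in>S. 2 + length (tr s False) + length (tr s True))"
  proof (rule sum_mono)
    fix s
    show "card (Y s False \<union> Y s True) \<le> 2 + length (tr s False) + length (tr s True)"
      using card_Un_le[of "Y s False" "Y s True"] cY[of s False] cY[of s True] by simp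
  qed
  finally show ?thesis by (simp add: nnz_def)
qed

end

section \<open>Rules preferring low ranks: a majority counter\<close>

datatype vstate = Gate nat bool | Voter nat nat

text \<open>Voters of larger level, the faster bits, come first. Two demands agree on this: a rule
  preferring low ranks has to meet the fast bits first, and the states that lead to a voter are
  gates and deeper voters, which must precede it.\<close>

fun vkey :: "nat \<Rightarrow> vstate \<Rightarrow> nat \<times> nat \<times> nat" where
  "vkey n (Gate j b) = (0, j, if b then 1 else 0)"
| "vkey n (Voter j c) = (1, n - j, c)"

locale majority =
  fixes n \<tau> m :: nat
  assumes m_eq: "m = 2 * \<tau> + 1"
begin

lemma m_pos [simp]: "0 < m" "m \<noteq> 0" by (simp_all add: m_eq)
lemma m_ge1: "1 \<le> (of_nat m :: rat)" by (simp add: m_eq)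

definition states :: "vstate set" where
  "states = case_prod Gate ` ({..n} \<times> UNIV) \<union> case_prod Voter ` ({..<n} \<times> {..<m})"

text \<open>\<open>Gate (Suc j) True\<close> is the average over the voters of level
  \<open>j\<close>, and \<open>Gate (Suc j) False\<close> a comparison value half-way between the
  two gates of level \<open>j\<close>. Which one is better depends on the majority and on the order
  of the lower gates, as in a Gray code. The two actions of a gate coincide, so gates never
  improve.\<close>

fun tr :: "vstate \<Rightarrow> bool \<Rightarrow> (vstate \<times> rat) list" where
  "tr (Gate 0 b) a = []"
| "tr (Gate (Suc j) True) a = map (\<lambda>c. (Voter j c, 1 / of_nat m)) [0..<m]"
| "tr (Gate (Suc j) False) a = [(Gate j True, 1/2), (Gate j False, 1/2)]"
| "tr (Voter j c) a = [(Gate j a, 1)]"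

definition rew :: "vstate \<Rightarrow> bool \<Rightarrow> rat" where "rew s a = of_bool (s = Gate 0 True)"

text \<open>An advantage is the absolute value of a \<open>gap\<close>, and each level shrinks it at
  most by the factor \<open>1 / (2 * m)\<close>; \<open>base\<close> is
  \<open>3 / lo\<close>.\<close>

definition lo :: rat where "lo = (1 / (2 * of_nat m)) ^ n"
definition base :: rat where "base = 3 * (2 * of_nat m) ^ n"

lemma Gate_in [simp]: "Gate j b \<in> states \<longleftrightarrow> j \<le> n"
  and Voter_in [simp]: "Voter j c \<in> states \<longleftrightarrow> j < n \<and> c < m"
  by (auto simp: states_def)

lemma lo_pos: "0 < lo" and base_lo: "2 < base * lo"
  by (simp_all add: lo_def base_def power_one_over)

sublocale binary_mdp states "vkey n" tr rew base
proof
  show "finite states" by (simp add: states_def)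
  show "inj_on (vkey n) states" by (auto simp: states_def inj_on_def split: if_splits)
  have "1 \<le> (2 * of_nat m :: rat) ^ n" by (intro one_le_power) (use m_ge1 in linarith)
  then show "2 \<le> base" by (simp add: base_def)
  show "t \<in> states \<and> t \<noteq> s \<and> 0 < w" if "s \<in> states" "(t, w) \<in> set (tr s a)" for s a t w
    using that by (cases "(s, a)" rule: tr.cases) auto
  show "0 \<le> rew s a" for s a by (simp add: rew_def)
  show "sum_list (map snd (tr s a)) + rew s a \<le> 1" for s a
  proof -
    have "sum_list (map snd (map (\<lambda>c. (Voter j c, 1 / of_nat m :: rat)) [0..<m])) = 1" for j
      by (simp add: comp_def sum_list_triv)
    then show ?thesis by (cases "(s, a)" rule: tr.cases) (auto simp: rew_def)
  qed
qed

text \<open>\<open>pos f j\<close> tells whether \<open>Gate j True\<close> is worth more than \<open>Gate j False\<close> under the policy \<open>f\<close>,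
  and \<open>unsettled f j\<close> counts the voters of level \<open>j\<close> that choose the worse of the two.\<close>
primrec pos :: "(vstate \<Rightarrow> bool) \<Rightarrow> nat \<Rightarrow> bool" where
  "pos f 0 = True"
| "pos f (Suc j) = (card {c. c < m \<and> f (Voter j c) \<noteq> pos f j} \<le> \<tau>)"

definition unsettled :: "(vstate \<Rightarrow> bool) \<Rightarrow> nat \<Rightarrow> nat" where
  "unsettled f j = card {c. c < m \<and> f (Voter j c) \<noteq> pos f j}"

lemma pos_Suc: "pos f (Suc j) \<longleftrightarrow> unsettled f j \<le> \<tau>"
  by (simp add: unsettled_def)

definition potential :: "(vstate \<Rightarrow> bool) \<Rightarrow> nat" where
  "potential f = (\<Sum>j<n. of_bool (\<tau> < unsettled f j) * 2 ^ (n - 1 - j))"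

definition yes :: "(vstate \<Rightarrow> bool) \<Rightarrow> nat \<Rightarrow> nat" where
  "yes f j = card {c. c < m \<and> f (Voter j c)}"

text \<open>The value of \<open>Gate j True\<close> minus the value \<open>low f j\<close> of
  \<open>Gate j False\<close>; the \<open>1/2\<close> is the position of
  \<open>Gate (Suc j) False\<close> between the gates below.\<close>

primrec gap :: "(vstate \<Rightarrow> bool) \<Rightarrow> nat \<Rightarrow> rat" where
  "gap f 0 = 1"
| "gap f (Suc j) = (of_nat (yes f j) / of_nat m - 1/2) * gap f j"

primrec low :: "(vstate \<Rightarrow> bool) \<Rightarrow> nat \<Rightarrow> rat" where
  "low f 0 = 0"
| "low f (Suc j) = low f j + gap f j / 2"

fun gate_val :: "(vstate \<Rightarrow> bool) \<Rightarrow> nat \<Rightarrow> bool \<Rightarrow> rat" where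
  "gate_val f j b = low f j + of_bool b * gap f j"

fun value_of :: "(vstate \<Rightarrow> bool) \<Rightarrow> vstate \<Rightarrow> rat" where
  "value_of f (Gate j b) = gate_val f j b"
| "value_of f (Voter j c) = gate_val f j (f (Voter j c))"

section \<open>Values and improving columns of the majority counter\<close>

lemma yes_le: "yes f j \<le> m"
proof -
  have "yes f j \<le> card {..<m}" unfolding yes_def by (rule card_mono) auto
  then show ?thesis by simp
qed

lemma unsettled_eq: "unsettled f j = (if pos f j then m - yes f j else yes f j)"
proof -
  have "{c. c < m \<and> f (Voter j c) \<noteq> True} = {..<m} - {c. c < m \<and> f (Voter j c)}" by auto
  then have "card {c. c < m \<and> f (Voter j c) \<noteq> True} = m - yes f j"
    by (simp add: yes_def card_Diff_subset subset_eq)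
  then show ?thesis by (simp add: unsettled_def yes_def)
qed

text \<open>As \<open>m\<close> is odd, \<open>yes / m - 1/2\<close> is an odd multiple of
  \<open>1 / (2 * m)\<close>, hence never zero and at least that large. Its sign is the majority,
  and signs multiply along the levels just as \<open>pos\<close> recurs.\<close>

lemma gap_bounds: "(pos f j \<longleftrightarrow> 0 < gap f j) \<and> (1 / (2 * of_nat m)) ^ j \<le> \<bar>gap f j\<bar> \<and> \<bar>gap f j\<bar> \<le> 1"
proof (induction j)
  case (Suc j)
  define y :: rat where "y = of_nat (yes f j) / of_nat m - 1/2"
  have y: "y = (2 * of_nat (yes f j) - of_nat m) / (2 * of_nat m)"
    by (simp add: y_def field_simps)
  have ysgn: "0 < y \<longleftrightarrow> \<tau> < yes f j"
  proof -
    have "0 < y \<longleftrightarrow> of_nat m < (of_nat (2 * yes f j) :: rat)"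
      unfolding y by (simp add: zero_less_divide_iff)
    also have "\<dots> \<longleftrightarrow> m < 2 * yes f j" by (rule of_nat_less_iff)
    finally show ?thesis using m_eq by linarith
  qed
  have ylow: "1 / (2 * of_nat m) \<le> \<bar>y\<bar>"
  proof -
    have "(1::int) \<le> \<bar>2 * int (yes f j) - int m\<bar>" unfolding m_eq by presburger
    then have "(1::rat) \<le> \<bar>of_int (2 * int (yes f j) - int m)\<bar>" by linarith
    then show ?thesis unfolding y by (simp add: abs_divide divide_right_mono)
  qed
  have y1: "\<bar>y\<bar> \<le> 1"
  proof -
    have "(of_nat (yes f j) :: rat) / of_nat m \<le> 1" using yes_le[of f j] by (simp add: divide_le_eq)
    moreover have "0 \<le> (of_nat (yes f j) :: rat) / of_nat m" by simp
    ultimately show ?thesis unfolding y_def by linarith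
  qed
  have g: "gap f (Suc j) = y * gap f j" by (simp add: y_def)
  have "pos f (Suc j) \<longleftrightarrow> (pos f j \<longleftrightarrow> \<tau> < yes f j)"
    unfolding pos_Suc unsettled_eq using yes_le[of f j] m_eq by auto
  moreover have "0 < gap f (Suc j) \<longleftrightarrow> (0 < gap f j \<longleftrightarrow> 0 < y)"
  proof -
    have "(0::rat) < (1 / (2 * of_nat m)) ^ j" "(0::rat) < 1 / (2 * of_nat m)" by simp_all
    then have "gap f j \<noteq> 0" "y \<noteq> 0" using Suc ylow by linarith+
    then show ?thesis unfolding g by (auto simp: zero_less_mult_iff)
  qed
  moreover have "(1 / (2 * of_nat m)) ^ Suc j \<le> \<bar>gap f (Suc j)\<bar>"
    unfolding g abs_mult power_Suc by (intro mult_mono) (use Suc ylow in auto)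
  moreover have "\<bar>gap f (Suc j)\<bar> \<le> 1 * 1"
    unfolding g abs_mult by (intro mult_mono) (use Suc y1 in auto)
  ultimately show ?case using Suc ysgn by auto
qed simp

lemma bellman: "bellman f (value_of f)"
  unfolding bellman_def
proof
  fix s assume "s \<in> states"
  show "value_of f s = val (value_of f) s (f s)"
  proof (cases "(s, f s)" rule: tr.cases)
    case (1 b a)
    then show ?thesis by (auto simp: val_def rew_def)
  next
    case (2 j a)
    have "(\<Sum>(u, w)\<leftarrow>tr s (f s). w * value_of f u) = (\<Sum>c<m. (1 / of_nat m) * gate_val f j (f (Voter j c)))"
      using 2 by (simp add: comp_def interv_sum_list_conv_sum_set_nat atLeast0LessThan)
    also have "\<dots> = (1 / of_nat m) * (\<Sum>c<m. low f j + of_bool (f (Voter j c)) * gap f j)"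
      by (simp add: sum_distrib_left)
    also have "(\<Sum>c<m. low f j + of_bool (f (Voter j c)) * gap f j)
        = of_nat m * low f j + of_nat (yes f j) * gap f j"
    proof -
      have "(\<Sum>c<m. of_bool (f (Voter j c)) :: rat) = of_nat (card ({..<m} \<inter> {c. f (Voter j c)}))"
        by (simp add: sum.If_cases of_bool_def)
      also have "{..<m} \<inter> {c. f (Voter j c)} = {c. c < m \<and> f (Voter j c)}" by auto
      finally have "(\<Sum>c<m. of_bool (f (Voter j c)) :: rat) = of_nat (yes f j)" by (simp add: yes_def)
      then show ?thesis by (simp add: sum.distrib sum_distrib_right[symmetric])
    qed
    also have "(1 / of_nat m) * (of_nat m * low f j + of_nat (yes f j) * gap f j) = gate_val f (Suc j) True"
      by (simp add: field_simps)
    finally show ?thesis using 2 by (simp add: val_def rew_def)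
  next
    case (3 j a)
    then show ?thesis by (simp add: val_def rew_def field_simps)
  next
    case (4 j c a)
    then show ?thesis by (simp add: val_def rew_def)
  qed
qed

lemma adv_Gate: "adv f (value_of f) (Gate j b) = 0" if "j \<le> n"
proof -
  have tr: "tr (Gate j b) a = tr (Gate j b) a'" for a a' by (cases "(Gate j b, a)" rule: tr.cases) auto
  have "val (value_of f) (Gate j b) a = val (value_of f) (Gate j b) a'" for a a'
    unfolding val_def rew_def tr[of a a'] ..
  moreover have "value_of f (Gate j b) = val (value_of f) (Gate j b) (f (Gate j b))"
    using bellman[of f] that unfolding bellman_def by (metis Gate_in)
  ultimately show ?thesis unfolding adv_def by (metis diff_self)
qed

lemma adv_Voter: "adv f (value_of f) (Voter j c) = (if f (Voter j c) then - gap f j else gap f j)"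
  by (simp add: adv_def val_def rew_def)

lemma gap_nz: "gap f j \<noteq> 0"
proof -
  have "0 < (1 / (2 * of_nat m) :: rat) ^ j" by simp
  then show ?thesis using gap_bounds[of f j] by linarith
qed

lemma imp_eq: "imp f (value_of f) = {Voter j c | j c. j < n \<and> c < m \<and> f (Voter j c) \<noteq> pos f j}"
proof (intro set_eqI)
  fix s
  show "s \<in> imp f (value_of f) \<longleftrightarrow> s \<in> {Voter j c | j c. j < n \<and> c < m \<and> f (Voter j c) \<noteq> pos f j}"
  proof (cases s)
    case (Gate j b)
    then show ?thesis by (auto simp: imp_def adv_Gate)
  next
    case (Voter j c)
    then show ?thesis using gap_bounds[of f j] gap_nz[of f j] by (auto simp: imp_def adv_Voter)
  qed
qed

lemma nice:
  assumes "imp f (value_of f) \<noteq> {}"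
  shows "nice lo f (value_of f)"
  unfolding nice_def
proof (intro conjI ballI)
  fix s assume "s \<in> imp f (value_of f)"
  then obtain j c where s: "s = Voter j c" "j < n" "c < m" "f (Voter j c) \<noteq> pos f j" by (auto simp: imp_eq)
  have adv: "adv f (value_of f) s = \<bar>gap f j\<bar>" using s gap_bounds[of f j] by (auto simp: adv_Voter)
  have "lo \<le> (1 / (2 * of_nat m)) ^ j" unfolding lo_def
    by (intro power_decreasing) (use s in \<open>auto simp: divide_le_eq_1\<close>)
  then show "lo \<le> adv f (value_of f) s" "adv f (value_of f) s \<le> 1" using gap_bounds[of f j] adv by auto
  \<comment> \<open>Flow reaches a voter of level \<open>j\<close> only from deeper gates and
    voters, which all precede it; the voter itself leads to a gate of level \<open>j\<close>,
    outside \<open>C\<close>.\<close>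
  define C where "C = insert s ({u\<in>states. \<exists>i b. u = Gate i b \<and> j < i} \<union> {u\<in>states. \<exists>i d. u = Voter i d \<and> j < i})"
  have "pred_closed (flip f s) s C"
    unfolding pred_closed_def
  proof (intro conjI ballI impI)
    show "C \<subseteq> states" "s \<in> C" using s by (auto simp: C_def)
    show "vkey n u \<le> vkey n s" if "u \<in> C" for u using that s by (auto simp: C_def)
    show "t \<in> C" if t: "t \<in> states" and u: "u \<in> C" "u \<in> fst ` set (tr t (flip f s t))" for t u
      using t u by (cases "(t, flip f s t)" rule: tr.cases) (auto simp: C_def s)
    show "C \<inter> fst ` set (tr s (flip f s s)) = {}" by (auto simp: C_def s)
  qed
  then show "\<exists>C. pred_closed (flip f s) s C" by blast
qed (use assms bellman in auto)

lemma card_imp_le: "card (imp f (value_of f)) \<le> n * m"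
proof -
  have "imp f (value_of f) \<subseteq> case_prod Voter ` ({..<n} \<times> {..<m})" by (auto simp: imp_eq)
  then have "card (imp f (value_of f)) \<le> card (case_prod Voter ` ({..<n} \<times> {..<m}))"
    by (intro card_mono) auto
  also have "\<dots> \<le> card ({..<n} \<times> {..<m})" by (rule card_image_le) simp
  finally show ?thesis by (simp add: card_cartesian_product)
qed

section \<open>The counter under a single switch\<close>

lemma unsettled_cong:
  assumes "\<And>c. c < m \<Longrightarrow> f' (Voter i c) = f (Voter i c)" "pos f' i = pos f i"
  shows "unsettled f' i = unsettled f i"
  unfolding unsettled_def using assms by (intro arg_cong[of _ _ card]) auto

text \<open>When the two gates exchange their order, exactly the voters that were right become
  wrong. As \<open>m = 2 * \<tau> + 1\<close>, this unsettles a settled majority.\<close>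

lemma unsettled_anticong:
  assumes "\<And>c. c < m \<Longrightarrow> f' (Voter i c) = f (Voter i c)" "pos f' i \<noteq> pos f i"
  shows "unsettled f' i = m - unsettled f i"
proof -
  have "{c. c < m \<and> f' (Voter i c) \<noteq> pos f' i} = {..<m} - {c. c < m \<and> f (Voter i c) \<noteq> pos f i}"
    using assms by auto
  then show ?thesis by (simp add: unsettled_def card_Diff_subset subset_eq)
qed

lemma sum_powers_below:
  assumes "j < n"
  shows "Suc (\<Sum>i\<in>{Suc j..<n}. 2 ^ (n - 1 - i)) = (2::nat) ^ (n - 1 - j)"
proof -
  have "(\<Sum>i\<in>{Suc j..<n}. (2::nat) ^ (n - 1 - i)) = (\<Sum>i\<in>{..<n - 1 - j}. 2 ^ i)"
    by (rule sum.reindex_bij_witness[of _ "\<lambda>i. n - 1 - i" "\<lambda>i. n - 1 - i"]) auto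
  moreover have "Suc (\<Sum>i\<in>{..<k}. 2 ^ i) = (2::nat) ^ k" for k by (induction k) auto
  ultimately show ?thesis by simp
qed

lemma potential_split:
  assumes "j < n"
  shows "potential f = (\<Sum>i<j. of_bool (\<tau> < unsettled f i) * 2 ^ (n - 1 - i))
    + of_bool (\<tau> < unsettled f j) * 2 ^ (n - 1 - j)
    + (\<Sum>i\<in>{Suc j..<n}. of_bool (\<tau> < unsettled f i) * 2 ^ (n - 1 - i))"
proof -
  have "{..<n} = insert j ({..<j} \<union> {Suc j..<n})" "{..<j} \<inter> {Suc j..<n} = {}" using assms by auto
  then have "(\<Sum>i<n. g i) = (\<Sum>i<j. g i) + g j + (\<Sum>i\<in>{Suc j..<n}. g i)" for g :: "nat \<Rightarrow> nat"
    by (simp add: sum.union_disjoint)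
  then show ?thesis unfolding potential_def by blast
qed

text \<open>If all faster levels \<open>i > j\<close> have a settled majority, a flip at level \<open>j\<close> either preserves all
  majorities or settles level \<open>j\<close> and thereby unsettles all faster levels:
  the unsettled majorities, read as a binary number, drop by at most one.\<close>
lemma potential_flip:
  assumes j: "j < n" and c: "c < m" "f (Voter j c) \<noteq> pos f j"
    and fast: "\<And>i. j < i \<Longrightarrow> i < n \<Longrightarrow> unsettled f i < \<tau>"
  shows "potential f \<le> Suc (potential (flip f (Voter j c)))"
proof -
  define f' where "f' = flip f (Voter j c)"
  have f'_other: "f' (Voter i d) = f (Voter i d)" if "i \<noteq> j" for i d using that by (simp add: f'_def)
  have pos_le: "pos f' i = pos f i" if "i \<le> j" for i
    using that
  proof (induction i)
    case (Suc i)
    then have "unsettled f' i = unsettled f i" by (intro unsettled_cong) (auto simp: f'_other)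
    then show ?case by (simp only: pos_Suc)
  qed simp
  have un_less: "unsettled f' i = unsettled f i" if "i < j" for i
    using that pos_le[of i] by (intro unsettled_cong) (auto simp: f'_other)
  have un_j: "unsettled f' j = unsettled f j - 1"
  proof -
    have "{d. d < m \<and> f' (Voter j d) \<noteq> pos f' j} = {d. d < m \<and> f (Voter j d) \<noteq> pos f j} - {c}"
      using c pos_le[of j] by (auto simp: f'_def)
    then show ?thesis using c by (simp add: unsettled_def card_Diff_singleton)
  qed
  show ?thesis
  \<comment> \<open>The switch lowers the count of level \<open>j\<close> by one, so its majority
    changes just when the count was \<open>\<tau> + 1\<close>.\<close>
  proof (cases "unsettled f j = Suc \<tau>")
    case False
    then have same: "\<tau> < unsettled f' j \<longleftrightarrow> \<tau> < unsettled f j" using un_j by linarith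
    have pos: "pos f' i = pos f i" for i
    proof (induction i)
      case (Suc i)
      show ?case
      proof (cases "i = j")
        case True
        then show ?thesis using same unfolding pos_Suc not_less[symmetric] by simp
      next
        case False
        then have "unsettled f' i = unsettled f i" using Suc by (intro unsettled_cong) (auto simp: f'_other)
        then show ?thesis by (simp only: pos_Suc)
      qed
    qed simp
    have "\<tau> < unsettled f' i \<longleftrightarrow> \<tau> < unsettled f i" for i
      using same pos[of "Suc i"] unfolding pos_Suc by linarith
    then have "potential f' = potential f" by (simp add: potential_def)
    then show ?thesis by (simp add: f'_def)
  next
    case True
    have anti: "pos f' i \<noteq> pos f i" if "j < i" "i \<le> n" for i
      using that
    proof (induction i)
      case (Suc i)
      show ?case
      proof (cases "i = j")
        case True
        then show ?thesis using un_j \<open>unsettled f j = Suc \<tau>\<close> unfolding pos_Suc by simp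
      next
        case False
        then have "unsettled f' i = m - unsettled f i" "unsettled f i < \<tau>"
          using Suc by (auto intro!: unsettled_anticong f'_other fast)
        then have "\<not> unsettled f' i \<le> \<tau>" "unsettled f i \<le> \<tau>" using m_eq by linarith+
        then show ?thesis unfolding pos_Suc by blast
      qed
    qed simp
    have un': "\<tau> < unsettled f' i" if "j < i" "i < n" for i
    proof -
      have "unsettled f' i = m - unsettled f i"
        using that by (intro unsettled_anticong anti f'_other) auto
      then show ?thesis using fast[OF that] m_eq by simp
    qed
    have "potential f = (\<Sum>i<j. of_bool (\<tau> < unsettled f i) * 2 ^ (n - 1 - i)) + 2 ^ (n - 1 - j)"
    proof -
      have "(\<Sum>i\<in>{Suc j..<n}. of_bool (\<tau> < unsettled f i) * 2 ^ (n - 1 - i)) = (0::nat)"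
      proof (rule sum.neutral, rule ballI)
        fix i assume "i \<in> {Suc j..<n}"
        then have "unsettled f i < \<tau>" by (intro fast) auto
        then show "of_bool (\<tau> < unsettled f i) * 2 ^ (n - 1 - i) = (0::nat)" by simp
      qed
      then show ?thesis unfolding potential_split[OF j] using True by simp
    qed
    moreover have "potential f' = (\<Sum>i<j. of_bool (\<tau> < unsettled f i) * 2 ^ (n - 1 - i))
        + (\<Sum>i\<in>{Suc j..<n}. 2 ^ (n - 1 - i))"
      unfolding potential_split[OF j] using un' un_less un_j True by simp
    ultimately show ?thesis unfolding f'_def[symmetric] using sum_powers_below[OF j] by linarith
  qed
qed

lemma potential_pos_imp:
  assumes "0 < potential f"
  shows "imp f (value_of f) \<noteq> {}"
proof -
  have "\<exists>j<n. \<tau> < unsettled f j"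
  proof (rule ccontr)
    assume "\<not> ?thesis"
    then have "potential f = 0" by (simp add: potential_def)
    then show False using assms by simp
  qed
  then obtain j where j: "j < n" "\<tau> < unsettled f j" by blast
  then have "{c. c < m \<and> f (Voter j c) \<noteq> pos f j} \<noteq> {}" unfolding unsettled_def by (metis card.empty not_less0)
  then show ?thesis using j by (auto simp: imp_eq)
qed

text \<open>All wrong voters of deeper levels are improving and precede \<open>s\<close>, so
  together with \<open>s\<close> those of one level occupy at most \<open>\<tau>\<close> ranks.
  Counting \<open>s\<close> gives the strict bound that \<open>potential_flip\<close> asks
  for.\<close>

lemma step:
  assumes r: "\<And>K. K \<le> n * m \<Longrightarrow> r K \<le> K \<Longrightarrow> r K \<le> \<tau>"
    and s: "s \<in> imp f (value_of f)"
    and rank: "card {t \<in> imp f (value_of f). vkey n t \<le> vkey n s} = r (card (imp f (value_of f)))"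
  shows "potential f \<le> Suc (potential (flip f s))"
proof -
  let ?I = "imp f (value_of f)"
  have fin: "finite ?I" using finS by (simp add: imp_def)
  have "r (card ?I) \<le> card ?I" unfolding rank[symmetric] by (rule card_mono) (use fin in auto)
  then have le: "card {t \<in> ?I. vkey n t \<le> vkey n s} \<le> \<tau>"
    using r[OF card_imp_le] rank by simp
  obtain j c where sj: "s = Voter j c" "j < n" "c < m" "f (Voter j c) \<noteq> pos f j" using s by (auto simp: imp_eq)
  show ?thesis
    unfolding sj(1)
  proof (rule potential_flip[OF sj(2-4)])
    fix i assume i: "j < i" "i < n"
    define D where "D = {c. c < m \<and> f (Voter i c) \<noteq> pos f i}"
    have "insert s (Voter i ` D) \<subseteq> {t \<in> ?I. vkey n t \<le> vkey n s}"
      using s i sj by (auto simp: imp_eq D_def)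
    then have "card (insert s (Voter i ` D)) \<le> \<tau>"
      using le card_mono[of "{t \<in> ?I. vkey n t \<le> vkey n s}" "insert s (Voter i ` D)"] fin by simp
    moreover have "card (insert s (Voter i ` D)) = Suc (card D)"
    proof -
      have "finite D" "s \<notin> Voter i ` D" using i sj by (auto simp: D_def)
      then show ?thesis by (simp add: card_image inj_on_def)
    qed
    ultimately show "unsettled f i < \<tau>" by (simp add: unsettled_def D_def)
  qed
qed

text \<open>All voters are wrong: those of level 0 choose the worthless gate, which makes
  \<open>pos\<close> False on level 1, and wrong choices of True keep it False from there
  on.\<close>

definition start :: "vstate \<Rightarrow> bool" where
  "start s = (case s of Gate j b \<Rightarrow> False | Voter j c \<Rightarrow> 0 < j)"

lemma potential_start: "potential start = 2 ^ n - 1"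
proof -
  have m: "\<tau> < m" by (simp add: m_eq)
  have un: "unsettled start j = m" if "pos start j \<longleftrightarrow> j = 0" for j
  proof -
    have "{c. c < m \<and> start (Voter j c) \<noteq> pos start j} = {..<m}" using that by (auto simp: start_def)
    then show ?thesis by (simp add: unsettled_def)
  qed
  have "pos start j \<longleftrightarrow> j = 0" for j
  proof (cases j)
    case (Suc i)
    have "pos start i \<longleftrightarrow> i = 0" for i
    proof (induction i)
      case (Suc i)
      then show ?case using un[of i] m by (simp add: pos_Suc del: pos.simps(2))
    qed simp
    then show ?thesis by blast
  qed simp
  then have "potential start = (\<Sum>j<n. 2 ^ (n - 1 - j))" using un m by (simp add: potential_def)
  also have "\<dots> = (\<Sum>j<n. 2 ^ j)"
    by (rule sum.reindex_bij_witness[of _ "\<lambda>i. n - 1 - i" "\<lambda>i. n - 1 - i"]) auto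
  also have "\<dots> = 2 ^ n - 1" by (induction n) auto
  finally show ?thesis .
qed

lemma feasible_start: "feasible_basis prog (basis start)"
proof (rule acyclic_basis[where \<rho> = "\<lambda>s. case s of Gate j b \<Rightarrow> 2 * j | Voter j c \<Rightarrow> 2 * j + 1"])
  fix s t assume "s \<in> states" "t \<in> fst ` set (tr s (start s))"
  then show "(case t of Gate j b \<Rightarrow> 2 * j | Voter j c \<Rightarrow> 2 * j + 1)
      < (case s of Gate j b \<Rightarrow> 2 * j | Voter j c \<Rightarrow> 2 * j + 1)"
    by (cases "(s, start s)" rule: tr.cases) auto
qed

lemma nnz_bounds: "n \<le> nnz prog" "nnz prog \<le> 6 * n * m + 8 * n + 4"
proof -
  let ?w = "\<lambda>s. 2 + length (tr s False) + length (tr s True)"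
  have "n \<le> card ((\<lambda>j. Gate j False) ` {..n})" by (subst card_image) (auto simp: inj_on_def)
  also have "\<dots> \<le> card states" by (rule card_mono[OF finS]) auto
  finally show "n \<le> nnz prog" using nnz_ge by simp
  have g: "?w (Gate j False) + ?w (Gate j True) = (if j = 0 then 4 else 2 * m + 8)" for j
    by (cases j) auto
  have "(\<Sum>s\<in>states. ?w s) = (\<Sum>s\<in>case_prod Gate ` ({..n} \<times> UNIV). ?w s) + (\<Sum>s\<in>case_prod Voter ` ({..<n} \<times> {..<m}). ?w s)"
    unfolding states_def by (rule sum.union_disjoint) auto
  also have "(\<Sum>s\<in>case_prod Gate ` ({..n} \<times> UNIV). ?w s) = (\<Sum>j\<le>n. \<Sum>b\<in>UNIV. ?w (Gate j b))"
    by (subst sum.reindex) (auto simp: inj_on_def sum.cartesian_product case_prod_unfold)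
  also have "\<dots> = (\<Sum>j\<le>n. if j = 0 then 4 else 2 * m + 8)"
    using g by (simp add: UNIV_bool add.commute)
  also have "\<dots> = n * (2 * m + 8) + 4"
    by (induction n) auto
  also have "(\<Sum>s\<in>case_prod Voter ` ({..<n} \<times> {..<m}). ?w s) = (\<Sum>p\<in>{..<n} \<times> {..<m}. 4)"
    by (subst sum.reindex) (simp_all add: inj_on_def case_prod_unfold prod_eq_iff)
  also have "\<dots> = 4 * (n * m)" by (simp add: card_cartesian_product)
  finally show "nnz prog \<le> 6 * n * m + 8 * n + 4" using nnz_le by (simp add: algebra_simps)
qed

end

theorem low_rank_lower_bound:
  assumes "selects_rank \<Pi> r" and r: "\<And>K. K \<le> n * (2 * \<tau> + 1) \<Longrightarrow> r K \<le> K \<Longrightarrow> r K \<le> \<tau>"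
  shows "\<exists>P B. admissible_lp P \<and> feasible_basis P B \<and> n \<le> nnz P \<and> nnz P \<le> 6 * n * (2 * \<tau> + 1) + 8 * n + 4
    \<and> simplex_runs_at_least \<Pi> P B (2 ^ n - 1)"
proof -
  define m where "m = 2 * \<tau> + 1"
  interpret majority n \<tau> m by unfold_locales (rule m_def)
  have "simplex_runs_at_least \<Pi> prog (basis start) (2 ^ n - 1)"
  proof (rule runs_at_least[where J = "\<lambda>N f. N \<le> potential f" and lo = lo, OF assms(1) lo_pos base_lo feasible_start])
    show "2 ^ n - 1 \<le> potential start" by (simp only: potential_start order_refl)
    fix N f assume N: "N \<le> potential f" "0 < N"
    then have "nice lo f (value_of f)" by (intro nice potential_pos_imp) simp
    moreover have "\<exists>N'. N \<le> Suc N' \<and> N' \<le> potential (flip f s)"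
      if "s \<in> imp f (value_of f)" "card {t \<in> imp f (value_of f). vkey n t \<le> vkey n s} = r (card (imp f (value_of f)))" for s
      using step[where r = r, OF r[folded m_def] that] N by (intro exI[of _ "potential (flip f s)"]) simp
    ultimately show "\<exists>v. nice lo f v \<and> (\<forall>s\<in>imp f v. card {t \<in> imp f v. vkey n t \<le> vkey n s} = r (card (imp f v))
        \<longrightarrow> (\<exists>N'. N \<le> Suc N' \<and> N' \<le> potential (flip f s)))" by blast
  qed
  then show ?thesis unfolding m_def[symmetric] using admissible feasible_start nnz_bounds by blast
qed

section \<open>Rules preferring higher ranks: an odometer\<close>

datatype ostate = Port nat bool | Latch nat nat bool | Hand nat nat | Guard nat bool | Seal nat | Low nat | High nat

text \<open>Latches of deeper wheels come later, so a rule taking the last of the wheel columns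
  moves the deepest unfinished wheel first. Hands are ordered the other way, because everything
  deeper may lead to a hand and must precede it; this does no harm, as at most one hand is improving
  in the configurations that occur.\<close>

fun okey :: "nat \<Rightarrow> ostate \<Rightarrow> nat \<times> nat \<times> nat" where
  "okey n (Port j b) = (0, j, if b then 1 else 0)"
| "okey n (Low i) = (1, 0, i)"
| "okey n (Guard j b) = (2, j, if b then 1 else 0)"
| "okey n (Seal j) = (2, j, 2)"
| "okey n (Latch j l b) = (3, j, 2 * l + (if b then 1 else 0))"
| "okey n (Hand j l) = (4, n - j, l)"
| "okey n (High i) = (5, 0, i)"

lemma sum_even_below: "h \<le> N \<Longrightarrow> (\<Sum>l<N. of_bool (even l \<and> l < h)) = (of_nat ((h + 1) div 2) :: rat)"
proof -
  assume "h \<le> N"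
  then have "(\<Sum>l<N. of_bool (even l \<and> l < h) :: rat) = (\<Sum>l<h. of_bool (even l \<and> l < h))"
    by (intro sum.mono_neutral_right) auto
  also have "\<dots> = (\<Sum>l<h. of_bool (even l))" by (intro sum.cong) auto
  also have "\<dots> = of_nat ((h + 1) div 2)" by (induction h) (auto elim!: evenE oddE)
  finally show ?thesis .
qed

lemma sum_odd_below: "h \<le> N \<Longrightarrow> (\<Sum>l<N. of_bool (odd l \<and> l < h)) = (of_nat (h div 2) :: rat)"
proof -
  assume "h \<le> N"
  then have "(\<Sum>l<N. of_bool (odd l \<and> l < h) :: rat) = (\<Sum>l<h. of_bool (odd l \<and> l < h))"
    by (intro sum.mono_neutral_right) auto
  also have "\<dots> = (\<Sum>l<h. of_bool (odd l))" by (intro sum.cong) auto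
  also have "\<dots> = of_nat (h div 2)" by (induction h) (auto elim!: evenE oddE)
  finally show ?thesis .
qed

lemma sum_list_filter_upt:
  "(\<Sum>l\<leftarrow>filter P [0..<N]. g l) = (\<Sum>l<N. of_bool (P l) * (g l :: rat))"
proof -
  have "(\<Sum>l\<leftarrow>filter P [0..<N]. g l) = (\<Sum>l\<leftarrow>[0..<N]. if P l then g l else 0)"
    by (rule sum_list_map_filter')
  also have "\<dots> = (\<Sum>l<N. if P l then g l else 0)"
    by (simp only: interv_sum_list_conv_sum_set_nat atLeast0LessThan set_upt)
  also have "\<dots> = (\<Sum>l<N. of_bool (P l) * g l)" by (intro sum.cong) auto
  finally show ?thesis .
qed

text \<open>Used for \<open>Port (Suc j) False\<close>: \<open>F\<close> and \<open>w\<close> are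
  floor and width of wheel \<open>j\<close>, \<open>q\<close> the number of moved hands of odd
  position.\<close>

lemma port_algebra:
  fixes b :: rat
  assumes "b + 1 \<noteq> 0"
  shows "1 / (b + 1) * (2 * F + w) + (2 / (b + 1) * F * ((b - 1) / 2) + 2 / (b + 1) * w * q) = F + w / (b + 1) * (1 + 2 * q)"
proof -
  have "2 / x * F * (y / 2) = F * y / x" for x y :: rat by simp
  then have e: "2 / (b + 1) * F * ((b - 1) / 2) = F * (b - 1) / (b + 1)" .
  have "1 / (b + 1) * (2 * F + w) + (2 / (b + 1) * F * ((b - 1) / 2) + 2 / (b + 1) * w * q)
    = (2 * F + w + F * (b - 1) + 2 * w * q) / (b + 1)" unfolding e by (simp add: add_divide_distrib)
  also have "2 * F + w + F * (b - 1) + 2 * w * q = F * (b + 1) + w * (1 + 2 * q)" by (simp add: algebra_simps)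
  finally show ?thesis using assms by (simp add: add_divide_distrib)
qed

locale odometer =
  fixes n \<beta> L H :: nat
  assumes odd_beta: "odd \<beta>"
begin

text \<open>One full turn of a wheel: \<open>\<beta> + 1\<close> latches are set,
  \<open>\<beta>\<close> hands move, \<open>\<beta> + 1\<close> latches are released.\<close>

abbreviation top :: nat where "top \<equiv> 3 * \<beta> + 2"

definition states :: "ostate set" where
  "states = case_prod Port ` ({..n} \<times> UNIV)
    \<union> (\<lambda>(j, l, b). Latch j l b) ` ({..<n} \<times> {..\<beta>} \<times> UNIV)
    \<union> case_prod Hand ` ({..<n} \<times> {..<\<beta>})
    \<union> case_prod Guard ` ({..<n} \<times> UNIV) \<union> Seal ` {..<n} \<union> Low ` {..<L} \<union> High ` {..<H}"

lemma states_iff [simp]: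
  "Port j b \<in> states \<longleftrightarrow> j \<le> n" "Latch j l b \<in> states \<longleftrightarrow> j < n \<and> l \<le> \<beta>"
  "Hand j l \<in> states \<longleftrightarrow> j < n \<and> l < \<beta>" "Guard j b \<in> states \<longleftrightarrow> j < n" "Seal j \<in> states \<longleftrightarrow> j < n"
  "Low i \<in> states \<longleftrightarrow> i < L" "High i \<in> states \<longleftrightarrow> i < H"
  by (auto simp: states_def intro!: image_eqI[where x = "(j, l, b)"])

text \<open>Wheel \<open>j\<close> follows the better one of \<open>Port j True\<close> and \<open>Port j False\<close>. When the order of these two
  changes, the latches of the new side are set one after the other (action \<open>True\<close>: copy the previous latch),
  each followed at once by its hand; then the latches of the old side are released in reverse order (action
  \<open>False\<close>: copy the next latch). Only the hands influence the ports of wheel \<open>j + 1\<close>, and each of their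
  moves changes the order of these ports. A direct move of a hand from one port to the other would be a
  large improvement that cannot be postponed; this is why it has to wait for its latch, whose own switch
  is worth little. \<open>Guard\<close> and \<open>Seal\<close> are improving exactly when needed to keep the number of
  improving columns of the wheel equal to three, and \<open>Low\<close>, \<open>High\<close> are always improving.\<close>

definition eps :: rat where "eps = (1 / (of_nat \<beta> + 1)) ^ n / (4 * of_nat \<beta>)"
definition base :: rat where "base = 3 / eps"

text \<open>The latches of a wheel form a path from \<open>Port j True\<close> along one side,
  across the two latches \<open>\<beta>\<close> and along the other side to
  \<open>Port j False\<close>; each latch follows one of its two neighbours. The weights of the
  ports sum to 1 and, when the first \<open>h\<close> hands have moved, put the two ports of the
  next wheel \<open>h\<close> and \<open>h + 1\<close> steps above the same floor, in an order that
  alternates with \<open>h\<close>.\<close>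

fun tr :: "ostate \<Rightarrow> bool \<Rightarrow> (ostate \<times> rat) list" where
  "tr (Port 0 b) a = []"
| "tr (Port (Suc j) True) a = map (\<lambda>l. (Hand j l, 2 / (of_nat \<beta> + 1))) (filter even [0..<\<beta>])"
| "tr (Port (Suc j) False) a = (Port j True, 1 / (of_nat \<beta> + 1)) # (Port j False, 1 / (of_nat \<beta> + 1))
    # map (\<lambda>l. (Hand j l, 2 / (of_nat \<beta> + 1))) (filter odd [0..<\<beta>])"
| "tr (Latch j l b) a = (if a then if l = 0 then [(Port j b, 1)] else [(Latch j (l - 1) b, 1)]
    else if l < \<beta> then [(Latch j (Suc l) b, 1)] else [(Latch j l (\<not> b), 1)])"
| "tr (Hand j l) a = [(Latch j l a, 1)]"
| "tr (Guard j b) a = map (\<lambda>l. (if a then Hand j l else Latch j l b, 1 / (2 * of_nat \<beta>))) [0..<\<beta>]"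
| "tr (Seal j) a = (if a then [(Latch j 0 True, 1/2), (Latch j 0 False, 1/2)] else [(Port j True, 1/2), (Port j False, 1/2)])"
| "tr (Low i) a = []"
| "tr (High i) a = []"

fun rew :: "ostate \<Rightarrow> bool \<Rightarrow> rat" where
  "rew (Port j b) a = of_bool (j = 0 \<and> b)"
| "rew (Guard j b) a = of_bool a * eps"
| "rew (Low i) a = of_bool a"
| "rew (High i) a = of_bool a"
| "rew _ a = 0"

lemma beta_pos: "0 < \<beta>" using odd_beta by (rule odd_pos)
lemma beta_ge1: "1 \<le> (of_nat \<beta> :: rat)" using beta_pos by (simp add: Suc_le_eq)

lemma eps_pos: "0 < eps" using beta_pos by (simp add: eps_def)

lemma eps_le: "j \<le> n \<Longrightarrow> eps \<le> (1 / (of_nat \<beta> + 1)) ^ j / (4 * of_nat \<beta>)"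
  unfolding eps_def by (intro divide_right_mono power_decreasing) auto

lemma eps_le_quarter: "eps \<le> 1/4"
proof -
  have "eps \<le> 1 / (4 * of_nat \<beta>)" using eps_le[of 0] by simp
  also have "\<dots> \<le> 1/4" using beta_ge1 by (simp add: divide_le_eq)
  finally show ?thesis .
qed

lemma base_eps: "2 < base * eps" using eps_pos by (simp add: base_def)

lemma even_count: "(\<Sum>l<\<beta>. of_bool (even l)) = (of_nat \<beta> + 1) / (2 :: rat)"
proof -
  obtain q where q: "\<beta> = 2 * q + 1" using odd_beta by (auto elim: oddE)
  have "(\<Sum>l<\<beta>. of_bool (even l) :: rat) = (\<Sum>l<\<beta>. of_bool (even l \<and> l < \<beta>))" by (intro sum.cong) auto
  also have "\<dots> = of_nat ((\<beta> + 1) div 2)" by (rule sum_even_below) simp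
  finally show ?thesis by (simp add: q)
qed

lemma odd_count: "(\<Sum>l<\<beta>. of_bool (odd l)) = (of_nat \<beta> - 1) / (2 :: rat)"
proof -
  obtain q where q: "\<beta> = 2 * q + 1" using odd_beta by (auto elim: oddE)
  have "(\<Sum>l<\<beta>. of_bool (odd l) :: rat) = (\<Sum>l<\<beta>. of_bool (odd l \<and> l < \<beta>))" by (intro sum.cong) auto
  also have "\<dots> = of_nat (\<beta> div 2)" by (rule sum_odd_below) simp
  finally show ?thesis by (simp add: q)
qed

sublocale binary_mdp states "okey n" tr rew base
proof
  show "finite states" by (simp add: states_def)
  show "inj_on (okey n) states"
  proof (rule inj_onI)
    fix s t assume st: "s \<in> states" "t \<in> states" "okey n s = okey n t"
    show "s = t"
    proof (cases s)
      case (Latch j l b)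
      with st obtain j' l' b' where t: "t = Latch j' l' b'" by (cases t) auto
      from st(3) have "j = j'" "2 * l + (if b then 1 else 0) = 2 * l' + (if b' then 1 else 0)" by (auto simp: Latch t)
      then show ?thesis by (cases b; cases b'; simp add: Latch t; presburger)
    next
      case (Hand j l) with st show ?thesis by (cases t) auto
    next
      case (Port j b) with st show ?thesis by (cases t) (auto split: if_splits)
    next
      case (Guard j b) with st show ?thesis by (cases t) (auto split: if_splits)
    next
      case (Seal j) with st show ?thesis by (cases t) (auto split: if_splits)
    next
      case (Low j) with st show ?thesis by (cases t) auto
    next
      case (High j) with st show ?thesis by (cases t) auto
    qed
  qed
  show "2 \<le> base" using eps_pos eps_le_quarter by (simp add: base_def pos_le_divide_eq)
  show "t \<in> states \<and> t \<noteq> s \<and> 0 < w" if "s \<in> states" "(t, w) \<in> set (tr s a)" for s a t w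
    using that beta_ge1 by (cases "(s, a)" rule: tr.cases) (auto split: if_splits)
  show "0 \<le> rew s a" for s a using eps_pos by (cases "(s, a)" rule: rew.cases) auto
  show "sum_list (map snd (tr s a)) + rew s a \<le> 1" for s a
  proof (cases "(s, a)" rule: tr.cases)
    case (2 j a)
    have "sum_list (map snd (tr (Port (Suc j) True) a)) = (\<Sum>l<\<beta>. of_bool (even l) * (2 / (of_nat \<beta> + 1)))"
      by (simp only: tr.simps map_map comp_def snd_conv sum_list_filter_upt)
    also have "\<dots> = 1" using beta_ge1 by (simp only: sum_distrib_right[symmetric] even_count) simp
    finally show ?thesis using 2 by simp
  next
    case (3 j a)
    have "sum_list (map snd (tr (Port (Suc j) False) a))
      = 2 / (of_nat \<beta> + 1) + (\<Sum>l<\<beta>. of_bool (odd l) * (2 / (of_nat \<beta> + 1)))"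
      by (simp only: tr.simps list.map map_map comp_def snd_conv sum_list_filter_upt sum_list.Cons)
    also have "\<dots> = 2 / (of_nat \<beta> + 1) + (of_nat \<beta> - 1) / 2 * (2 / (of_nat \<beta> + 1))"
      by (simp only: sum_distrib_right[symmetric] odd_count)
    also have "\<dots> = 1"
    proof -
      have e: "y / 2 * (2 / x) = y / x" for x y :: rat by simp
      show ?thesis using beta_ge1 unfolding e by (simp add: add_divide_distrib[symmetric])
    qed
    finally show ?thesis using 3 by simp
  next
    case (6 j b a)
    then show ?thesis using eps_le_quarter beta_ge1 by (simp add: comp_def sum_list_triv)
  qed (auto split: if_splits)
qed

text \<open>\<open>k j\<close> is the number of moves that wheel \<open>j\<close> has made since its ports last changed their order.\<close>

definition hands :: "(nat \<Rightarrow> nat) \<Rightarrow> nat \<Rightarrow> nat" where "hands k j = min (k j div 2) \<beta>"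

fun lead :: "(nat \<Rightarrow> nat) \<Rightarrow> nat \<Rightarrow> bool" where
  "lead k 0 = True"
| "lead k (Suc j) = odd (hands k j)"

text \<open>The schedule of a wheel: on the leading side latch \<open>l\<close> moves at time
  \<open>2 * l + 1\<close> and hand \<open>l\<close> at time \<open>2 * l + 2\<close>; on the other
  side latch \<open>l\<close> is released at time \<open>top - l\<close>. Having moved means having
  the value of the better port.\<close>

fun moved :: "(nat \<Rightarrow> nat) \<Rightarrow> ostate \<Rightarrow> bool" where
  "moved k (Latch j l b) = (if b = lead k j then 2 * l + 1 \<le> k j else top \<le> k j + l)"
| "moved k (Hand j l) = (2 * l + 2 \<le> k j)"
| "moved k _ = False"

fun choice :: "(nat \<Rightarrow> nat) \<Rightarrow> ostate \<Rightarrow> bool" where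
  "choice k (Latch j l b) = (moved k (Latch j l b) = (b = lead k j))"
| "choice k (Hand j l) = (moved k (Hand j l) = lead k j)"
| "choice k _ = False"

text \<open>It is False outside \<open>states\<close>, so that \<open>policy_succ\<close> can be an
  equality of functions. Guards, seals and additional states stay at False: they may be improving
  but are never selected.\<close>

definition policy :: "(nat \<Rightarrow> nat) \<Rightarrow> ostate \<Rightarrow> bool" where
  "policy k s \<longleftrightarrow> s \<in> states \<and> choice k s"

definition width :: "nat \<Rightarrow> rat" where "width j = (1 / (of_nat \<beta> + 1)) ^ j"

text \<open>The value of the worse port of wheel \<open>j\<close>; each moved hand lifts the next
  floor by one \<open>width\<close>.\<close>

primrec floor_val :: "(nat \<Rightarrow> nat) \<Rightarrow> nat \<Rightarrow> rat" where
  "floor_val k 0 = 0"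
| "floor_val k (Suc j) = floor_val k j + width (Suc j) * of_nat (hands k j)"

fun value_of :: "(nat \<Rightarrow> nat) \<Rightarrow> ostate \<Rightarrow> rat" where
  "value_of k (Port j b) = floor_val k j + of_bool (b = lead k j) * width j"
| "value_of k (Latch j l b) = floor_val k j + of_bool (moved k (Latch j l b)) * width j"
| "value_of k (Hand j l) = floor_val k j + of_bool (moved k (Hand j l)) * width j"
| "value_of k (Guard j b) = (\<Sum>l<\<beta>. floor_val k j + of_bool (moved k (Latch j l b)) * width j) / (2 * of_nat \<beta>)"
| "value_of k (Seal j) = floor_val k j + width j / 2"
| "value_of k (Low i) = 0"
| "value_of k (High i) = 0"

section \<open>Bellman equations of the odometer\<close>

lemma width_Suc: "width (Suc j) = width j / (of_nat \<beta> + 1)" by (simp add: width_def)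
lemma width_pos: "0 < width j" by (simp add: width_def add_nonneg_pos)
lemma width_le: "width j \<le> 1" using beta_ge1 by (simp add: width_def power_le_one)

lemma moved_Hand_iff: "l < \<beta> \<Longrightarrow> moved k (Hand j l) \<longleftrightarrow> l < hands k j"
  by (auto simp: hands_def)

lemma hands_le: "hands k j \<le> \<beta>" by (simp add: hands_def)

lemma val_Port_Suc: "val (value_of k) (Port (Suc j) b) a = value_of k (Port (Suc j) b)"
proof -
  let ?h = "hands k j" and ?F = "floor_val k j" and ?w = "width j"
  have b0: "(of_nat \<beta> + 1 :: rat) \<noteq> 0" using beta_ge1 by linarith
  have hand: "of_bool (P l) * (c * value_of k (Hand j l)) = c * ?F * of_bool (P l) + c * ?w * of_bool (P l \<and> l < ?h)"
    if "l < \<beta>" for P l and c :: rat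
    using moved_Hand_iff[OF that, of k j] by (simp add: algebra_simps)
  show ?thesis
  proof (cases b)
    case True
    have "(\<Sum>(u, w)\<leftarrow>tr (Port (Suc j) True) a. w * value_of k u)
      = (\<Sum>l<\<beta>. of_bool (even l) * (2 / (of_nat \<beta> + 1) * value_of k (Hand j l)))"
      by (simp add: comp_def sum_list_filter_upt del: value_of.simps)
    also have "\<dots> = (\<Sum>l<\<beta>. 2 / (of_nat \<beta> + 1) * ?F * of_bool (even l) + 2 / (of_nat \<beta> + 1) * ?w * of_bool (even l \<and> l < ?h))"
      by (intro sum.cong refl hand) simp
    also have "\<dots> = 2 / (of_nat \<beta> + 1) * ?F * ((of_nat \<beta> + 1) / 2) + 2 / (of_nat \<beta> + 1) * ?w * of_nat ((?h + 1) div 2)"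
      by (simp only: sum.distrib sum_distrib_left[symmetric] even_count sum_even_below[OF hands_le])
    also have "\<dots> = ?F + width (Suc j) * (2 * of_nat ((?h + 1) div 2))" using b0 by (simp add: width_Suc)
    also have "(2 * of_nat ((?h + 1) div 2) :: rat) = of_nat ?h + of_bool (odd ?h)"
    proof -
      have "2 * ((?h + 1) div 2) = ?h + of_bool (odd ?h)" by (cases "even ?h") (auto elim!: evenE oddE)
      then have "(of_nat (2 * ((?h + 1) div 2)) :: rat) = of_nat (?h + of_bool (odd ?h))" by (rule arg_cong)
      then show ?thesis by simp
    qed
    finally show ?thesis using True by (simp add: val_def algebra_simps)
  next
    case False
    have "(\<Sum>(u, w)\<leftarrow>tr (Port (Suc j) False) a. w * value_of k u)
      = 1 / (of_nat \<beta> + 1) * (2 * ?F + ?w) + (\<Sum>l<\<beta>. of_bool (odd l) * (2 / (of_nat \<beta> + 1) * value_of k (Hand j l)))"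
      by (cases "lead k j") (simp_all add: comp_def sum_list_filter_upt add_divide_distrib del: value_of.simps(3))
    also have "(\<Sum>l<\<beta>. of_bool (odd l) * (2 / (of_nat \<beta> + 1) * value_of k (Hand j l)))
      = (\<Sum>l<\<beta>. 2 / (of_nat \<beta> + 1) * ?F * of_bool (odd l) + 2 / (of_nat \<beta> + 1) * ?w * of_bool (odd l \<and> l < ?h))"
      by (intro sum.cong refl hand) simp
    also have "\<dots> = 2 / (of_nat \<beta> + 1) * ?F * ((of_nat \<beta> - 1) / 2) + 2 / (of_nat \<beta> + 1) * ?w * of_nat (?h div 2)"
      by (simp only: sum.distrib sum_distrib_left[symmetric] odd_count sum_odd_below[OF hands_le])
    also have "1 / (of_nat \<beta> + 1) * (2 * ?F + ?w) + \<dots> = ?F + width (Suc j) * (1 + 2 * of_nat (?h div 2))"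
      unfolding width_Suc by (rule port_algebra[OF b0])
    also have "(1 + 2 * of_nat (?h div 2) :: rat) = of_nat ?h + of_bool (even ?h)"
    proof -
      have "1 + 2 * (?h div 2) = ?h + of_bool (even ?h)" by (cases "even ?h") (auto elim!: evenE oddE)
      then have "(of_nat (1 + 2 * (?h div 2)) :: rat) = of_nat (?h + of_bool (even ?h))" by (rule arg_cong)
      then show ?thesis by simp
    qed
    finally show ?thesis using False by (simp add: val_def algebra_simps)
  qed
qed

lemma val_Port: "val (value_of k) (Port j b) a = value_of k (Port j b)"
proof (cases j)
  case 0
  then show ?thesis by (auto simp: val_def width_def)
next
  case (Suc i)
  then show ?thesis using val_Port_Suc by simp
qed

lemma val_Guard_False: "val (value_of k) (Guard j b) False = value_of k (Guard j b)"
  by (simp add: val_def comp_def interv_sum_list_conv_sum_set_nat atLeast0LessThan sum_divide_distrib del: moved.simps)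

lemma val_Guard_True: "val (value_of k) (Guard j b) True
    = eps + (\<Sum>l<\<beta>. floor_val k j + of_bool (moved k (Hand j l)) * width j) / (2 * of_nat \<beta>)"
  by (simp add: val_def comp_def interv_sum_list_conv_sum_set_nat atLeast0LessThan sum_divide_distrib del: moved.simps)

lemma bellman: "bellman (policy k) (value_of k)"
  unfolding bellman_def
proof
  fix s assume s: "s \<in> states"
  have p: "policy k s = choice k s" using s by (simp add: policy_def)
  show "value_of k s = val (value_of k) s (policy k s)"
  proof (cases s)
    case (Port j b) then show ?thesis by (simp add: val_Port del: value_of.simps)
  next
    case (Latch j l b)
    then have l: "l \<le> \<beta>" using s by simp
    show ?thesis
      unfolding p unfolding Latch
      by (cases "b = lead k j"; cases "moved k (Latch j l b)"; cases l; cases "l < \<beta>")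
        (use l beta_pos in \<open>auto simp: val_def\<close>)
  next
    case (Hand j l)
    then have l: "l < \<beta>" using s by simp
    then show ?thesis unfolding p unfolding Hand by (auto simp: val_def)
  next
    case (Guard j b) then show ?thesis unfolding p by (simp add: val_Guard_False del: value_of.simps)
  next
    case (Seal j) then show ?thesis unfolding p by (simp add: val_def) (auto simp: field_simps)
  qed (simp_all add: policy_def val_def)
qed

section \<open>Advantages of single switches\<close>

abbreviation "gain k \<equiv> adv (policy k) (value_of k)"
abbreviation "improv k \<equiv> imp (policy k) (value_of k)"

lemma gain_Port: "gain k (Port j b) = 0"
  by (simp add: adv_def val_Port del: value_of.simps)

text \<open>A latch of the leading side is ready once its predecessor has moved, hence already while
  the hand in between is still waiting (\<open>k j + 1 = 2 * l\<close>).\<close>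

definition ready :: "(nat \<Rightarrow> nat) \<Rightarrow> ostate \<Rightarrow> bool" where
  "ready k s \<longleftrightarrow> (case s of
     Latch j l b \<Rightarrow> (if b = lead k j then k j = 2 * l \<or> k j + 1 = 2 * l else k j + l + 1 = top)
   | Hand j l \<Rightarrow> k j = 2 * l + 1 | _ \<Rightarrow> False)"

lemma gain_Latch:
  assumes "j < n" "l \<le> \<beta>"
  shows "ready k (Latch j l b) \<Longrightarrow> gain k (Latch j l b) = width j"
    and "\<not> ready k (Latch j l b) \<Longrightarrow> gain k (Latch j l b) \<le> 0"
  using assms beta_pos width_pos[of j] unfolding ready_def adv_def policy_def
  by (cases "b = lead k j"; cases "moved k (Latch j l b)"; cases l; cases "l < \<beta>"; auto simp: val_def)+

lemma gain_Hand:
  assumes "j < n" "l < \<beta>"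
  shows "ready k (Hand j l) \<Longrightarrow> gain k (Hand j l) = width j"
    and "\<not> ready k (Hand j l) \<Longrightarrow> gain k (Hand j l) \<le> 0"
  using assms beta_pos width_pos[of j] unfolding ready_def adv_def policy_def by (auto simp: val_def)

text \<open>Latch \<open>k j div 2\<close> of the leading side has moved but its hand has
  not.\<close>

definition pending :: "(nat \<Rightarrow> nat) \<Rightarrow> nat \<Rightarrow> bool" where
  "pending k j \<longleftrightarrow> odd (k j) \<and> k j < 2 * \<beta>"

lemma sum_pending: "(\<Sum>l<\<beta>. of_bool (k j = 2 * l + 1) :: rat) = of_bool (pending k j)"
proof (cases "odd (k j)")
  case True
  then obtain q where q: "k j = 2 * q + 1" by (elim oddE)
  have "(\<Sum>l<\<beta>. of_bool (k j = 2 * l + 1) :: rat) = (\<Sum>l<\<beta>. if l = q then 1 else 0)"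
    by (intro sum.cong) (auto simp: q)
  then show ?thesis by (simp add: pending_def q)
next
  case False
  then have "(\<Sum>l<\<beta>. of_bool (k j = 2 * l + 1) :: rat) = 0" by (intro sum.neutral) auto
  then show ?thesis using False by (simp add: pending_def)
qed

lemma gain_Guard:
  assumes "j < n"
  shows "gain k (Guard j b)
    = eps + (\<Sum>l<\<beta>. of_bool (moved k (Hand j l)) - of_bool (moved k (Latch j l b))) * (width j / (2 * of_nat \<beta>))"
proof -
  have "gain k (Guard j b) = eps + ((\<Sum>l<\<beta>. floor_val k j + of_bool (moved k (Hand j l)) * width j)
      - (\<Sum>l<\<beta>. floor_val k j + of_bool (moved k (Latch j l b)) * width j)) / (2 * of_nat \<beta>)"
    by (simp add: adv_def policy_def val_Guard_True diff_divide_distrib del: moved.simps)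
  also have "(\<Sum>l<\<beta>. floor_val k j + of_bool (moved k (Hand j l)) * width j)
      - (\<Sum>l<\<beta>. floor_val k j + of_bool (moved k (Latch j l b)) * width j)
    = (\<Sum>l<\<beta>. of_bool (moved k (Hand j l)) - of_bool (moved k (Latch j l b))) * width j"
    unfolding sum_subtractf[symmetric] sum_distrib_right by (intro sum.cong) (simp_all add: left_diff_distrib)
  finally show ?thesis by simp
qed

text \<open>On the leading side exactly one more latch than hands has moved, a loss of
  \<open>width j / (2 * \<beta>)\<close>. The bonus \<open>eps\<close> is half of this expression at
  \<open>width n\<close>, too small to compensate.\<close>

lemma gain_Guard_pending:
  assumes "j < n" "b = lead k j" "pending k j"
  shows "gain k (Guard j b) \<le> 0"
proof -
  have "(\<Sum>l<\<beta>. of_bool (moved k (Hand j l)) - of_bool (moved k (Latch j l b))) = (\<Sum>l<\<beta>. - of_bool (k j = 2 * l + 1) :: rat)"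
    by (intro sum.cong) (auto simp: assms(2))
  also have "\<dots> = - 1" using assms(3) by (simp only: sum_negf sum_pending) simp
  finally have "gain k (Guard j b) = eps - width j / (2 * of_nat \<beta>)"
    unfolding gain_Guard[OF assms(1)] by simp
  moreover have "eps \<le> width j / (4 * of_nat \<beta>)" using eps_le[of j] assms(1) by (simp add: width_def)
  moreover have "width j / (4 * of_nat \<beta>) \<le> width j / (2 * of_nat \<beta>)"
    using width_pos[of j] beta_ge1 by (intro divide_left_mono) auto
  ultimately show ?thesis by linarith
qed

text \<open>On the leading side as many hands as latches below \<open>\<beta>\<close> have moved,
  which leaves \<open>eps\<close>; on the other side no latch is released before all hands are
  done.\<close>

lemma gain_Guard_idle:
  assumes "j < n" "\<not> (b = lead k j \<and> pending k j)"
  shows "eps \<le> gain k (Guard j b) \<and> gain k (Guard j b) \<le> 1"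
proof -
  let ?D = "(\<Sum>l<\<beta>. of_bool (moved k (Hand j l)) - of_bool (moved k (Latch j l b))) :: rat"
  have "?D \<le> (\<Sum>l<\<beta>. 1)" by (intro sum_mono) auto
  then have up: "?D \<le> of_nat \<beta>" by simp
  have low: "0 \<le> ?D"
  proof (cases "b = lead k j")
    case True
    have "?D = (\<Sum>l<\<beta>. - of_bool (k j = 2 * l + 1))" by (intro sum.cong) (auto simp: True)
    also have "\<dots> = 0" using assms True by (simp only: sum_negf sum_pending) simp
    finally show ?thesis by simp
  next
    case False
    then show ?thesis by (intro sum_nonneg) auto
  qed
  have "?D * (width j / (2 * of_nat \<beta>)) \<le> of_nat \<beta> * (1 / (2 * of_nat \<beta>))"
    using up low width_le[of j] width_pos[of j] beta_ge1 by (intro mult_mono divide_right_mono) auto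
  also have "\<dots> = 1/2" using beta_pos by simp
  finally have "?D * (width j / (2 * of_nat \<beta>)) \<le> 1/2" .
  moreover have "0 \<le> ?D * (width j / (2 * of_nat \<beta>))" using low width_pos[of j] by simp
  ultimately show ?thesis unfolding gain_Guard[OF assms(1)] using eps_le_quarter by linarith
qed

text \<open>A gain requires that both first latches have moved, which happens at the end of a turn;
  there the seal stands in for the missing latch as third improving column.\<close>

lemma gain_Seal:
  assumes "j < n"
  shows "top \<le> k j \<Longrightarrow> gain k (Seal j) = width j / 2" and "k j < top \<Longrightarrow> gain k (Seal j) \<le> 0"
  using assms width_pos[of j] unfolding adv_def policy_def
  by (cases "lead k j"; auto simp: val_def field_simps)+

lemma gain_dummy: "i < L \<Longrightarrow> gain k (Low i) = 1" "i < H \<Longrightarrow> gain k (High i) = 1"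
  by (simp_all add: adv_def policy_def val_def)

definition active :: "(nat \<Rightarrow> nat) \<Rightarrow> ostate \<Rightarrow> bool" where
  "active k s \<longleftrightarrow> s \<in> states \<and> (case s of
     Port j b \<Rightarrow> False | Guard j b \<Rightarrow> \<not> (b = lead k j \<and> pending k j) | Seal j \<Rightarrow> top \<le> k j
   | Low i \<Rightarrow> True | High i \<Rightarrow> True | _ \<Rightarrow> ready k s)"

lemma eps_le_width: "j < n \<Longrightarrow> eps \<le> width j / 2"
proof -
  assume "j < n"
  then have "eps \<le> width j / (4 * of_nat \<beta>)" using eps_le[of j] by (simp add: width_def)
  also have "\<dots> \<le> width j / 2" using width_pos[of j] beta_ge1 by (intro divide_left_mono) auto
  finally show ?thesis .
qed

lemma gain_active: "active k s \<Longrightarrow> eps \<le> gain k s \<and> gain k s \<le> 1"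
proof (cases s)
  case (Latch j l b)
  assume "active k s"
  then show ?thesis using Latch gain_Latch[of j l k b] eps_le_width[of j] width_le[of j] width_pos[of j]
    by (auto simp: active_def)
next
  case (Hand j l)
  assume "active k s"
  then show ?thesis using Hand gain_Hand[of j l k] eps_le_width[of j] width_le[of j] width_pos[of j]
    by (auto simp: active_def)
next
  case (Guard j b)
  assume "active k s"
  then show ?thesis using Guard gain_Guard_idle[of j b k] by (simp add: active_def)
next
  case (Seal j)
  assume "active k s"
  then show ?thesis using Seal gain_Seal[of j k] eps_le_width[of j] width_le[of j] width_pos[of j]
    by (auto simp: active_def)
next
  case (Low i)
  assume "active k s"
  then show ?thesis using Low gain_dummy eps_le_quarter by (simp add: active_def)
next
  case (High i)
  assume "active k s"
  then show ?thesis using High gain_dummy eps_le_quarter by (simp add: active_def)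
qed (simp add: active_def)

lemma improv_eq: "improv k = {s. active k s}"
proof (intro set_eqI)
  fix s
  have "gain k s \<le> 0" if "s \<in> states" "\<not> active k s"
  proof (cases s)
    case (Port j b) then show ?thesis by (simp add: gain_Port)
  next
    case (Latch j l b) then show ?thesis using that gain_Latch[of j l k b] by (simp add: active_def)
  next
    case (Hand j l) then show ?thesis using that gain_Hand[of j l k] by (simp add: active_def)
  next
    case (Guard j b) then show ?thesis using that gain_Guard_pending[of j b k] by (simp add: active_def)
  next
    case (Seal j) then show ?thesis using that gain_Seal[of j k] by (simp add: active_def)
  qed (use that in \<open>simp_all add: active_def\<close>)
  moreover have "0 < gain k s" "s \<in> states" if "active k s"
    using gain_active[OF that] eps_pos that by (auto simp: active_def)
  ultimately show "s \<in> improv k \<longleftrightarrow> s \<in> {s. active k s}" unfolding imp_def by force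
qed

fun deeper :: "nat \<Rightarrow> ostate \<Rightarrow> bool" where
  "deeper j (Port i b) = (j < i)" | "deeper j (Latch i l b) = (j < i)" | "deeper j (Hand i l) = (j < i)"
| "deeper j (Guard i b) = (j < i)" | "deeper j (Seal i) = (j < i)" | "deeper j _ = False"

text \<open>At its switch only its guard follows a ready latch: its neighbours on the path do not
  copy it, and its hand has not arrived yet or has already left. So deeper latches may have larger
  keys without their flow arriving here.\<close>

lemma pred_closed_Latch:
  assumes s: "s = Latch j l b" "active k s"
  shows "pred_closed (flip (policy k) s) s {s, Guard j b}"
  unfolding pred_closed_def
proof (intro conjI ballI impI)
  have jl: "j < n" "l \<le> \<beta>" and rdy: "ready k (Latch j l b)" using s by (auto simp: active_def)
  show "{s, Guard j b} \<subseteq> states" "s \<in> {s, Guard j b}" using jl s by auto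
  show "okey n u \<le> okey n s" if "u \<in> {s, Guard j b}" for u using that s by auto
  show "{s, Guard j b} \<inter> fst ` set (tr s (flip (policy k) s s)) = {}" using s jl by auto
  fix t u
  assume t: "t \<in> states" and u: "u \<in> {s, Guard j b}" "u \<in> fst ` set (tr t (flip (policy k) s t))"
  show "t \<in> {s, Guard j b}"
  proof (rule ccontr)
    assume no: "t \<notin> {s, Guard j b}"
    then have "flip (policy k) s t = choice k t" using t by (simp add: policy_def)
    with u(2) have u2: "u \<in> fst ` set (tr t (choice k t))" by simp
    show False
    proof (cases t)
      case (Port i c)
      then show False using u(1) u2 s by (cases "(t, False)" rule: tr.cases) auto
    next
      case (Latch i l' c)
      then show False using u(1) u2 s no rdy jl t beta_pos
        by (auto simp: ready_def split: if_splits)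
    next
      case (Hand i l')
      then show False using u(1) u2 s rdy jl t by (auto simp: ready_def split: if_splits)
    next
      case (Guard i c)
      then show False using u(1) u2 s no by auto
    qed (use u(1) u2 s in auto)
  qed
qed

text \<open>Everything deeper may flow through a hand, but all of it has a smaller key: deeper hands
  by the \<open>n - j\<close> in \<open>okey\<close>, the other kinds because they come before all
  hands.\<close>

lemma pred_closed_Hand:
  assumes s: "s = Hand j l" "active k s"
  shows "pred_closed (flip (policy k) s) s (insert s {t \<in> states. deeper j t})"
  unfolding pred_closed_def
proof (intro conjI ballI impI)
  let ?C = "insert s {t \<in> states. deeper j t}"
  have jl: "j < n" "l < \<beta>" using s by (auto simp: active_def)
  show "?C \<subseteq> states" "s \<in> ?C" using jl s by auto
  show "okey n u \<le> okey n s" if "u \<in> ?C" for u using that s jl by (cases u) auto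
  show "?C \<inter> fst ` set (tr s (flip (policy k) s s)) = {}" using s jl by auto
  fix t u
  assume t: "t \<in> states" and u: "u \<in> ?C" "u \<in> fst ` set (tr t (flip (policy k) s t))"
  show "t \<in> ?C"
  proof (rule ccontr)
    assume no: "t \<notin> ?C"
    then have "flip (policy k) s t = choice k t" using t by (auto simp: policy_def)
    with u(2) have u2: "u \<in> fst ` set (tr t (choice k t))" by simp
    show False
    proof (cases t)
      case (Port i c)
      then show False using u(1) u2 s t no by (cases "(t, False)" rule: tr.cases) auto
    next
      case (Latch i l' c)
      then show False using u(1) u2 s t no by (auto split: if_splits)
    next
      case (Hand i l')
      then show False using u(1) u2 s t no by auto
    qed (use u(1) u2 s t no in auto)
  qed
qed

lemma pred_closed_source:
  assumes s: "s \<in> states" "\<And>t a. s \<notin> fst ` set (tr t a)"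
  shows "pred_closed f s {s}"
  using s by (auto simp: pred_closed_def)

lemma ex_pred_closed:
  assumes "active k s"
  shows "\<exists>C. pred_closed (flip (policy k) s) s C"
proof -
  have out: "\<exists>j l b. u = Port j b \<or> u = Latch j l b \<or> u = Hand j l" if "u \<in> fst ` set (tr t a)" for u t a
    using that by (cases "(t, a)" rule: tr.cases) (auto split: if_splits)
  have source: "\<exists>C. pred_closed (flip (policy k) s) s C"
    if "\<not> (\<exists>j l b. s = Port j b \<or> s = Latch j l b \<or> s = Hand j l)"
  proof -
    have "s \<notin> fst ` set (tr t a)" for t a using out that by metis
    then show ?thesis using pred_closed_source assms unfolding active_def by blast
  qed
  show ?thesis
  proof (cases s)
    case (Port j b)
    then show ?thesis using assms by (simp add: active_def)
  next
    case (Latch j l b)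
    then show ?thesis using pred_closed_Latch assms by blast
  next
    case (Hand j l)
    then show ?thesis using pred_closed_Hand assms by blast
  qed (use source in simp_all)
qed

lemma nice: "active k s \<Longrightarrow> nice eps (policy k) (value_of k)"
  unfolding nice_def improv_eq using bellman gain_active ex_pred_closed by auto

section \<open>Three improving columns per wheel\<close>

definition event :: "(nat \<Rightarrow> nat) \<Rightarrow> nat \<Rightarrow> ostate" where
  "event k j = (if pending k j then Hand j (k j div 2)
    else if k j \<le> 2 * \<beta> then Latch j (k j div 2) (lead k j) else Latch j (3 * \<beta> + 1 - k j) (\<not> lead k j))"

definition lev :: "(nat \<Rightarrow> nat) \<Rightarrow> nat \<Rightarrow> ostate set" where
  "lev k j = (if pending k j then {Hand j (k j div 2), Latch j (Suc (k j div 2)) (lead k j), Guard j (\<not> lead k j)}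
    else {if k j = top then Seal j else event k j, Guard j True, Guard j False})"

lemma card_lev: "card (lev k j) = 3"
  by (auto simp: lev_def event_def)

lemma active_Latch:
  assumes "j < n" "k j \<le> top"
  shows "active k (Latch j l b) \<longleftrightarrow> Latch j l b \<in> lev k j"
proof (cases "k j \<le> 2 * \<beta>")
  case True
  show ?thesis
  proof (cases "even (k j)")
    case ev: True
    then obtain q where "k j = 2 * q" by (elim evenE)
    then show ?thesis using assms True by (auto simp: active_def ready_def lev_def pending_def event_def)
  next
    case od: False
    then obtain q where "k j = 2 * q + 1" by (elim oddE)
    then show ?thesis using assms True by (auto simp: active_def ready_def lev_def pending_def event_def)
  qed
next
  case False
  then show ?thesis using assms by (auto simp: active_def ready_def lev_def pending_def event_def)
qed

lemma active_Hand:
  assumes "j < n" "k j \<le> top"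
  shows "active k (Hand j l) \<longleftrightarrow> Hand j l \<in> lev k j"
  using assms by (auto simp: active_def ready_def lev_def pending_def event_def elim!: oddE)

lemma active_Guard: "j < n \<Longrightarrow> active k (Guard j b) \<longleftrightarrow> Guard j b \<in> lev k j"
  by (auto simp: active_def lev_def event_def)

lemma active_Seal: "j < n \<Longrightarrow> k j \<le> top \<Longrightarrow> active k (Seal j) \<longleftrightarrow> Seal j \<in> lev k j"
  by (auto simp: active_def lev_def event_def pending_def)

text \<open>A latch moves only when all deeper wheels are finished, and a waiting hand moves next.
  Hence a waiting hand comes with finished deeper wheels, and at most one hand waits.\<close>

definition valid :: "(nat \<Rightarrow> nat) \<Rightarrow> bool" where
  "valid k \<longleftrightarrow> (\<forall>j<n. k j \<le> top \<and> (pending k j \<longrightarrow> (\<forall>i. j < i \<and> i < n \<longrightarrow> k i = top)))"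

lemma active_set:
  assumes "valid k"
  shows "{s. active k s} = Low ` {..<L} \<union> High ` {..<H} \<union> (\<Union>j<n. lev k j)"
proof (intro set_eqI)
  fix s
  have top: "k j \<le> top" if "j < n" for j using assms that by (simp add: valid_def)
  have lev: "s \<in> lev k j \<Longrightarrow> \<exists>l b. s = Latch j l b \<or> s = Hand j l \<or> s = Guard j b \<or> s = Seal j" for j
    by (auto simp: lev_def event_def split: if_splits)
  show "s \<in> {s. active k s} \<longleftrightarrow> s \<in> Low ` {..<L} \<union> High ` {..<H} \<union> (\<Union>j<n. lev k j)"
  proof (cases s)
    case (Port j b) then show ?thesis using lev by (auto simp: active_def)
  next
    case (Latch j l b)
    have "active k s \<Longrightarrow> j < n" using Latch by (simp add: active_def)
    then show ?thesis using Latch lev active_Latch[of j k l b] top[of j] by blast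
  next
    case (Hand j l)
    have "active k s \<Longrightarrow> j < n" using Hand by (simp add: active_def)
    then show ?thesis using Hand lev active_Hand[of j k l] top[of j] by blast
  next
    case (Guard j b)
    have "active k s \<Longrightarrow> j < n" using Guard by (simp add: active_def)
    then show ?thesis using Guard lev active_Guard[of j k b] by blast
  next
    case (Seal j)
    have "active k s \<Longrightarrow> j < n" using Seal by (simp add: active_def)
    then show ?thesis using Seal lev active_Seal[of j k] top[of j] by blast
  next
    case (Low i) then show ?thesis using lev by (auto simp: active_def)
  next
    case (High i) then show ?thesis using lev by (auto simp: active_def)
  qed
qed

lemma lev_not_dummy: "s \<in> lev k j \<Longrightarrow> s \<noteq> Low i \<and> s \<noteq> High i"
  by (auto simp: lev_def event_def split: if_splits)

lemma lev_disjoint: "i \<noteq> j \<Longrightarrow> lev k i \<inter> lev k j = {}"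
  by (auto simp: lev_def event_def split: if_splits)

lemma finite_lev: "finite (lev k j)" by (simp add: lev_def)

lemma card_active_low:
  assumes "valid k"
  shows "card ({s. active k s} - High ` {..<H}) = L + 3 * n"
proof -
  have "{s. active k s} - High ` {..<H} = Low ` {..<L} \<union> (\<Union>j<n. lev k j)"
    unfolding active_set[OF assms] using lev_not_dummy by blast
  moreover have "card (\<Union>j<n. lev k j) = 3 * n"
    by (subst card_UN_disjoint) (auto simp: finite_lev lev_disjoint card_lev)
  moreover have "card (Low ` {..<L}) = L" by (simp add: card_image inj_on_def)
  moreover have "Low ` {..<L} \<inter> (\<Union>j<n. lev k j) = {}" using lev_not_dummy by blast
  ultimately show ?thesis by (simp add: card_Un_disjoint finite_lev)
qed

text \<open>The number of improving columns never changes, so \<open>r\<close> is only ever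
  evaluated at one argument.\<close>

lemma card_active:
  assumes "valid k"
  shows "card {s. active k s} = L + 3 * n + H"
proof -
  have fin: "finite {s. active k s}" using finS by (rule rev_finite_subset) (auto simp: active_def)
  have "High ` {..<H} \<subseteq> {s. active k s}" by (auto simp: active_def)
  then have "card {s. active k s} = card ({s. active k s} - High ` {..<H}) + card (High ` {..<H})"
    using fin by (metis card_Diff_subset card_mono finite_subset le_add_diff_inverse2)
  then show ?thesis by (simp add: card_active_low[OF assms] card_image inj_on_def)
qed

text \<open>A move of a hand of wheel \<open>J\<close> changes the order of the ports of all deeper wheels and so restarts them.\<close>

definition succ :: "(nat \<Rightarrow> nat) \<Rightarrow> nat \<Rightarrow> nat \<Rightarrow> nat" where
  "succ k J i = (if i = J then Suc (k J) else if pending k J \<and> J < i then 0 else k i)"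

text \<open>The remaining hand moves as a number in base \<open>\<beta> + 1\<close> with wheel 0 as
  most significant digit; latch moves do not count.\<close>

definition potential :: "(nat \<Rightarrow> nat) \<Rightarrow> nat" where
  "potential k = (\<Sum>j<n. (\<beta> - hands k j) * (\<beta> + 1) ^ (n - 1 - j))"

text \<open>\<open>J\<close> is the deepest unfinished level; every deeper level is finished.\<close>
definition turn :: "(nat \<Rightarrow> nat) \<Rightarrow> nat \<Rightarrow> bool" where
  "turn k J \<longleftrightarrow> J < n \<and> k J < top \<and> (\<forall>i. J < i \<and> i < n \<longrightarrow> k i = top)"

lemma ex_turn:
  assumes "0 < potential k" "valid k"
  obtains J where "turn k J"
proof -
  have "\<exists>j<n. k j < top"
  proof (rule ccontr)
    assume "\<not> ?thesis"
    then have "hands k j = \<beta>" if "j < n" for j using that by (auto simp: hands_def)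
    then have "potential k = 0" by (simp add: potential_def)
    then show False using assms by simp
  qed
  then have ex: "\<exists>j. j < n \<and> k j < top" by blast
  define J where "J = (GREATEST j. j < n \<and> k j < top)"
  have J: "J < n \<and> k J < top" unfolding J_def by (rule GreatestI_ex_nat[OF ex, of n]) auto
  have "k i = top" if "J < i" "i < n" for i
  proof (rule ccontr)
    assume "k i \<noteq> top"
    then have "i < n \<and> k i < top" using that assms(2) unfolding valid_def by force
    then have "i \<le> J" unfolding J_def by (rule Greatest_le_nat[of _ _ n]) auto
    then show False using that by simp
  qed
  then show ?thesis using J that by (auto simp: turn_def)
qed

lemma turn_not_pending:
  assumes "valid k" "turn k J" "j < n" "j \<noteq> J"
  shows "\<not> pending k j"
proof
  assume p: "pending k j"
  show False
  proof (cases "j < J")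
    case True
    then have "k J = top" using p assms unfolding valid_def turn_def by blast
    then show False using assms(2) by (simp add: turn_def)
  next
    case False
    then have "k j = top" using assms by (simp add: turn_def)
    then show False using p by (simp add: pending_def)
  qed
qed

lemma hands_succ:
  assumes "turn k J"
  shows "i < J \<Longrightarrow> hands (succ k J) i = hands k i"
    and "hands (succ k J) J = (if pending k J then Suc (hands k J) else hands k J)"
    and "J < i \<Longrightarrow> i < n \<Longrightarrow> hands (succ k J) i = (if pending k J then 0 else hands k i)"
    and "J < i \<Longrightarrow> i < n \<Longrightarrow> hands k i = \<beta>"
proof -
  show "i < J \<Longrightarrow> hands (succ k J) i = hands k i" by (simp add: hands_def succ_def)
  show "hands (succ k J) J = (if pending k J then Suc (hands k J) else hands k J)"
    unfolding hands_def succ_def pending_def by (auto elim!: oddE evenE)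
  show "J < i \<Longrightarrow> i < n \<Longrightarrow> hands (succ k J) i = (if pending k J then 0 else hands k i)"
    by (simp add: hands_def succ_def)
  show "J < i \<Longrightarrow> i < n \<Longrightarrow> hands k i = \<beta>" using assms by (simp add: hands_def turn_def)
qed

text \<open>Here \<open>\<beta>\<close> has to be odd: a restarting wheel goes from
  \<open>\<beta>\<close> to 0 moved hands, and the ports of the wheel after it must be exchanged,
  just as those of wheel \<open>J + 1\<close> are when a single hand moves.\<close>

lemma lead_succ:
  assumes "turn k J"
  shows "i \<le> J \<Longrightarrow> lead (succ k J) i = lead k i"
    and "J < i \<Longrightarrow> i \<le> n \<Longrightarrow> lead (succ k J) i = (lead k i \<noteq> pending k J)"
proof -
  show "i \<le> J \<Longrightarrow> lead (succ k J) i = lead k i"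
    using hands_succ(1)[OF assms, of "i - 1"] by (cases i) auto
  show "J < i \<Longrightarrow> i \<le> n \<Longrightarrow> lead (succ k J) i = (lead k i \<noteq> pending k J)"
    using hands_succ(2)[OF assms] hands_succ(3,4)[OF assms, of "i - 1"] odd_beta
    by (cases i; cases "i - 1 = J") auto
qed

text \<open>For deeper wheels, exchanging the ports and resetting the time from \<open>top\<close>
  to 0 leave all choices as they are: what pointed to the better port now points to the worse one,
  which is the unmoved configuration.\<close>

lemma choice_succ:
  assumes J: "turn k J" and s: "s \<in> states"
  shows "choice (succ k J) s = (choice k s \<noteq> (s = event k J))"
proof -
  have JT: "J < n" "k J < top" using J by (auto simp: turn_def)
  have deep: "k i = top" if "J < i" "i < n" for i using J that by (simp add: turn_def)
  have hand_ev: "Hand j l \<noteq> event k J" if "j \<noteq> J" for j l using that by (simp add: event_def)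
  have latch_ev: "Latch j l b \<noteq> event k J" if "j \<noteq> J" for j l b using that by (simp add: event_def)
  show ?thesis
  proof (cases s)
    case (Latch j l b)
    have jl: "j < n" "l \<le> \<beta>" using s Latch by auto
    show ?thesis
    proof (cases j J rule: linorder_cases)
      case less
      then show ?thesis using Latch latch_ev[of j l b] lead_succ(1)[OF J, of j] by (auto simp: succ_def)
    next
      case greater
      then show ?thesis
        using Latch latch_ev[of j l b] lead_succ(2)[OF J, of j] deep[of j] jl by (auto simp: succ_def)
    next
      case equal
      have ev: "Latch J l b = event k J \<longleftrightarrow> (if b = lead k J then k J = 2 * l else k J + l + 1 = top)"
        using jl JT by (auto simp: event_def pending_def)
      have "succ k J J = Suc (k J)" by (simp add: succ_def)
      then show ?thesis using Latch equal lead_succ(1)[OF J, of J] ev by auto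
    qed
  next
    case (Hand j l)
    have jl: "j < n" "l < \<beta>" using s Hand by auto
    show ?thesis
    proof (cases j J rule: linorder_cases)
      case less
      then show ?thesis using Hand hand_ev[of j l] lead_succ(1)[OF J, of j] by (auto simp: succ_def)
    next
      case greater
      then show ?thesis
        using Hand hand_ev[of j l] lead_succ(2)[OF J, of j] deep[of j] jl by (auto simp: succ_def)
    next
      case equal
      have ev: "Hand J l = event k J \<longleftrightarrow> k J = 2 * l + 1"
        using jl by (auto simp: event_def pending_def)
      have "succ k J J = Suc (k J)" by (simp add: succ_def)
      then show ?thesis using Hand equal lead_succ(1)[OF J, of J] ev by auto
    qed
  qed (simp_all add: event_def)
qed

lemma event_in_lev: "turn k J \<Longrightarrow> event k J \<in> lev k J"
  by (auto simp: turn_def lev_def event_def)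

lemma active_event:
  assumes "valid k" "turn k J"
  shows "active k (event k J)"
proof -
  have "event k J \<in> (\<Union>j<n. lev k j)" using event_in_lev[OF assms(2)] assms(2) by (auto simp: turn_def)
  then show ?thesis using active_set[OF assms(1)] by blast
qed

lemma policy_succ:
  assumes "valid k" "turn k J"
  shows "policy (succ k J) = flip (policy k) (event k J)"
proof
  fix s
  have "event k J \<in> states" using active_event[OF assms] by (simp add: active_def)
  then show "policy (succ k J) s = flip (policy k) (event k J) s"
    using choice_succ[OF assms(2), of s] by (auto simp: policy_def)
qed

lemma valid_succ:
  assumes "valid k" "turn k J"
  shows "valid (succ k J)"
  unfolding valid_def
proof (intro allI impI conjI)
  have JT: "J < n" "k J < top" using assms by (auto simp: turn_def)
  have deep: "k i = top" if "J < i" "i < n" for i using assms that by (simp add: turn_def)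
  fix j assume j: "j < n"
  show "succ k J j \<le> top" using j JT assms(1) by (auto simp: succ_def valid_def)
  fix i assume p: "pending (succ k J) j" and i: "j < i \<and> i < n"
  have "j = J"
  proof (rule ccontr)
    assume "j \<noteq> J"
    then have "succ k J j = 0 \<or> succ k J j = k j" by (auto simp: succ_def)
    then show False using p turn_not_pending[OF assms j \<open>j \<noteq> J\<close>] by (auto simp: pending_def)
  qed
  then have "\<not> pending k J" using p by (auto simp: pending_def succ_def)
  then show "succ k J i = top" using i \<open>j = J\<close> deep[of i] by (simp add: succ_def)
qed

lemma geometric: "J < n \<Longrightarrow> Suc (\<Sum>i\<in>{Suc J..<n}. \<beta> * (\<beta> + 1) ^ (n - 1 - i)) = (\<beta> + 1) ^ (n - 1 - J)"
proof -
  assume "J < n"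
  have "(\<Sum>i\<in>{Suc J..<n}. \<beta> * (\<beta> + 1) ^ (n - 1 - i)) = (\<Sum>i\<in>{..<n - 1 - J}. \<beta> * (\<beta> + 1) ^ i)"
    by (rule sum.reindex_bij_witness[of _ "\<lambda>i. n - 1 - i" "\<lambda>i. n - 1 - i"]) auto
  moreover have "Suc (\<Sum>i\<in>{..<m}. \<beta> * (\<beta> + 1) ^ i) = (\<beta> + 1) ^ m" for m by (induction m) (auto simp: algebra_simps)
  ultimately show ?thesis by simp
qed

lemma potential_succ:
  assumes "turn k J"
  shows "potential k \<le> Suc (potential (succ k J))"
proof (cases "pending k J")
  case False
  have "hands (succ k J) i = hands k i" if "i < n" for i
    using hands_succ(1)[OF assms, of i] hands_succ(3)[OF assms, of i] hands_succ(2)[OF assms] that False by (cases i J rule: linorder_cases) auto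
  then show ?thesis by (simp add: potential_def)
next
  case True
  have J: "J < n" using assms by (simp add: turn_def)
  have "{..<n} = insert J ({..<J} \<union> {Suc J..<n})" "{..<J} \<inter> {Suc J..<n} = {}" using J by auto
  then have split: "(\<Sum>i<n. g i) = (\<Sum>i<J. g i) + g J + (\<Sum>i\<in>{Suc J..<n}. g i)" for g :: "nat \<Rightarrow> nat"
    by (simp add: sum.union_disjoint)
  let ?p = "\<lambda>i. (\<beta> + 1) ^ (n - 1 - i)"
  have "(\<Sum>i\<in>{Suc J..<n}. (\<beta> - hands k i) * ?p i) = 0"
    by (intro sum.neutral) (use hands_succ(4)[OF assms] in auto)
  then have 1: "potential k = (\<Sum>i<J. (\<beta> - hands k i) * ?p i) + (\<beta> - hands k J) * ?p J"
    unfolding potential_def split by simp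
  have "(\<Sum>i<J. (\<beta> - hands (succ k J) i) * ?p i) = (\<Sum>i<J. (\<beta> - hands k i) * ?p i)"
    by (intro sum.cong) (use hands_succ(1)[OF assms] in auto)
  moreover have "(\<Sum>i\<in>{Suc J..<n}. (\<beta> - hands (succ k J) i) * ?p i) = (\<Sum>i\<in>{Suc J..<n}. \<beta> * ?p i)"
    by (intro sum.cong) (use hands_succ(3)[OF assms] True in auto)
  ultimately have 2: "potential (succ k J) = (\<Sum>i<J. (\<beta> - hands k i) * ?p i) + (\<beta> - Suc (hands k J)) * ?p J
      + (\<Sum>i\<in>{Suc J..<n}. \<beta> * ?p i)"
    unfolding potential_def split using hands_succ(2)[OF assms] True by simp
  have "hands k J < \<beta>" using True by (auto simp: pending_def hands_def)
  then have "(\<beta> - hands k J) * ?p J = (\<beta> - Suc (hands k J)) * ?p J + ?p J"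
    by (metis Suc_diff_Suc add.commute mult_Suc)
  then show ?thesis unfolding 1 2 using geometric[OF J] by linarith
qed

text \<open>A waiting hand belongs to wheel \<open>J\<close> and exceeds all latches. If no hand
  waits, the latch of wheel \<open>J\<close> is last, since deeper wheels are finished and have no
  improving latch.\<close>

lemma event_is_last:
  assumes "valid k" "turn k J" "active k t"
  shows "okey n t \<le> okey n (event k J) \<longleftrightarrow> t \<notin> High ` {..<H}"
proof -
  note np = turn_not_pending[OF assms(1,2)]
  have ev5: "fst (okey n (event k J)) < 5" "3 \<le> fst (okey n (event k J))" by (auto simp: event_def)
  show ?thesis
  proof (cases t)
    case (Latch j l b)
    have j: "j < n" "l \<le> \<beta>" using assms(3) Latch by (auto simp: active_def)
    have in_lev: "t \<in> lev k j" using active_Latch[of j k l b] assms(1,3) j Latch by (auto simp: valid_def)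
    have "j \<le> J"
    proof (rule ccontr)
      assume "\<not> j \<le> J"
      then have "k j = top" using assms(2) j by (simp add: turn_def)
      then show False using in_lev Latch by (auto simp: lev_def pending_def split: if_splits)
    qed
    moreover have "t = event k J" if "j = J" "\<not> pending k J"
      using that in_lev Latch assms(2) by (auto simp: lev_def turn_def split: if_splits)
    ultimately show ?thesis using Latch by (cases "pending k J"; cases "j = J") (auto simp: event_def)
  next
    case (Hand j l)
    have j: "j < n" using assms(3) Hand by (simp add: active_def)
    have in_lev: "t \<in> lev k j" using active_Hand[of j k l] assms(1,3) j Hand by (auto simp: valid_def)
    then have "pending k j" using Hand by (auto simp: lev_def event_def split: if_splits)
    then have "j = J" using np[OF j] by blast
    then have "t = event k J" using in_lev \<open>pending k j\<close> Hand by (auto simp: lev_def event_def)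
    then show ?thesis using Hand by auto
  next
    case (High i)
    then show ?thesis using assms(3) ev5 by (cases "okey n (event k J)") (auto simp: active_def)
  qed (use assms(3) ev5 in \<open>cases "okey n (event k J)"; auto simp: active_def\<close>)+
qed

lemma event_unique:
  assumes "valid k" "turn k J" "active k s"
    and rank: "card {t. active k t \<and> okey n t \<le> okey n s} = L + 3 * n"
  shows "s = event k J"
proof -
  let ?w = "event k J"
  have fin: "finite {t. active k t}" using finS by (rule rev_finite_subset) (auto simp: active_def)
  have "{t. active k t \<and> okey n t \<le> okey n ?w} = {t. active k t} - High ` {..<H}"
    using event_is_last[OF assms(1,2)] by blast
  then have w: "card {t. active k t \<and> okey n t \<le> okey n ?w} = L + 3 * n" using card_active_low[OF assms(1)] by simp
  have strict: "card {t. active k t \<and> okey n t \<le> okey n a} < card {t. active k t \<and> okey n t \<le> okey n b}"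
    if "active k b" "okey n a < okey n b" for a b
  proof (rule psubset_card_mono)
    show "finite {t. active k t \<and> okey n t \<le> okey n b}" by (rule rev_finite_subset[OF fin]) auto
    have "{t. active k t \<and> okey n t \<le> okey n a} \<subseteq> {t. active k t \<and> okey n t \<le> okey n b}"
      using that(2) by (auto intro: order.trans[OF _ less_imp_le])
    moreover have "b \<notin> {t. active k t \<and> okey n t \<le> okey n a}" using that(2) by (simp add: not_le)
    moreover have "b \<in> {t. active k t \<and> okey n t \<le> okey n b}" using that(1) by simp
    ultimately show "{t. active k t \<and> okey n t \<le> okey n a} \<subset> {t. active k t \<and> okey n t \<le> okey n b}" by blast
  qed
  have "\<not> okey n s < okey n ?w" "\<not> okey n ?w < okey n s"
    using strict[of ?w s] strict[of s ?w] active_event[OF assms(1,2)] assms(3) rank w by auto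
  then have "okey n s = okey n ?w" by simp
  then show ?thesis using inj_key assms(3) active_event[OF assms(1,2)] by (auto simp: inj_on_def active_def)
qed

abbreviation start :: "nat \<Rightarrow> nat" where "start \<equiv> \<lambda>_. 0"

lemma lead_start: "lead start j \<longleftrightarrow> j = 0"
  by (cases j) (auto simp: hands_def)

text \<open>A rank function for the initial policy, in blocks of length
  \<open>2 * \<beta> + 5\<close> per wheel. At time 0 all latches lead along the path to the worse
  port, which is \<open>Port j False\<close> for wheel 0 and \<open>Port j True\<close> for the
  others.\<close>

fun depth :: "ostate \<Rightarrow> nat" where
  "depth (Port j b) = j * (2 * \<beta> + 5)"
| "depth (Latch j l b) = j * (2 * \<beta> + 5) + (if b = (j = 0) then 2 * \<beta> + 2 - l else 1 + l)"
| "depth (Hand j l) = j * (2 * \<beta> + 5) + 2 + l"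
| "depth (Guard j b) = j * (2 * \<beta> + 5) + 2 * \<beta> + 3"
| "depth (Seal j) = j * (2 * \<beta> + 5) + 1"
| "depth (Low i) = 0"
| "depth (High i) = 0"

lemma feasible_start: "feasible_basis prog (basis (policy start))"
proof (rule acyclic_basis[where \<rho> = depth])
  fix s t assume s: "s \<in> states" and "t \<in> fst ` set (tr s (policy start s))"
  then have t: "t \<in> fst ` set (tr s (choice start s))" by (simp add: policy_def)
  show "depth t < depth s"
  proof (cases s)
    case (Port j b)
    then show ?thesis using t by (cases "(s, False)" rule: tr.cases) auto
  next
    case (Latch j l b)
    then show ?thesis using t s by (auto simp: lead_start split: if_splits)
  next
    case (Hand j l)
    then show ?thesis using t s by (auto simp: lead_start split: if_splits)
  next
    case (Guard j b)
    then show ?thesis using t s by auto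
  next
    case (Seal j)
    then show ?thesis using t s by auto
  qed (use t in auto)
qed

lemma valid_start: "valid start"
  by (simp add: valid_def pending_def)

lemma potential_start: "potential start = (\<beta> + 1) ^ n - 1"
proof -
  have "potential start = (\<Sum>j<n. \<beta> * (\<beta> + 1) ^ (n - 1 - j))" by (simp add: potential_def hands_def)
  also have "\<dots> = (\<Sum>j<n. \<beta> * (\<beta> + 1) ^ j)"
    by (rule sum.reindex_bij_witness[of _ "\<lambda>i. n - 1 - i" "\<lambda>i. n - 1 - i"]) auto
  also have "\<dots> = (\<beta> + 1) ^ n - 1"
  proof -
    have "Suc (\<Sum>i<m. \<beta> * (\<beta> + 1) ^ i) = (\<beta> + 1) ^ m" for m by (induction m) (auto simp: algebra_simps)
    from this[of n] show ?thesis by linarith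
  qed
  finally show ?thesis .
qed

lemma nnz_bounds:
  "n \<le> nnz prog" "nnz prog \<le> 2 * (L + H) + (n * (3 * \<beta> + 7) + 2) * (2 * \<beta> + 8)"
proof -
  let ?w = "\<lambda>s. 2 + length (tr s False) + length (tr s True)"
  have "n \<le> card ((\<lambda>j. Port j False) ` {..n})" by (subst card_image) (auto simp: inj_on_def)
  also have "\<dots> \<le> card states" by (rule card_mono[OF finS]) auto
  finally show "n \<le> nnz prog" using nnz_ge by simp
  have len: "length (filter P [0..<\<beta>]) \<le> \<beta>" for P using length_filter_le[of P "[0..<\<beta>]"] by simp
  have tr_len: "length (tr s a) \<le> \<beta> + 3" for s a
    using len[of even] len[of odd] by (cases "(s, a)" rule: tr.cases) auto
  have w: "?w s \<le> 2 * \<beta> + 8" for s using tr_len[of s False] tr_len[of s True] by simp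
  define D where "D = Low ` {..<L} \<union> High ` {..<H}"
  have D: "D \<subseteq> states" by (auto simp: D_def)
  have finD: "finite D" by (simp add: D_def)
  have cardD: "card D = L + H"
    unfolding D_def by (subst card_Un_disjoint) (auto simp: card_image inj_on_def)
  have "states - D \<subseteq> case_prod Port ` ({..n} \<times> UNIV) \<union> (\<lambda>(j, l, b). Latch j l b) ` ({..<n} \<times> {..\<beta>} \<times> UNIV)
    \<union> case_prod Hand ` ({..<n} \<times> {..<\<beta>}) \<union> case_prod Guard ` ({..<n} \<times> UNIV) \<union> Seal ` {..<n}"
    unfolding states_def D_def by blast
  then have "card (states - D) \<le> card (case_prod Port ` ({..n} \<times> (UNIV :: bool set))
      \<union> (\<lambda>(j, l, b). Latch j l b) ` ({..<n} \<times> {..\<beta>} \<times> UNIV)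
      \<union> case_prod Hand ` ({..<n} \<times> {..<\<beta>}) \<union> case_prod Guard ` ({..<n} \<times> UNIV) \<union> Seal ` {..<n})"
    by (intro card_mono) auto
  also have "\<dots> \<le> card (case_prod Port ` ({..n} \<times> (UNIV :: bool set)))
      + card ((\<lambda>(j, l, b). Latch j l b) ` ({..<n} \<times> {..\<beta>} \<times> (UNIV :: bool set)))
      + card (case_prod Hand ` ({..<n} \<times> {..<\<beta>})) + card (case_prod Guard ` ({..<n} \<times> (UNIV :: bool set)))
      + card (Seal ` {..<n})"
    by (intro order.trans[OF card_Un_le] add_right_mono order.refl)
  also have "\<dots> \<le> card ({..n} \<times> (UNIV :: bool set)) + card ({..<n} \<times> {..\<beta>} \<times> (UNIV :: bool set))
      + card ({..<n} \<times> {..<\<beta>}) + card ({..<n} \<times> (UNIV :: bool set)) + card {..<n}"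
    by (intro add_mono card_image_le) auto
  also have "\<dots> = n * (3 * \<beta> + 7) + 2" by (simp add: card_cartesian_product algebra_simps)
  finally have cardND: "card (states - D) \<le> n * (3 * \<beta> + 7) + 2" .
  have "(\<Sum>s\<in>states. ?w s) = (\<Sum>s\<in>states - D. ?w s) + (\<Sum>s\<in>D. ?w s)"
    by (rule sum.subset_diff[OF D finS])
  also have "(\<Sum>s\<in>D. ?w s) = (\<Sum>s\<in>D. 2)" by (intro sum.cong) (auto simp: D_def)
  also have "\<dots> = 2 * (L + H)" by (simp add: cardD)
  also have "(\<Sum>s\<in>states - D. ?w s) \<le> card (states - D) * (2 * \<beta> + 8)"
    using sum_bounded_above[of "states - D" ?w "2 * \<beta> + 8"] w by simp
  also have "\<dots> \<le> (n * (3 * \<beta> + 7) + 2) * (2 * \<beta> + 8)" by (intro mult_right_mono cardND) simp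
  finally show "nnz prog \<le> 2 * (L + H) + (n * (3 * \<beta> + 7) + 2) * (2 * \<beta> + 8)" using nnz_le by simp
qed

end

theorem high_rank_lower_bound:
  assumes "selects_rank \<Pi> r" "odd \<beta>" and r: "r (L + 3 * n + H) = L + 3 * n"
  shows "\<exists>P B. admissible_lp P \<and> feasible_basis P B \<and> n \<le> nnz P
    \<and> nnz P \<le> 2 * (L + H) + (n * (3 * \<beta> + 7) + 2) * (2 * \<beta> + 8)
    \<and> simplex_runs_at_least \<Pi> P B ((\<beta> + 1) ^ n - 1)"
proof -
  interpret odometer n \<beta> L H by unfold_locales fact
  have "simplex_runs_at_least \<Pi> prog (basis (policy start)) ((\<beta> + 1) ^ n - 1)"
  proof (rule runs_at_least[where J = "\<lambda>N f. \<exists>k. valid k \<and> f = policy k \<and> N \<le> potential k" and lo = eps,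
        OF assms(1) eps_pos base_eps feasible_start])
    show "\<exists>k. valid k \<and> policy start = policy k \<and> (\<beta> + 1) ^ n - 1 \<le> potential k"
      using valid_start potential_start by (intro exI[of _ start]) simp
    fix N f assume "\<exists>k. valid k \<and> f = policy k \<and> N \<le> potential k" and N: "0 < N"
    then obtain k where k: "valid k" "f = policy k" "N \<le> potential k" by blast
    then obtain J where J: "turn k J" using N ex_turn[of k] by auto
    have "\<exists>N'. N \<le> Suc N' \<and> (\<exists>k. valid k \<and> flip f s = policy k \<and> N' \<le> potential k)"
      if s: "s \<in> improv k" and rank: "card {t \<in> improv k. okey n t \<le> okey n s} = r (card (improv k))" for s
    proof -
      have "s = event k J"
        using event_unique[OF k(1) J, of s] s rank r by (simp add: improv_eq card_active[OF k(1)])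
      then have "flip f s = policy (succ k J)" using policy_succ[OF k(1) J] k(2) by simp
      then show ?thesis using valid_succ[OF k(1) J] potential_succ[OF J] k(3)
        by (intro exI[of _ "potential (succ k J)"]) auto
    qed
    then show "\<exists>v. nice eps f v \<and> (\<forall>s\<in>imp f v. card {t \<in> imp f v. okey n t \<le> okey n s} = r (card (imp f v))
        \<longrightarrow> (\<exists>N'. N \<le> Suc N' \<and> (\<exists>k. valid k \<and> flip f s = policy k \<and> N' \<le> potential k)))"
      unfolding k(2) using nice[OF active_event[OF k(1) J]] by blast
  qed
  then show ?thesis using admissible feasible_start nnz_bounds by blast
qed

section \<open>The lower bound\<close>

text \<open>\<open>M\<close> is a natural upper bound for the square root of \<open>nnz P\<close>,
  which keeps the case distinction within natural numbers.\<close>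

lemma sqrt_exponential_family:
  assumes "selects_rank \<Pi> r"
  shows "\<exists>P B M. admissible_lp P \<and> feasible_basis P B \<and> k \<le> nnz P \<and> nnz P \<le> M\<^sup>2 \<and> 1 \<le> M
    \<and> simplex_runs_at_least \<Pi> P B (2 ^ M - 1)"
proof -
  define good where "good n \<longleftrightarrow> (\<exists>K. K \<le> 350 * n\<^sup>2 \<and> 3 * n \<le> r K \<and> r K \<le> K)" for n
  show ?thesis
  proof (cases "\<forall>n0. \<exists>n\<ge>n0. good n")
    case True
    define \<beta> :: nat where "\<beta> = 2 ^ 32 - 1"
    have \<beta>: "odd \<beta>" "\<beta> + 1 = 2 ^ 32" by (simp_all add: \<beta>_def)
    define C where "C = (3 * \<beta> + 7) * (2 * \<beta> + 8) + 2 * (2 * \<beta> + 8)"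
    \<comment> \<open>\<open>C\<close> depends only on \<open>\<beta>\<close>, so
      \<open>n \<ge> C\<close> bounds the cost of the wheels by \<open>n\<^sup>2\<close>.\<close>
    obtain n where n: "max k (max 1 C) \<le> n" "good n" using True by blast
    then obtain K where K: "K \<le> 350 * n\<^sup>2" "3 * n \<le> r K" "r K \<le> K" by (auto simp: good_def)
    \<comment> \<open>The wheels contribute \<open>3 * n\<close> improving columns; \<open>L\<close>
      lower ones bring the last of these to rank \<open>r K\<close>, and \<open>H\<close> higher
      ones complete the number \<open>K\<close>.\<close>
    define L H where "L = r K - 3 * n" and "H = K - r K"
    have "L + 3 * n = r K" "L + 3 * n + H = K" using K by (auto simp: L_def H_def)
    then have "r (L + 3 * n + H) = L + 3 * n" by simp
    from high_rank_lower_bound[OF assms \<beta>(1) this]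
    obtain P B where P: "admissible_lp P" "feasible_basis P B" "n \<le> nnz P"
      "nnz P \<le> 2 * (L + H) + (n * (3 * \<beta> + 7) + 2) * (2 * \<beta> + 8)"
      "simplex_runs_at_least \<Pi> P B ((\<beta> + 1) ^ n - 1)" by blast
    have "(n * (3 * \<beta> + 7) + 2) * (2 * \<beta> + 8) = n * ((3 * \<beta> + 7) * (2 * \<beta> + 8)) + 1 * (2 * (2 * \<beta> + 8))"
      by (simp add: algebra_simps)
    also have "\<dots> \<le> n * ((3 * \<beta> + 7) * (2 * \<beta> + 8)) + n * (2 * (2 * \<beta> + 8))"
      using n by (intro add_left_mono mult_right_mono) auto
    also have "\<dots> = n * C" by (simp add: C_def algebra_simps)
    also have "\<dots> \<le> n * n" using n by (intro mult_left_mono) auto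
    finally have "nnz P \<le> 2 * (L + H) + n\<^sup>2" using P(4) by (simp add: power2_eq_square)
    also have "L + H \<le> 350 * n\<^sup>2" using K by (simp add: L_def H_def)
    finally have "nnz P \<le> 701 * n\<^sup>2" by simp
    then have "nnz P \<le> (32 * n)\<^sup>2" by (simp add: power_mult_distrib)
    moreover have "(\<beta> + 1) ^ n = 2 ^ (32 * n)" unfolding \<beta>(2) by (rule power_mult[symmetric])
    ultimately show ?thesis using P n by (intro exI[of _ P] exI[of _ B] exI[of _ "32 * n"]) auto
  next
    case False
    then obtain n0 where n0: "\<And>n. n0 \<le> n \<Longrightarrow> \<not> good n" by blast
    define n where "n = max n0 (k + 2)"
    have n: "\<not> good n" "k \<le> n" "2 \<le> n" using n0[of n] by (auto simp: n_def)
    have "r K \<le> 3 * n" if K: "K \<le> 50 * n * (2 * (3 * n) + 1)" "r K \<le> K" for K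
    proof -
      have "n \<le> n\<^sup>2" using n(3) by (simp add: power2_eq_square)
      moreover have "K \<le> 300 * n\<^sup>2 + 50 * n" using K(1) by (simp add: power2_eq_square algebra_simps)
      ultimately have "K \<le> 350 * n\<^sup>2" by linarith
      then show ?thesis using n(1) K(2) unfolding good_def by (meson nat_le_linear)
    qed
    from low_rank_lower_bound[OF assms this]
    obtain P B where P: "admissible_lp P" "feasible_basis P B" "50 * n \<le> nnz P"
      "nnz P \<le> 6 * (50 * n) * (2 * (3 * n) + 1) + 8 * (50 * n) + 4"
      "simplex_runs_at_least \<Pi> P B (2 ^ (50 * n) - 1)" by blast
    have "2 * n \<le> n\<^sup>2" using n(3) by (simp add: power2_eq_square)
    moreover have "nnz P \<le> 1800 * n\<^sup>2 + 700 * n + 4" using P(4) by (simp add: power2_eq_square algebra_simps)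
    ultimately have "nnz P \<le> 2500 * n\<^sup>2" using n(3) by linarith
    then have "nnz P \<le> (50 * n)\<^sup>2" by (simp add: power_mult_distrib)
    then show ?thesis using P n by (intro exI[of _ P] exI[of _ B] exI[of _ "50 * n"]) auto
  qed
qed

theorem theorem23:
  fixes \<Pi> :: "lp \<Rightarrow> nat set \<Rightarrow> nat"
  assumes "pivot_rule \<Pi>"
    and "ranking_based_BDL \<Pi>"
  shows "\<exists>C::real. C > 0 \<and>
           (\<forall>k::nat. \<exists>P B0 T. admissible_lp P \<and> feasible_basis P B0 \<and> k \<le> nnz P \<and>
              simplex_runs_at_least \<Pi> P B0 T \<and> real T \<ge> C * 2 powr sqrt (real (nnz P)))"
proof -
  obtain r where r: "selects_rank \<Pi> r" using ex_selects_rank[OF assms] by blast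
  have "\<exists>P B0 T. admissible_lp P \<and> feasible_basis P B0 \<and> k \<le> nnz P \<and>
      simplex_runs_at_least \<Pi> P B0 T \<and> real T \<ge> 1/2 * 2 powr sqrt (real (nnz P))" for k
  proof -
    obtain P B M where P: "admissible_lp P" "feasible_basis P B" "k \<le> nnz P" "nnz P \<le> M\<^sup>2" "1 \<le> M"
      "simplex_runs_at_least \<Pi> P B (2 ^ M - 1)"
      using sqrt_exponential_family[OF r, of k] by blast
    have "real (nnz P) \<le> (real M)\<^sup>2" using P(4) by (metis of_nat_le_iff of_nat_power)
    then have "sqrt (real (nnz P)) \<le> real M" by (intro real_le_lsqrt) auto
    then have "2 powr sqrt (real (nnz P)) \<le> 2 powr real M" by (intro powr_mono) auto
    also have "\<dots> = 2 ^ M" by (simp add: powr_realpow)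
    finally have "2 powr sqrt (real (nnz P)) \<le> 2 ^ M" .
    \<comment> \<open>With \<open>M \<ge> 1\<close> the number \<open>2 ^ M - 1\<close> is at least
      half of \<open>2 ^ M\<close>, whence the constant \<open>1/2\<close>.\<close>
    moreover have "(2::real) ^ 1 \<le> 2 ^ M" using P(5) by (intro power_increasing) auto
    moreover have "real (2 ^ M - 1) = 2 ^ M - 1" by (simp add: of_nat_diff)
    ultimately have "real (2 ^ M - 1) \<ge> 1/2 * 2 powr sqrt (real (nnz P))" by simp
    then show ?thesis using P by blast
  qed
  then show ?thesis by (intro exI[of _ "1/2"]) auto
qed

end
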